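(* Let $u$ be a Leray–Hopf solution of the Navier–Stokes equations (unit viscosity, no force) on $\mathbb R^3$, on a time interval containing $[t_0-1,t_0]$. Fix $x_0\in\mathbb R^3$, $0<\sigma\le\rho\le\frac14$, $r_k=2^{-k}$, $\ell_k=\sigma r_k$, $p\in[2,4]$, and $\eta_{\mathrm{near}},\eta_{\mathrm{com}}>0$ with $\eta_{\mathrm{near}}+\eta_{\mathrm{com}}<1$. There are a constant $C_{\mathrm{near}}=C_{\eta_{\mathrm{near}},\sigma,\rho,\varphi,\chi}$, used in the definition of the surplus $$\mathfrak S_k:=\Bigl[E_{k,\mathrm{out}}^\omega+(1-\eta_{\mathrm{near}}-\eta_{\mathrm{com}})P_k-E_{k,\mathrm{in}}^\omega-C_{\mathrm{near}}\,M_k\,\mathcal O_k\Bigr]_+,$$ a constant $C_{\rho,\sigma,\chi,\varphi}$ and a constant $C_{\eta_{\mathrm{com}},\varphi}$ (each depending only on the indicated data) such that for every finite $N$ and every nonnegative sequence $w=(w_k)_{k\ge0}$ with $\|w\|_{\mathcal W_{3/2}}:=\sum_{k\ge0}2^{3k/2}w_k<\infty$, $$\sum_{k=0}^{N}w_k\mathfrak S_k\le C_{\rho,\sigma,\chi,\varphi}\,M_E^{3/2}\,\|w\|_{\mathcal W_{3/2}}+C_{\eta_{\mathrm{com}},\varphi}\sum_{k=0}^{N}w_k\widetilde{\mathcal S}_k^{(p)}+\sum_{k=0}^{N}w_k\bigl(L_k+L_{k,\mathrm{inc}}^{\mathrm{com}}\bigr).$$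
   Context: Filter: $\varphi\in C_c^\infty(B_1(0))$, $\varphi\ge0$, $\int\varphi=1$, $\varphi_\ell(x)=\ell^{-3}\varphi(x/\ell)$; convolutions are in space. $U_k=\varphi_{\ell_k}*u$, $\Omega_k=\operatorname{curl}U_k$, $R_k=\varphi_{\ell_k}*(u\otimes u)-U_k\otimes U_k$. Cylinders and cutoffs: $B_s=B_s(x_0)$, $I_k=(t_0-r_k^2,t_0)$, $Q_k=B_{r_k}\times I_k$. Fix $[\tau_0,\tau_1]\subset(-1,0)$ and one smooth profile $\chi:\mathbb R^3\times[\tau_0,\tau_1]\to[0,1]$ with spatial support in a compact subset of $B_1(0)$; $\chi_k(x,t)=\chi((x-x_0)/r_k,(t-t_0)/r_k^2)$ on the time slab $J_k=[t_0+\tau_0r_k^2,\,t_0+\tau_1r_k^2]=:[s_{0,k},s_{1,k}]$. All $\chi_k$-weighted space-time integrals at scale $k$ are over $J_k$. Energy: $M_E=\mathrm{ess\,sup}_t\|u(t)\|_{L^2(\mathbb R^3)}^2$, $M_k=\frac1{r_k}\mathrm{ess\,sup}_{t\in I_k}\int_{B_{(1+2\rho)r_k}}|u|^2dx$. Endpoint, diffusion and reservoir terms: $E_{k,\mathrm{in}}^\omega=\frac{r_k}2\int\chi_k|\Omega_k|^2dx\big|_{t=s_{0,k}}$, $E_{k,\mathrm{out}}^\omega=\frac{r_k}2\int\chi_k|\Omega_k|^2dx\big|_{t=s_{1,k}}$, $P_k=r_k\iint\chi_k|\nabla\Omega_k|^2$, $\mathcal O_k=r_k^{-1}\iint\chi_k|\Omega_k|^2$.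 Increment defect: with $\delta_zu(x,t)=u(x-z,t)-u(x,t)$ and $\ell=\ell_k$, let $d\nu_\ell=\varphi_\ell(z)dz$, $d\mu_\ell=\ell|\nabla\varphi_\ell(z)|\,\|\nabla\varphi\|_{L^1}^{-1}dz$, $$\mathfrak M_{\ell,p}(x,t)=\Bigl(\int|\delta_zu|^pd\nu_\ell\Bigr)^{1/p}+\Bigl(\int|\delta_zu|^pd\mu_\ell\Bigr)^{1/p},\qquad \widetilde{\mathcal S}_k^{(p)}=\frac{r_k}{\ell_k^2}\iint\chi_k\,\mathfrak M_{\ell_k,p}^4\,dx\,dt\in[0,\infty].$$ Localization budgets: $$L_{k,\mathrm{inc}}^{\mathrm{com}}=C_\chi r_k^{-1}\iint_{\operatorname{supp}\nabla\chi_k}|\Omega_k|^2+C_\chi r_k\iint_{\operatorname{supp}\nabla\chi_k}|\nabla\cdot R_k|^2,$$ with $C_\chi$ depending only on the profile $\chi$ (chosen large enough), and $L_k\ge0$ is the sum of (a) the absolute value of the cutoff residual $\frac{r_k}2\iint|\Omega_k|^2(\partial_t\chi_k+\Delta\chi_k+U_k\cdot\nabla\chi_k)$, (b) the annular diffusion cost $r_k\int_{J_k}\int_{B_{(1+\rho)r_k}}|\nabla\Omega_k|^2dx\,dt-P_k$, and (c) the commutator shell terms $L_{k,\mathrm{inc}}^{\mathrm{com}}$. *)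

theory Defs
  imports "HOL-Analysis.Analysis" "HOL-Probability.Essential_Supremum"
begin

section \<open>Smooth functions and differential operators\<close>

primrec Ck :: "nat \<Rightarrow> ('a::euclidean_space \<Rightarrow> 'b::real_normed_vector) \<Rightarrow> bool" where
  "Ck 0 f \<longleftrightarrow> continuous_on UNIV f"
| "Ck (Suc n) f \<longleftrightarrow> (\<forall>x. f differentiable (at x)) \<and>
     (\<forall>b\<in>Basis. Ck n (\<lambda>x. frechet_derivative f (at x) b))"

definition smooth :: "('a::euclidean_space \<Rightarrow> 'b::real_normed_vector) \<Rightarrow> bool" where
  "smooth f \<longleftrightarrow> (\<forall>n. Ck n f)"

definition supp :: "('a::topological_space \<Rightarrow> 'b::zero) \<Rightarrow> 'a set" where
  "supp f = closure {x. f x \<noteq> 0}"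

definition test_fun :: "'a set \<Rightarrow> ('a::euclidean_space \<Rightarrow> 'b::real_normed_vector) \<Rightarrow> bool" where
  "test_fun A f \<longleftrightarrow> smooth f \<and> compact (supp f) \<and> supp f \<subseteq> A"

definition pd :: "'n::finite \<Rightarrow> (real^'n \<Rightarrow> 'b::real_normed_vector) \<Rightarrow> real^'n \<Rightarrow> 'b" where
  "pd i f x = frechet_derivative f (at x) (axis i 1)"

definition grad :: "(real^'n::finite \<Rightarrow> real) \<Rightarrow> real^'n \<Rightarrow> real^'n" where
  "grad f x = (\<chi> i. pd i f x)"

definition lapl :: "(real^'n::finite \<Rightarrow> 'b::real_normed_vector) \<Rightarrow> real^'n \<Rightarrow> 'b" where
  "lapl f x = (\<Sum>i\<in>UNIV. pd i (pd i f) x)"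

definition divg :: "(real^'n::finite \<Rightarrow> real^'n) \<Rightarrow> real^'n \<Rightarrow> real" where
  "divg V x = (\<Sum>i\<in>UNIV. pd i (\<lambda>y. V y $ i) x)"

definition div_mat :: "(real^'n::finite \<Rightarrow> real^'n^'n) \<Rightarrow> real^'n \<Rightarrow> real^'n" where
  "div_mat R x = (\<chi> i. \<Sum>j\<in>UNIV. pd j (\<lambda>y. R y $ i $ j) x)"

definition curl :: "(real^3 \<Rightarrow> real^3) \<Rightarrow> real^3 \<Rightarrow> real^3" where
  "curl V x = vector
     [pd 2 (\<lambda>y. V y $ 3) x - pd 3 (\<lambda>y. V y $ 2) x,
      pd 3 (\<lambda>y. V y $ 1) x - pd 1 (\<lambda>y. V y $ 3) x,
      pd 1 (\<lambda>y. V y $ 2) x - pd 2 (\<lambda>y. V y $ 1) x]"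

definition grad_sq :: "(real^'n::finite \<Rightarrow> real^'m::finite) \<Rightarrow> real^'n \<Rightarrow> real" where
  "grad_sq V x = (\<Sum>i\<in>UNIV. (norm (pd i V x))\<^sup>2)"

definition outer :: "real^'n::finite \<Rightarrow> real^'n \<Rightarrow> real^'n^'n" where
  "outer a b = (\<chi> i j. a $ i * b $ j)"

section \<open>Leray--Hopf solutions\<close>

text \<open>Space-time functions take time first, so that \<open>u t\<close> is the field at time \<open>t\<close>.\<close>

definition square_integrable :: "(real^3 \<Rightarrow> real^3) \<Rightarrow> bool" where
  "square_integrable v \<longleftrightarrow>
     v \<in> borel_measurable borel \<and> integrable lborel (\<lambda>x. (norm (v x))\<^sup>2)"

definition weak_gradient :: "(real^3 \<Rightarrow> real^3) \<Rightarrow> (real^3 \<Rightarrow> real^3^3) \<Rightarrow> bool" where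
  "weak_gradient v G \<longleftrightarrow> (\<forall>\<psi>. test_fun UNIV \<psi> \<longrightarrow> (\<forall>i j.
     (\<integral>x. v x $ i * pd j \<psi> x \<partial>lborel) = - (\<integral>x. G x $ i $ j * \<psi> x \<partial>lborel)))"

definition weakly_div_free :: "(real^3 \<Rightarrow> real^3) \<Rightarrow> bool" where
  "weakly_div_free v \<longleftrightarrow>
     (\<forall>\<psi>. test_fun UNIV \<psi> \<longrightarrow> (\<integral>x. v x \<bullet> grad \<psi> x \<partial>lborel) = 0)"

text \<open>The equation tested against solenoidal fields, which eliminates the pressure.\<close>

definition weak_navier_stokes :: "real set \<Rightarrow> (real \<Rightarrow> real^3 \<Rightarrow> real^3) \<Rightarrow> bool" where
  "weak_navier_stokes I u \<longleftrightarrow>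
     (\<forall>\<psi> :: real \<times> (real^3) \<Rightarrow> real^3.
        test_fun (interior I \<times> UNIV) \<psi> \<and> (\<forall>t x. divg (\<lambda>y. \<psi> (t, y)) x = 0) \<longrightarrow>
        set_lebesgue_integral lborel (I \<times> UNIV) (\<lambda>(t, x).
            u t x \<bullet> vector_derivative (\<lambda>s. \<psi> (s, x)) (at t)
          + (\<Sum>i\<in>UNIV. \<Sum>j\<in>UNIV. u t x $ i * u t x $ j * pd j (\<lambda>y. \<psi> (t, y) $ i) x)
          + u t x \<bullet> lapl (\<lambda>y. \<psi> (t, y)) x) = 0)"

text \<open>
  \<open>I\<close> is an interval with initial time \<open>a \<in> I\<close>. The solution is represented by its weakly
  continuous version, so that every \<open>u t\<close> is meaningful, and by a jointly Borel representative;
  weak continuity at \<open>a\<close> encodes that \<open>u a\<close> is the initial datum. Only the energy inequality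
  starting from \<open>a\<close> is required.
\<close>

definition leray_hopf :: "real \<Rightarrow> real set \<Rightarrow> (real \<Rightarrow> real^3 \<Rightarrow> real^3) \<Rightarrow> bool" where
  "leray_hopf a I u \<longleftrightarrow>
     is_interval I \<and> a \<in> I \<and> (\<forall>t\<in>I. a \<le> t) \<and>
     (\<lambda>(t, x). u t x) \<in> borel_measurable (restrict_space borel (I \<times> UNIV)) \<and>
     (\<forall>t\<in>I. square_integrable (u t)) \<and>
     (\<exists>B. \<forall>t\<in>I. (\<integral>x. (norm (u t x))\<^sup>2 \<partial>lborel) \<le> B) \<and>
     (\<forall>v. square_integrable v \<longrightarrow> continuous_on I (\<lambda>t. \<integral>x. u t x \<bullet> v x \<partial>lborel)) \<and>
     (\<forall>t\<in>I. weakly_div_free (u t)) \<and>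
     weak_navier_stokes I u \<and>
     (\<exists>G :: real \<Rightarrow> real^3 \<Rightarrow> real^3^3.
        (\<lambda>(t, x). G t x) \<in> borel_measurable (restrict_space borel (I \<times> UNIV)) \<and>
        set_integrable lborel (I \<times> UNIV) (\<lambda>(t, x). (norm (G t x))\<^sup>2) \<and>
        (AE t in lborel. t \<in> I \<longrightarrow> weak_gradient (u t) (G t)) \<and>
        (\<forall>t\<in>I. (\<integral>x. (norm (u t x))\<^sup>2 \<partial>lborel) / 2
            + set_lebesgue_integral lborel ({a..t} \<times> UNIV) (\<lambda>(s, x). (norm (G s x))\<^sup>2)
            \<le> (\<integral>x. (norm (u a x))\<^sup>2 \<partial>lborel) / 2))"

section \<open>Filter\<close>

definition filter_kernel :: "(real^3 \<Rightarrow> real) \<Rightarrow> bool" where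
  "filter_kernel \<phi> \<longleftrightarrow>
     test_fun (ball 0 1) \<phi> \<and> (\<forall>x. 0 \<le> \<phi> x) \<and> (\<integral>x. \<phi> x \<partial>lborel) = 1"

definition scaled :: "(real^3 \<Rightarrow> real) \<Rightarrow> real \<Rightarrow> real^3 \<Rightarrow> real" where
  "scaled \<phi> l x = \<phi> (x /\<^sub>R l) / l ^ 3"

definition conv :: "(real^3 \<Rightarrow> real) \<Rightarrow> (real^3 \<Rightarrow> 'b::euclidean_space) \<Rightarrow> real^3 \<Rightarrow> 'b" where
  "conv f g x = (\<integral>y. f (x - y) *\<^sub>R g y \<partial>lborel)"

definition Ufil :: "(real^3 \<Rightarrow> real) \<Rightarrow> real \<Rightarrow> (real \<Rightarrow> real^3 \<Rightarrow> real^3) \<Rightarrow> real \<Rightarrow> real^3 \<Rightarrow> real^3" where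
  "Ufil \<phi> l u t = conv (scaled \<phi> l) (u t)"

definition Omfil :: "(real^3 \<Rightarrow> real) \<Rightarrow> real \<Rightarrow> (real \<Rightarrow> real^3 \<Rightarrow> real^3) \<Rightarrow> real \<Rightarrow> real^3 \<Rightarrow> real^3" where
  "Omfil \<phi> l u t = curl (Ufil \<phi> l u t)"

definition Rfil :: "(real^3 \<Rightarrow> real) \<Rightarrow> real \<Rightarrow> (real \<Rightarrow> real^3 \<Rightarrow> real^3) \<Rightarrow> real \<Rightarrow> real^3 \<Rightarrow> real^3^3" where
  "Rfil \<phi> l u t x = conv (scaled \<phi> l) (\<lambda>y. outer (u t y) (u t y)) x
     - outer (Ufil \<phi> l u t x) (Ufil \<phi> l u t x)"

section \<open>Cylinders and cutoffs\<close>

definition rad :: "nat \<Rightarrow> real" where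
  "rad k = 1 / 2 ^ k"

text \<open>
  \<open>chi\<close> is the profile on \<open>[\<tau>0, \<tau>1] \<times> \<real>\<^sup>3\<close>; its values at other times are
  irrelevant to everything below. Smoothness on the closed slab, including its time boundary,
  means being the restriction of a smooth function on the whole space-time.
\<close>

definition cutoff_profile :: "real \<Rightarrow> real \<Rightarrow> (real \<Rightarrow> real^3 \<Rightarrow> real) \<Rightarrow> bool" where
  "cutoff_profile \<tau>0 \<tau>1 chi \<longleftrightarrow>
     -1 < \<tau>0 \<and> \<tau>0 < \<tau>1 \<and> \<tau>1 < 0 \<and>
     (\<exists>g :: real \<times> (real^3) \<Rightarrow> real. smooth g \<and> (\<forall>t\<in>{\<tau>0..\<tau>1}. \<forall>x. chi t x = g (t, x))) \<and>
     (\<forall>t\<in>{\<tau>0..\<tau>1}. \<forall>x. 0 \<le> chi t x \<and> chi t x \<le> 1) \<and>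
     (\<exists>K. compact K \<and> K \<subseteq> ball 0 1 \<and> (\<forall>t\<in>{\<tau>0..\<tau>1}. \<forall>x. x \<notin> K \<longrightarrow> chi t x = 0))"

definition cutk :: "(real \<Rightarrow> real^3 \<Rightarrow> real) \<Rightarrow> real^3 \<Rightarrow> real \<Rightarrow> real \<Rightarrow> real \<Rightarrow> real^3 \<Rightarrow> real" where
  "cutk chi x0 t0 r t x = chi ((t - t0) / r\<^sup>2) ((x - x0) /\<^sub>R r)"

definition slab :: "real \<Rightarrow> real \<Rightarrow> real \<Rightarrow> real \<Rightarrow> real set" where
  "slab \<tau>0 \<tau>1 t0 r = {t0 + \<tau>0 * r\<^sup>2 .. t0 + \<tau>1 * r\<^sup>2}"

definition shell :: "real \<Rightarrow> real \<Rightarrow> (real \<Rightarrow> real^3 \<Rightarrow> real) \<Rightarrow> real^3 \<Rightarrow> real \<Rightarrow> real \<Rightarrow> (real \<times> (real^3)) set" where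
  "shell \<tau>0 \<tau>1 chi x0 t0 r =
     closure {(t, x). t \<in> slab \<tau>0 \<tau>1 t0 r \<and> grad (cutk chi x0 t0 r t) x \<noteq> 0}"

abbreviation stint :: "(real \<times> (real^3)) set \<Rightarrow> (real \<Rightarrow> real^3 \<Rightarrow> real) \<Rightarrow> real" where
  "stint A f \<equiv> set_lebesgue_integral lborel A (\<lambda>(t, x). f t x)"

section \<open>Scale-wise quantities\<close>

text \<open>
  Below \<open>r\<close> and \<open>l\<close> stand for \<open>r_k\<close> and \<open>\<ell>_k\<close>. For a Leray--Hopf solution the filtered
  fields are bounded on the relevant bounded regions and the essential suprema are finite, so the
  real-valued integrals and \<open>enn2real\<close> carry no convention; only \<open>increment_defect\<close> may be infinite.
\<close>

definition ME :: "real set \<Rightarrow> (real \<Rightarrow> real^3 \<Rightarrow> real^3) \<Rightarrow> real" where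
  "ME I u = enn2real (esssup (restrict_space lborel I)
     (\<lambda>t. \<integral>\<^sup>+x. ennreal ((norm (u t x))\<^sup>2) \<partial>lborel))"

definition Mloc :: "real \<Rightarrow> real^3 \<Rightarrow> real \<Rightarrow> real \<Rightarrow> (real \<Rightarrow> real^3 \<Rightarrow> real^3) \<Rightarrow> real" where
  "Mloc \<rho> x0 t0 r u = 1 / r * enn2real (esssup (restrict_space lborel {t0 - r\<^sup>2 <..< t0})
     (\<lambda>t. \<integral>\<^sup>+x\<in>ball x0 ((1 + 2 * \<rho>) * r). ennreal ((norm (u t x))\<^sup>2) \<partial>lborel))"

definition Eom :: "(real^3 \<Rightarrow> real) \<Rightarrow> (real \<Rightarrow> real^3 \<Rightarrow> real) \<Rightarrow> real^3 \<Rightarrow> real \<Rightarrow>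
    (real \<Rightarrow> real^3 \<Rightarrow> real^3) \<Rightarrow> real \<Rightarrow> real \<Rightarrow> real \<Rightarrow> real" where
  "Eom \<phi> chi x0 t0 u r l s =
     r / 2 * (\<integral>x. cutk chi x0 t0 r s x * (norm (Omfil \<phi> l u s x))\<^sup>2 \<partial>lborel)"

definition Ein where
  "Ein \<phi> \<tau>0 chi x0 t0 u r l = Eom \<phi> chi x0 t0 u r l (t0 + \<tau>0 * r\<^sup>2)"

definition Eout where
  "Eout \<phi> \<tau>1 chi x0 t0 u r l = Eom \<phi> chi x0 t0 u r l (t0 + \<tau>1 * r\<^sup>2)"

definition Pdiff :: "(real^3 \<Rightarrow> real) \<Rightarrow> real \<Rightarrow> real \<Rightarrow> (real \<Rightarrow> real^3 \<Rightarrow> real) \<Rightarrow> real^3 \<Rightarrow> real \<Rightarrow>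
    (real \<Rightarrow> real^3 \<Rightarrow> real^3) \<Rightarrow> real \<Rightarrow> real \<Rightarrow> real" where
  "Pdiff \<phi> \<tau>0 \<tau>1 chi x0 t0 u r l =
     r * stint (slab \<tau>0 \<tau>1 t0 r \<times> UNIV)
       (\<lambda>t x. cutk chi x0 t0 r t x * grad_sq (Omfil \<phi> l u t) x)"

definition Ores :: "(real^3 \<Rightarrow> real) \<Rightarrow> real \<Rightarrow> real \<Rightarrow> (real \<Rightarrow> real^3 \<Rightarrow> real) \<Rightarrow> real^3 \<Rightarrow> real \<Rightarrow>
    (real \<Rightarrow> real^3 \<Rightarrow> real^3) \<Rightarrow> real \<Rightarrow> real \<Rightarrow> real" where
  "Ores \<phi> \<tau>0 \<tau>1 chi x0 t0 u r l =
     1 / r * stint (slab \<tau>0 \<tau>1 t0 r \<times> UNIV)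
       (\<lambda>t x. cutk chi x0 t0 r t x * (norm (Omfil \<phi> l u t x))\<^sup>2)"

subsection \<open>Increment defect\<close>

text \<open>Real power on \<open>[0, \<infinity>]\<close>, for positive exponents.\<close>

definition epowr :: "ennreal \<Rightarrow> real \<Rightarrow> ennreal" where
  "epowr y q = (if y = \<infinity> then \<infinity> else ennreal (enn2real y powr q))"

definition nu :: "(real^3 \<Rightarrow> real) \<Rightarrow> real \<Rightarrow> (real^3) measure" where
  "nu \<phi> l = density lborel (\<lambda>z. ennreal (scaled \<phi> l z))"

definition mu :: "(real^3 \<Rightarrow> real) \<Rightarrow> real \<Rightarrow> (real^3) measure" where
  "mu \<phi> l = density lborel
     (\<lambda>z. ennreal (l * norm (grad (scaled \<phi> l) z) / (\<integral>y. norm (grad \<phi> y) \<partial>lborel)))"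

definition increment_norm :: "(real^3) measure \<Rightarrow> real \<Rightarrow> (real^3 \<Rightarrow> real^3) \<Rightarrow> real^3 \<Rightarrow> ennreal" where
  "increment_norm m p v x =
     epowr (\<integral>\<^sup>+z. ennreal (norm (v (x - z) - v x) powr p) \<partial>m) (1 / p)"

definition MM :: "(real^3 \<Rightarrow> real) \<Rightarrow> real \<Rightarrow> real \<Rightarrow> (real \<Rightarrow> real^3 \<Rightarrow> real^3) \<Rightarrow> real \<Rightarrow> real^3 \<Rightarrow> ennreal" where
  "MM \<phi> l p u t x = increment_norm (nu \<phi> l) p (u t) x + increment_norm (mu \<phi> l) p (u t) x"

definition increment_defect :: "(real^3 \<Rightarrow> real) \<Rightarrow> real \<Rightarrow> real \<Rightarrow> (real \<Rightarrow> real^3 \<Rightarrow> real) \<Rightarrow> real^3 \<Rightarrow>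
    real \<Rightarrow> real \<Rightarrow> (real \<Rightarrow> real^3 \<Rightarrow> real^3) \<Rightarrow> real \<Rightarrow> real \<Rightarrow> ennreal" where
  "increment_defect \<phi> \<tau>0 \<tau>1 chi x0 t0 p u r l =
     ennreal (r / l\<^sup>2) * (\<integral>\<^sup>+(t, x)\<in>slab \<tau>0 \<tau>1 t0 r \<times> UNIV.
       ennreal (cutk chi x0 t0 r t x) * MM \<phi> l p u t x ^ 4 \<partial>lborel)"

subsection \<open>Localization budgets and surplus\<close>

definition Lcom :: "real \<Rightarrow> (real^3 \<Rightarrow> real) \<Rightarrow> real \<Rightarrow> real \<Rightarrow> (real \<Rightarrow> real^3 \<Rightarrow> real) \<Rightarrow> real^3 \<Rightarrow>
    real \<Rightarrow> (real \<Rightarrow> real^3 \<Rightarrow> real^3) \<Rightarrow> real \<Rightarrow> real \<Rightarrow> real" where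
  "Lcom C \<phi> \<tau>0 \<tau>1 chi x0 t0 u r l =
     C * (1 / r) * stint (shell \<tau>0 \<tau>1 chi x0 t0 r) (\<lambda>t x. (norm (Omfil \<phi> l u t x))\<^sup>2)
   + C * r * stint (shell \<tau>0 \<tau>1 chi x0 t0 r) (\<lambda>t x. (norm (div_mat (Rfil \<phi> l u t) x))\<^sup>2)"

definition cutoff_residual :: "(real^3 \<Rightarrow> real) \<Rightarrow> real \<Rightarrow> real \<Rightarrow> (real \<Rightarrow> real^3 \<Rightarrow> real) \<Rightarrow> real^3 \<Rightarrow>
    real \<Rightarrow> (real \<Rightarrow> real^3 \<Rightarrow> real^3) \<Rightarrow> real \<Rightarrow> real \<Rightarrow> real" where
  "cutoff_residual \<phi> \<tau>0 \<tau>1 chi x0 t0 u r l =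
     r / 2 * stint (slab \<tau>0 \<tau>1 t0 r \<times> UNIV)
       (\<lambda>t x. (norm (Omfil \<phi> l u t x))\<^sup>2 *
          (vector_derivative (\<lambda>s. cutk chi x0 t0 r s x) (at t within slab \<tau>0 \<tau>1 t0 r)
           + lapl (cutk chi x0 t0 r t) x
           + Ufil \<phi> l u t x \<bullet> grad (cutk chi x0 t0 r t) x))"

definition annular_cost :: "(real^3 \<Rightarrow> real) \<Rightarrow> real \<Rightarrow> real \<Rightarrow> (real \<Rightarrow> real^3 \<Rightarrow> real) \<Rightarrow> real \<Rightarrow> real^3 \<Rightarrow>
    real \<Rightarrow> (real \<Rightarrow> real^3 \<Rightarrow> real^3) \<Rightarrow> real \<Rightarrow> real \<Rightarrow> real" where
  "annular_cost \<phi> \<tau>0 \<tau>1 chi \<rho> x0 t0 u r l =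
     r * stint (slab \<tau>0 \<tau>1 t0 r \<times> ball x0 ((1 + \<rho>) * r)) (\<lambda>t x. grad_sq (Omfil \<phi> l u t) x)
   - Pdiff \<phi> \<tau>0 \<tau>1 chi x0 t0 u r l"

definition Lbud :: "real \<Rightarrow> (real^3 \<Rightarrow> real) \<Rightarrow> real \<Rightarrow> real \<Rightarrow> (real \<Rightarrow> real^3 \<Rightarrow> real) \<Rightarrow> real \<Rightarrow> real^3 \<Rightarrow>
    real \<Rightarrow> (real \<Rightarrow> real^3 \<Rightarrow> real^3) \<Rightarrow> real \<Rightarrow> real \<Rightarrow> real" where
  "Lbud C \<phi> \<tau>0 \<tau>1 chi \<rho> x0 t0 u r l =
     \<bar>cutoff_residual \<phi> \<tau>0 \<tau>1 chi x0 t0 u r l\<bar>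
   + annular_cost \<phi> \<tau>0 \<tau>1 chi \<rho> x0 t0 u r l
   + Lcom C \<phi> \<tau>0 \<tau>1 chi x0 t0 u r l"

definition surplus :: "real \<Rightarrow> real \<Rightarrow> real \<Rightarrow> (real^3 \<Rightarrow> real) \<Rightarrow> real \<Rightarrow> real \<Rightarrow>
    (real \<Rightarrow> real^3 \<Rightarrow> real) \<Rightarrow> real \<Rightarrow> real^3 \<Rightarrow> real \<Rightarrow> (real \<Rightarrow> real^3 \<Rightarrow> real^3) \<Rightarrow> real \<Rightarrow> real \<Rightarrow> real" where
  "surplus Cnear \<eta>near \<eta>com \<phi> \<tau>0 \<tau>1 chi \<rho> x0 t0 u r l =
     max 0 (Eout \<phi> \<tau>1 chi x0 t0 u r l
       + (1 - \<eta>near - \<eta>com) * Pdiff \<phi> \<tau>0 \<tau>1 chi x0 t0 u r l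
       - Ein \<phi> \<tau>0 chi x0 t0 u r l
       - Cnear * Mloc \<rho> x0 t0 r u * Ores \<phi> \<tau>0 \<tau>1 chi x0 t0 u r l)"

definition Wnorm :: "(nat \<Rightarrow> real) \<Rightarrow> real" where
  "Wnorm w = (\<Sum>k. 2 powr (3 * real k / 2) * w k)"

end

(* The filtered vorticity Omega satisfies the vorticity equation with the subfilter force curl div R.
   Multiplying it by chi Omega and integrating by parts gives a local enstrophy balance, in which only two
   terms are not of the form already present in the statement. The commutator term is moved onto
   chi curl Omega . div R by one more integration by parts; Young's inequality absorbs it into the diffusion,
   at the cost of chi |div R|^2, and R is unchanged when a constant is subtracted from u, so div R is
   quadratic in the increments of u. The stretching term is cubic in grad U, and the crude bound
   |grad U| <= C l^(-5/2) ||u||_2 already makes it r_k^(-3/2) M_E^(3/2) = 2^(3k/2) M_E^(3/2); hence no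
   near-field cancellation is needed and C_near may be any positive constant. *)

theory Submission
  imports Defs
begin

section \<open>Smooth functions and test functions\<close>

text \<open>Filtering makes all fields smooth in space, but a Leray-Hopf solution has no classical
  time derivative: at a fixed point the filtered vorticity is only a primitive of a bounded
  measurable function. This obstacle shapes the proof. The vorticity equation is kept integrated in
  time, the time half of the balance is a product rule for primitives at each x, the space half an
  integration by parts at each t, and Fubini in both orders joins them. The exponent is a count of
  powers: the cube of the bound on grad U carries r^(-15/2), while slab length r^2, ball volume r^3
  and the prefactor r give r^6. \<open>C_chi\<close> is a bound for the gradient of the profile. It
  pays for the boundary term of the commutator, which lives where that gradient is nonzero; this
  term is charged to the separate copy of L^com, and the cutoff residual to L_k. Qualitative facts
  use a bound \<open>B\<close> on the energy at all times; M_E is an essential supremum and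
  therefore enters through statements valid for almost every t.\<close>

lemma Ck_SucI:
  assumes "\<And>x. (f has_derivative f' x) (at x)" "\<And>b. b \<in> Basis \<Longrightarrow> Ck n (\<lambda>x. f' x b)"
  shows "Ck (Suc n) f"
  using assms frechet_derivative_at[OF assms(1)] by (auto simp: differentiable_def)

lemma Ck_SucD:
  assumes "Ck (Suc n) f"
  shows "(f has_derivative frechet_derivative f (at x)) (at x)"
    "b \<in> Basis \<Longrightarrow> Ck n (\<lambda>x. frechet_derivative f (at x) b)"
  using assms by (auto simp: frechet_derivative_works)

lemma Ck_Suc_imp: "Ck (Suc n) f \<Longrightarrow> Ck n f"
proof (induction n arbitrary: f)
  case 0
  then show ?case
    by (auto simp: continuous_on_eq_continuous_at intro: differentiable_imp_continuous_within)
next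
  case (Suc n)
  then show ?case by (metis Ck.simps(2))
qed

lemma Ck_const: "Ck n (\<lambda>x. c)"
proof (induction n arbitrary: c)
  case (Suc n)
  show ?case
    by (rule Ck_SucI[where f'="\<lambda>x h. 0"]) (auto intro: Suc)
qed auto

lemma Ck_add: "Ck n f \<Longrightarrow> Ck n g \<Longrightarrow> Ck n (\<lambda>x. f x + g x)"
proof (induction n arbitrary: f g)
  case 0 then show ?case by (auto intro: continuous_intros)
next
  case (Suc n)
  show ?case
    by (rule Ck_SucI, rule has_derivative_add[OF Ck_SucD(1)[OF Suc.prems(1)] Ck_SucD(1)[OF Suc.prems(2)]])
      (intro Suc.IH Ck_SucD(2)[OF Suc.prems(1)] Ck_SucD(2)[OF Suc.prems(2)])
qed

lemma Ck_sum: "(\<And>i. i \<in> A \<Longrightarrow> Ck n (f i)) \<Longrightarrow> Ck n (\<lambda>x. \<Sum>i\<in>A. f i x)"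
  by (induction A rule: infinite_finite_induct) (auto intro: Ck_add Ck_const)

lemma Ck_bounded_linear:
  assumes L: "bounded_linear L"
  shows "Ck n f \<Longrightarrow> Ck n (\<lambda>x. L (f x))"
proof (induction n arbitrary: f)
  case 0 then show ?case by (auto intro: bounded_linear.continuous_on[OF L])
next
  case (Suc n)
  show ?case
    by (rule Ck_SucI, rule bounded_linear.has_derivative[OF L Ck_SucD(1)[OF Suc.prems(1)]])
      (intro Suc.IH Ck_SucD(2)[OF Suc.prems(1)])
qed

lemma Ck_scaleR:
  fixes f :: "'a::euclidean_space \<Rightarrow> real" and g :: "'a \<Rightarrow> 'b::real_normed_vector"
  shows "Ck n f \<Longrightarrow> Ck n g \<Longrightarrow> Ck n (\<lambda>x. f x *\<^sub>R g x)"
proof (induction n arbitrary: f g)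
  case 0 then show ?case by (auto intro: continuous_intros)
next
  case (Suc n)
  show ?case
    by (rule Ck_SucI, rule has_derivative_scaleR[OF Ck_SucD(1)[OF Suc.prems(1)] Ck_SucD(1)[OF Suc.prems(2)]])
      (intro Ck_add Suc.IH Ck_SucD(2)[OF Suc.prems(1)] Ck_SucD(2)[OF Suc.prems(2)]
        Ck_Suc_imp[OF Suc.prems(1)] Ck_Suc_imp[OF Suc.prems(2)])
qed

text \<open>By the chain rule the derivative in direction \<open>b\<close> is the derivative of
  \<open>f\<close> in direction \<open>L b\<close>, which is not a basis vector; expanding it in
  coordinates leads back to the basis directions that \<open>Ck\<close> controls.\<close>

lemma Ck_affine:
  fixes L :: "'a::euclidean_space \<Rightarrow> 'c::euclidean_space"
  assumes L: "bounded_linear L"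
  shows "Ck n f \<Longrightarrow> Ck n (\<lambda>x. f (c + L x))"
proof (induction n arbitrary: f)
  case 0
  then have "continuous_on UNIV f" by simp
  moreover have "continuous_on UNIV (\<lambda>x. c + L x)"
    by (intro continuous_intros bounded_linear.continuous_on[OF L])
  ultimately show ?case
    by (auto intro: continuous_on_compose2)
next
  case (Suc n)
  have lin: "linear (frechet_derivative f (at x))" for x
    using Ck_SucD(1)[OF Suc.prems] by (intro bounded_linear.linear has_derivative_bounded_linear)
  have eq: "frechet_derivative f (at x) v = (\<Sum>b\<in>Basis. (v \<bullet> b) *\<^sub>R frechet_derivative f (at x) b)" for x v
    by (subst euclidean_representation[of v, symmetric])
      (simp add: linear_sum[OF lin] linear_scale[OF lin])
  show ?case
  proof (rule Ck_SucI)
    show "((\<lambda>x. f (c + L x)) has_derivative (\<lambda>h. frechet_derivative f (at (c + L x)) (L h))) (at x)" for x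
      by (rule has_derivative_compose[where f="\<lambda>x. c + L x" and g=f, OF _ Ck_SucD(1)[OF Suc.prems]])
        (auto intro!: derivative_eq_intros bounded_linear.has_derivative[OF L])
    fix b :: 'a assume "b \<in> Basis"
    show "Ck n (\<lambda>x. frechet_derivative f (at (c + L x)) (L b))"
      by (subst eq) (intro Ck_sum Ck_bounded_linear[OF bounded_linear_scaleR_right]
          Suc.IH[of "\<lambda>x. frechet_derivative f (at x) _"] Ck_SucD(2)[OF Suc.prems])
  qed
qed

lemma smooth_has_derivative: "smooth f \<Longrightarrow> (f has_derivative frechet_derivative f (at x)) (at x)"
  unfolding smooth_def using Ck_SucD(1) by blast

lemma smooth_differentiable: "smooth f \<Longrightarrow> f differentiable (at x)"
  using smooth_has_derivative differentiable_def by blast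

lemma smooth_continuous: "smooth f \<Longrightarrow> continuous_on S f"
  unfolding smooth_def by (metis Ck.simps(1) continuous_on_subset subset_UNIV)

lemma smooth_deriv: "smooth f \<Longrightarrow> b \<in> Basis \<Longrightarrow> smooth (\<lambda>x. frechet_derivative f (at x) b)"
  unfolding smooth_def using Ck_SucD(2) by blast

lemma smooth_const: "smooth (\<lambda>x. c)"
  by (simp add: smooth_def Ck_const)

lemma smooth_add: "smooth f \<Longrightarrow> smooth g \<Longrightarrow> smooth (\<lambda>x. f x + g x)"
  by (simp add: smooth_def Ck_add)

lemma smooth_sum: "(\<And>i. i \<in> A \<Longrightarrow> smooth (f i)) \<Longrightarrow> smooth (\<lambda>x. \<Sum>i\<in>A. f i x)"
  by (simp add: smooth_def Ck_sum)

lemma smooth_bounded_linear: "bounded_linear L \<Longrightarrow> smooth f \<Longrightarrow> smooth (\<lambda>x. L (f x))"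
  by (simp add: smooth_def Ck_bounded_linear)

lemma smooth_scaleR:
  fixes f :: "'a::euclidean_space \<Rightarrow> real"
  shows "smooth f \<Longrightarrow> smooth g \<Longrightarrow> smooth (\<lambda>x. f x *\<^sub>R g x)"
  by (simp add: smooth_def Ck_scaleR)

lemma smooth_mult:
  fixes f g :: "'a::euclidean_space \<Rightarrow> real"
  shows "smooth f \<Longrightarrow> smooth g \<Longrightarrow> smooth (\<lambda>x. f x * g x)"
  using smooth_scaleR[of f g] by simp

lemma smooth_minus: "smooth f \<Longrightarrow> smooth (\<lambda>x. - f x)"
  by (rule smooth_bounded_linear) (simp_all add: bounded_linear_minus bounded_linear_ident)

lemma smooth_diff: "smooth f \<Longrightarrow> smooth g \<Longrightarrow> smooth (\<lambda>x. f x - g x)"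
  using smooth_add[OF _ smooth_minus, of f g] by simp

lemma smooth_affine:
  fixes L :: "'a::euclidean_space \<Rightarrow> 'c::euclidean_space"
  shows "bounded_linear L \<Longrightarrow> smooth f \<Longrightarrow> smooth (\<lambda>x. f (c + L x))"
  by (simp add: smooth_def Ck_affine)

lemma frechet_derivative_affine:
  fixes L :: "'a::euclidean_space \<Rightarrow> 'c::euclidean_space"
  assumes L: "bounded_linear L" and f: "f differentiable (at (c + L x))"
  shows "frechet_derivative (\<lambda>x. f (c + L x)) (at x) = (\<lambda>h. frechet_derivative f (at (c + L x)) (L h))"
proof -
  have "((\<lambda>x. f (c + L x)) has_derivative (\<lambda>h. frechet_derivative f (at (c + L x)) (L h))) (at x)"
    by (rule has_derivative_compose[where f="\<lambda>x. c + L x" and g=f, OF _ f[unfolded frechet_derivative_works]])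
      (auto intro!: derivative_eq_intros bounded_linear.has_derivative[OF L])
  then show ?thesis by (rule frechet_derivative_at[symmetric])
qed

section \<open>Calculus of partial derivatives\<close>

lemma axis_Basis [simp]: "axis i (1::real) \<in> Basis"
  by (auto simp: Basis_vec_def)

lemma smooth_pd: "smooth f \<Longrightarrow> smooth (pd i f)"
  unfolding pd_def[abs_def] by (rule smooth_deriv) auto

lemma pd_has_derivative:
  "(f has_derivative f') (at x) \<Longrightarrow> pd i f x = f' (axis i 1)"
  unfolding pd_def by (simp add: frechet_derivative_at[symmetric])

lemma pd_add:
  assumes "smooth f" "smooth g" shows "pd i (\<lambda>x. f x + g x) x = pd i f x + pd i g x"
  using pd_has_derivative[OF has_derivative_add[OF smooth_has_derivative[OF assms(1)] smooth_has_derivative[OF assms(2)]], of i x]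
  by (simp add: pd_def)

lemma pd_diff:
  assumes "smooth f" "smooth g" shows "pd i (\<lambda>x. f x - g x) x = pd i f x - pd i g x"
  using pd_has_derivative[OF has_derivative_diff[OF smooth_has_derivative[OF assms(1)] smooth_has_derivative[OF assms(2)]], of i x]
  by (simp add: pd_def)

lemma pd_minus:
  assumes "smooth f" shows "pd i (\<lambda>x. - f x) x = - pd i f x"
  using pd_has_derivative[OF has_derivative_minus[OF smooth_has_derivative[OF assms(1)]], of i x]
  by (simp add: pd_def)

lemma pd_bounded_linear:
  assumes "bounded_linear L" "f differentiable (at x)" shows "pd i (\<lambda>x. L (f x)) x = L (pd i f x)"
  using pd_has_derivative[OF bounded_linear.has_derivative[OF assms(1) assms(2)[unfolded frechet_derivative_works]], of i]
  by (simp add: pd_def)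

lemma pd_nth:
  "f differentiable (at x) \<Longrightarrow> pd i (\<lambda>x. f x $ k) x = pd i f x $ k"
  by (rule pd_bounded_linear[OF bounded_linear_vec_nth])

lemma pd_const [simp]: "pd i (\<lambda>x. c) x = 0"
  using pd_has_derivative[OF has_derivative_const] .

lemma pd_sum:
  assumes "\<And>k. k \<in> A \<Longrightarrow> smooth (f k)" shows "pd i (\<lambda>x. \<Sum>k\<in>A. f k x) x = (\<Sum>k\<in>A. pd i (f k) x)"
  using assms
  by (induction A rule: infinite_finite_induct) (auto simp: pd_add smooth_sum)

lemma pd_mult:
  fixes f g :: "real^'n::finite \<Rightarrow> real"
  assumes "smooth f" "smooth g" shows "pd i (\<lambda>x. f x * g x) x = pd i f x * g x + f x * pd i g x"
  using pd_has_derivative[OF has_derivative_mult[OF smooth_has_derivative[OF assms(1)] smooth_has_derivative[OF assms(2)]], of i x]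
  by (simp add: pd_def)

lemma smooth_vec:
  fixes f :: "'a::euclidean_space \<Rightarrow> real^'n::finite"
  assumes "\<And>k. smooth (\<lambda>x. f x $ k)"
  shows "smooth f"
proof -
  have "smooth (\<lambda>x. \<Sum>k\<in>UNIV. (f x $ k) *\<^sub>R axis k (1::real))"
    by (intro smooth_sum smooth_scaleR smooth_const assms)
  moreover have "(\<Sum>k\<in>UNIV. (f x $ k) *\<^sub>R axis k (1::real)) = f x" for x
    using basis_expansion[of "f x"] by (simp add: scalar_mult_eq_scaleR)
  ultimately show ?thesis by simp
qed

section \<open>Supports and test functions\<close>

lemma supp_subset_closed: "closed S \<Longrightarrow> (\<And>x. x \<notin> S \<Longrightarrow> f x = 0) \<Longrightarrow> supp f \<subseteq> S"
  unfolding supp_def by (rule closure_minimal) auto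

lemma not_supp: "x \<notin> supp f \<Longrightarrow> f x = 0"
  using closure_subset[of "{x. f x \<noteq> 0}"] unfolding supp_def by fastforce

lemma closed_supp: "closed (supp f)"
  unfolding supp_def by simp

lemma test_funI:
  assumes "smooth f" "compact S" "S \<subseteq> A" "\<And>x. x \<notin> S \<Longrightarrow> f x = 0"
  shows "test_fun A f"
proof -
  have "supp f \<subseteq> S" by (rule supp_subset_closed) (use assms compact_imp_closed in auto)
  then show ?thesis
    using assms closed_supp[of f] compact_Int_closed[of S "supp f"]
    by (auto simp: test_fun_def inf.absorb2)
qed

lemma test_fun_smooth: "test_fun A f \<Longrightarrow> smooth f"
  by (simp add: test_fun_def)

text \<open>The complement of the support is open, so \<open>f\<close> vanishes near
  \<open>x\<close> and not just at it.\<close>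

lemma deriv_zero_off_supp:
  assumes "x \<notin> supp f" shows "frechet_derivative f (at x) h = 0"
proof -
  have "(f has_derivative (\<lambda>h. 0)) (at x)"
    by (rule has_derivative_transform_within_open[where f="\<lambda>x. 0" and s="- supp f"])
      (use assms closed_supp[of f] in \<open>auto simp: not_supp[of _ f]\<close>)
  then show ?thesis by (simp add: frechet_derivative_at[symmetric])
qed

lemma test_fun_pd: "test_fun A f \<Longrightarrow> test_fun A (pd i f)"
  by (rule test_funI[where S="supp f"]) (auto simp: test_fun_def smooth_pd pd_def deriv_zero_off_supp)

lemma test_fun_mult:
  fixes f g :: "'a::euclidean_space \<Rightarrow> real"
  shows "test_fun A f \<Longrightarrow> smooth g \<Longrightarrow> test_fun A (\<lambda>x. f x * g x)"
  by (rule test_funI[where S="supp f"]) (auto simp: test_fun_def smooth_mult not_supp[of _ f])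

lemma test_fun_minus:
  assumes "test_fun A f" shows "test_fun A (\<lambda>x. - f x)"
  by (rule test_funI[where S="supp f"])
    (use assms in \<open>auto simp: test_fun_def smooth_minus not_supp\<close>)

lemma test_fun_zero: "test_fun A (\<lambda>x. 0)"
  by (rule test_funI[where S="{}"]) (auto simp: smooth_const)

lemma test_fun_mono: "test_fun A f \<Longrightarrow> A \<subseteq> B \<Longrightarrow> test_fun B f"
  by (auto simp: test_fun_def)

lemma test_fun_bounded:
  assumes "test_fun A f" obtains M where "0 < M" "\<And>x. norm (f x) \<le> M"
proof -
  have "bounded (f ` supp f)"
    using assms by (intro compact_imp_bounded compact_continuous_image smooth_continuous)
      (auto simp: test_fun_def)
  then obtain M where M: "0 < M" "\<forall>x\<in>supp f. norm (f x) \<le> M"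
    by (auto simp: bounded_pos)
  have "norm (f x) \<le> M" for x
    using M not_supp[of x f] by (cases "x \<in> supp f") auto
  then show ?thesis using M(1) that by blast
qed

lemma test_fun_supp_ball:
  assumes "test_fun A f" obtains R where "0 < R" "\<And>x. R < norm x \<Longrightarrow> f x = 0"
proof -
  have "bounded (supp f)" using assms compact_imp_bounded unfolding test_fun_def by blast
  then obtain R where R: "0 < R" "\<forall>x\<in>supp f. norm x \<le> R"
    by (auto simp: bounded_pos)
  have "f x = 0" if "R < norm x" for x
    using that R(2) not_supp[of x f] by (meson not_le)
  then show ?thesis using R(1) that by blast
qed

lemma test_fun_integrable:
  fixes f :: "'a::euclidean_space \<Rightarrow> real"
  assumes "test_fun A f" shows "integrable lborel f"
proof -
  have "integrable lborel (\<lambda>x. indicator (supp f) x *\<^sub>R f x)"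
    using assms by (intro borel_integrable_compact smooth_continuous) (auto simp: test_fun_def)
  moreover have "(\<lambda>x. indicator (supp f) x *\<^sub>R f x) = f"
    using not_supp[of _ f] by (auto simp: indicator_def fun_eq_iff)
  ultimately show ?thesis by simp
qed

section \<open>Partial derivatives and convolution\<close>

lemma nn_integral_lborel_affine:
  fixes f :: "'a::euclidean_space \<Rightarrow> ennreal"
  assumes "f \<in> borel_measurable borel" "c \<noteq> 0"
  shows "(\<integral>\<^sup>+x. f x \<partial>lborel) = ennreal (\<bar>c\<bar> ^ DIM('a)) * (\<integral>\<^sup>+x. f (t + c *\<^sub>R x) \<partial>lborel)"
  by (subst lborel_affine[OF assms(2), of t])
    (use assms(1) in \<open>simp add: nn_integral_density nn_integral_distr nn_integral_cmult\<close>)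

lemma integral_lborel_affine:
  fixes f :: "'a::euclidean_space \<Rightarrow> real"
  assumes "f \<in> borel_measurable borel" "c \<noteq> 0"
  shows "(\<integral>x. f x \<partial>lborel) = \<bar>c\<bar> ^ DIM('a) * (\<integral>x. f (t + c *\<^sub>R x) \<partial>lborel)"
  by (subst lborel_affine[OF assms(2), of t])
    (use assms(1) in \<open>simp add: integral_density integral_distr\<close>)

lemma smooth_line_deriv:
  fixes f :: "real^'n::finite \<Rightarrow> real"
  assumes "smooth f"
  shows "((\<lambda>s. f (y + s *\<^sub>R axis i 1)) has_real_derivative pd i f (y + s *\<^sub>R axis i 1)) (at s)"
proof -
  have lin: "linear (frechet_derivative f (at x))" for x
    using smooth_has_derivative[OF assms] by (intro bounded_linear.linear has_derivative_bounded_linear)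
  have "((\<lambda>s. f (y + s *\<^sub>R axis i 1)) has_derivative
      (\<lambda>h. frechet_derivative f (at (y + s *\<^sub>R axis i 1)) (h *\<^sub>R axis i 1))) (at s)"
    by (rule has_derivative_compose[where g=f and f="\<lambda>s. y + s *\<^sub>R axis i 1", OF _ smooth_has_derivative[OF assms]])
      (auto intro!: derivative_eq_intros)
  then show ?thesis
    by (simp add: has_field_derivative_def pd_def linear_scale[OF lin] mult_commute_abs)
qed

text \<open>Schwarz's theorem: the second difference of \<open>f\<close> over a square of side
  \<open>h\<close> is symmetric in the two directions, and two applications of the mean value
  theorem turn it, in either order, into \<open>h * h\<close> times a mixed derivative at a point of
  the square.\<close>

lemma pd_commute:
  fixes f :: "real^'n::finite \<Rightarrow> real"
  assumes f: "smooth f"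
  shows "pd i (pd j f) x = pd j (pd i f) x"
proof -
  let ?e = "\<lambda>k. axis k (1::real) :: real^'n"
  have mean: "\<exists>s\<in>{0<..<h}. \<exists>t\<in>{0<..<h}.
      f (x + h *\<^sub>R ?e i + h *\<^sub>R ?e j) - f (x + h *\<^sub>R ?e i) - f (x + h *\<^sub>R ?e j) + f x
      = h * (h * pd j (pd i f) (x + s *\<^sub>R ?e i + t *\<^sub>R ?e j))" if "0 < h" for h i j
  proof -
    let ?g = "\<lambda>s. f (x + h *\<^sub>R ?e j + s *\<^sub>R ?e i) - f (x + s *\<^sub>R ?e i)"
    have "\<exists>s. 0 < s \<and> s < h \<and> ?g h - ?g 0 =
        (h - 0) * (pd i f (x + h *\<^sub>R ?e j + s *\<^sub>R ?e i) - pd i f (x + s *\<^sub>R ?e i))"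
      by (rule MVT2[OF that]) (intro DERIV_diff smooth_line_deriv[OF f])
    then obtain s where s: "0 < s" "s < h" "?g h - ?g 0 =
        h * (pd i f (x + h *\<^sub>R ?e j + s *\<^sub>R ?e i) - pd i f (x + s *\<^sub>R ?e i))" by auto
    have "\<exists>t. 0 < t \<and> t < h \<and> pd i f (x + s *\<^sub>R ?e i + h *\<^sub>R ?e j) - pd i f (x + s *\<^sub>R ?e i + 0 *\<^sub>R ?e j)
        = (h - 0) * pd j (pd i f) (x + s *\<^sub>R ?e i + t *\<^sub>R ?e j)"
      by (rule MVT2[OF that]) (intro smooth_line_deriv smooth_pd f)
    then obtain t where "0 < t" "t < h" "pd i f (x + s *\<^sub>R ?e i + h *\<^sub>R ?e j) - pd i f (x + s *\<^sub>R ?e i)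
        = h * pd j (pd i f) (x + s *\<^sub>R ?e i + t *\<^sub>R ?e j)" by auto
    then show ?thesis using s
      by (intro bexI[of _ s] bexI[of _ t]) (auto simp: algebra_simps)
  qed
  have near: "\<exists>d>0. \<forall>h s t. 0 < h \<and> h < d \<and> s \<in> {0<..<h} \<and> t \<in> {0<..<h} \<longrightarrow>
      \<bar>F (x + s *\<^sub>R ?e a + t *\<^sub>R ?e b) - F x\<bar> < e" if F: "continuous_on UNIV F" and e: "0 < e"
    for F :: "real^'n \<Rightarrow> real" and e a b
  proof -
    obtain d where d: "0 < d" "\<And>y. dist y x < d \<Longrightarrow> dist (F y) (F x) < e"
      using F[unfolded continuous_on_iff, rule_format, OF UNIV_I e, of x] by auto
    have *: "\<bar>F (x + s *\<^sub>R ?e a + t *\<^sub>R ?e b) - F x\<bar> < e"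
      if "0 < h" "h < d / 2" "s \<in> {0<..<h}" "t \<in> {0<..<h}" for h s t
    proof -
      have "norm (s *\<^sub>R ?e a + t *\<^sub>R ?e b) \<le> \<bar>s\<bar> + \<bar>t\<bar>"
        using norm_triangle_ineq[of "s *\<^sub>R ?e a" "t *\<^sub>R ?e b"] by (simp add: norm_axis_1)
      also have "\<dots> < d" using that by auto
      finally have "dist (x + s *\<^sub>R ?e a + t *\<^sub>R ?e b) x < d" by (simp add: dist_norm add.assoc)
      from d(2)[OF this] show ?thesis by (simp add: dist_norm)
    qed
    show ?thesis using d(1) * by (intro exI[of _ "d / 2"]) auto
  qed
  have "\<bar>pd i (pd j f) x - pd j (pd i f) x\<bar> \<le> 2 * e" if e: "0 < e" for e
  proof -
    obtain d1 where d1: "0 < d1" "\<And>h s t. 0 < h \<Longrightarrow> h < d1 \<Longrightarrow> s \<in> {0<..<h} \<Longrightarrow> t \<in> {0<..<h} \<Longrightarrow>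
      \<bar>pd j (pd i f) (x + s *\<^sub>R ?e i + t *\<^sub>R ?e j) - pd j (pd i f) x\<bar> < e"
      using near[OF smooth_continuous[OF smooth_pd[OF smooth_pd[OF f]]] e, of j i i j] by blast
    obtain d2 where d2: "0 < d2" "\<And>h s t. 0 < h \<Longrightarrow> h < d2 \<Longrightarrow> s \<in> {0<..<h} \<Longrightarrow> t \<in> {0<..<h} \<Longrightarrow>
      \<bar>pd i (pd j f) (x + s *\<^sub>R ?e j + t *\<^sub>R ?e i) - pd i (pd j f) x\<bar> < e"
      using near[OF smooth_continuous[OF smooth_pd[OF smooth_pd[OF f]]] e, of i j j i] by blast
    \<comment> \<open>One side length that serves the continuity of both mixed derivatives at
      \<open>x\<close>.\<close>
    define h where "h = min d1 d2 / 2"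
    have h: "0 < h" "h < d1" "h < d2" using d1(1) d2(1) by (auto simp: h_def)
    obtain s t where 1: "s \<in> {0<..<h}" "t \<in> {0<..<h}" "f (x + h *\<^sub>R ?e i + h *\<^sub>R ?e j) - f (x + h *\<^sub>R ?e i) - f (x + h *\<^sub>R ?e j) + f x
      = h * (h * pd j (pd i f) (x + s *\<^sub>R ?e i + t *\<^sub>R ?e j))" using mean[OF h(1)] by blast
    obtain s' t' where 2: "s' \<in> {0<..<h}" "t' \<in> {0<..<h}" "f (x + h *\<^sub>R ?e j + h *\<^sub>R ?e i) - f (x + h *\<^sub>R ?e j) - f (x + h *\<^sub>R ?e i) + f x
      = h * (h * pd i (pd j f) (x + s' *\<^sub>R ?e j + t' *\<^sub>R ?e i))" using mean[OF h(1)] by blast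
    have "h * (h * pd j (pd i f) (x + s *\<^sub>R ?e i + t *\<^sub>R ?e j)) = h * (h * pd i (pd j f) (x + s' *\<^sub>R ?e j + t' *\<^sub>R ?e i))"
      unfolding 1(3)[symmetric] 2(3)[symmetric] by (simp add: algebra_simps)
    then have "pd j (pd i f) (x + s *\<^sub>R ?e i + t *\<^sub>R ?e j) = pd i (pd j f) (x + s' *\<^sub>R ?e j + t' *\<^sub>R ?e i)"
      using h(1) by simp
    then show ?thesis using d1(2)[OF h(1,2) 1(1,2)] d2(2)[OF h(1,3) 2(1,2)] by linarith
  qed
  note bound = this
  have "\<bar>pd i (pd j f) x - pd j (pd i f) x\<bar> \<le> 0"
  proof (rule field_le_epsilon)
    fix e :: real assume "0 < e"
    then show "\<bar>pd i (pd j f) x - pd j (pd i f) x\<bar> \<le> 0 + e" using bound[of "e / 2"] by simp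
  qed
  then show ?thesis by simp
qed

lemma frechet_pd:
  fixes f :: "real^'n::finite \<Rightarrow> real"
  assumes "smooth f"
  shows "frechet_derivative f (at x) h = (\<Sum>j\<in>UNIV. h $ j * pd j f x)"
proof -
  have lin: "linear (frechet_derivative f (at x))"
    using smooth_has_derivative[OF assms] by (intro bounded_linear.linear has_derivative_bounded_linear)
  have "h = (\<Sum>j\<in>UNIV. h $ j *\<^sub>R axis j 1)"
    using basis_expansion[of h] by (simp add: scalar_mult_eq_scaleR)
  then have "frechet_derivative f (at x) h = frechet_derivative f (at x) (\<Sum>j\<in>UNIV. h $ j *\<^sub>R axis j 1)"
    by simp
  also have "\<dots> = (\<Sum>j\<in>UNIV. h $ j * pd j f x)"
    by (simp add: linear_sum[OF lin] linear_scale[OF lin] pd_def)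
  finally show ?thesis .
qed

lemma test_fun_lipschitz:
  fixes f :: "real^'n::finite \<Rightarrow> real"
  assumes f: "test_fun A f"
  obtains L where "0 < L" "\<And>x y. \<bar>f x - f y\<bar> \<le> L * norm (x - y)"
proof -
  have "\<exists>M. 0 < M \<and> (\<forall>x. \<bar>pd j f x\<bar> \<le> M)" for j
    using test_fun_bounded[OF test_fun_pd[OF f]] by (metis real_norm_def)
  then obtain M where M: "\<And>j. 0 < M j" "\<And>j x. \<bar>pd j f x\<bar> \<le> M j" by metis
  let ?L = "(\<Sum>j\<in>UNIV. M j)"
  have sm: "smooth f" using f by (simp add: test_fun_def)
  have "norm (f x - f y) \<le> ?L * norm (x - y)" for x y
  proof (rule differentiable_bound[of UNIV])
    show "(f has_derivative frechet_derivative f (at x)) (at x within UNIV)" for x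
      using smooth_has_derivative[OF sm] .
    show "onorm (frechet_derivative f (at x)) \<le> ?L" for x
    proof (rule onorm_le)
      fix h :: "real^'n"
      have "norm (frechet_derivative f (at x) h) \<le> (\<Sum>j\<in>UNIV. norm (h $ j * pd j f x))"
        unfolding frechet_pd[OF sm] by (rule norm_sum)
      also have "\<dots> \<le> (\<Sum>j\<in>UNIV. norm h * M j)"
        by (intro sum_mono) (auto simp: abs_mult intro!: mult_mono M component_le_norm_cart)
      finally show "norm (frechet_derivative f (at x) h) \<le> ?L * norm h"
        by (simp add: sum_distrib_left mult.commute)
    qed
  qed auto
  then show ?thesis using that[of ?L] M(1) by (simp add: sum_pos)
qed

text \<open>The remainder is bounded uniformly in the base point, so it can be integrated against a
  locally integrable function; this differentiates a convolution without any limit theorem for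
  integrals.\<close>

lemma test_fun_taylor:
  fixes f :: "real^'n::finite \<Rightarrow> real"
  assumes f: "test_fun A f"
  obtains C where "0 < C" "\<And>z h. \<bar>f (z + h) - f z - (\<Sum>j\<in>UNIV. h $ j * pd j f z)\<bar> \<le> C * (norm h)\<^sup>2"
proof -
  have "\<exists>M. 0 < M \<and> (\<forall>x y. \<bar>pd j f x - pd j f y\<bar> \<le> M * norm (x - y))" for j
    using test_fun_lipschitz[OF test_fun_pd[OF f]] by metis
  then obtain M where M: "\<And>j. 0 < M j" "\<And>j x y. \<bar>pd j f x - pd j f y\<bar> \<le> M j * norm (x - y)" by metis
  let ?L = "(\<Sum>j\<in>UNIV. M j)"
  have sm: "smooth f" using f by (simp add: test_fun_def)
  have "norm (f (z + h) - f z - frechet_derivative f (at z) (z + h - z)) \<le> norm (z + h - z) * (?L * norm h)" for z h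
  proof (rule differentiable_bound_linearization[where S="closed_segment z (z + h)"])
    show "z + t *\<^sub>R (z + h - z) \<in> closed_segment z (z + h)" if "t \<in> {0..1}" for t
      using that by (auto simp: closed_segment_def algebra_simps intro!: exI[of _ t])
    show "(f has_derivative frechet_derivative f (at x)) (at x within closed_segment z (z + h))" for x
      using smooth_has_derivative[OF sm] has_derivative_at_withinI by blast
    show "onorm (frechet_derivative f (at x) - frechet_derivative f (at z)) \<le> ?L * norm h"
      if "x \<in> closed_segment z (z + h)" for x
    proof (rule onorm_le)
      fix k :: "real^'n"
      have xz: "norm (x - z) \<le> norm h"
        using segment_bound[OF that] by simp
      have "norm (frechet_derivative f (at x) k - frechet_derivative f (at z) k)
          = norm (\<Sum>j\<in>UNIV. k $ j * (pd j f x - pd j f z))"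
        unfolding frechet_pd[OF sm] by (simp add: sum_subtractf algebra_simps)
      also have "\<dots> \<le> (\<Sum>j\<in>UNIV. norm (k $ j * (pd j f x - pd j f z)))"
        by (rule norm_sum)
      also have "\<dots> \<le> (\<Sum>j\<in>UNIV. norm k * (M j * norm h))"
      proof (intro sum_mono)
        fix j
        have "\<bar>pd j f x - pd j f z\<bar> \<le> M j * norm h"
          using M(2)[of j x z] mult_left_mono[OF xz, of "M j"] M(1)[of j] by linarith
        then show "norm (k $ j * (pd j f x - pd j f z)) \<le> norm k * (M j * norm h)"
          by (auto simp: abs_mult intro!: mult_mono component_le_norm_cart)
      qed
      finally show "norm ((frechet_derivative f (at x) - frechet_derivative f (at z)) k) \<le> ?L * norm h * norm k"
        by (simp add: minus_apply sum_distrib_left sum_distrib_right mult.commute mult.left_commute)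
    qed
  qed auto
  then have "\<bar>f (z + h) - f z - (\<Sum>j\<in>UNIV. h $ j * pd j f z)\<bar> \<le> ?L * (norm h)\<^sup>2" for z h
    by (simp add: frechet_pd[OF sm] power2_eq_square mult_ac)
  then show ?thesis using that[of ?L] M(1) by (simp add: sum_pos)
qed

section \<open>Convolution of a test function with a locally integrable function\<close>

definition loc_int :: "(real^3 \<Rightarrow> real) \<Rightarrow> bool" where
  "loc_int a \<longleftrightarrow> (\<forall>R. integrable lborel (\<lambda>y. indicator (cball 0 R) y * a y))"

text \<open>The kernel is bounded and supported in a ball, so all the integrability comes from
  \<open>a\<close> on that ball. Balls about the origin suffice because every bounded set lies in
  one.\<close>

lemma loc_int_mult:
  assumes a: "loc_int a" and f: "f \<in> borel_measurable borel"
    and M: "\<And>y. \<bar>f y\<bar> \<le> M * indicator (cball 0 R) y"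
  shows "integrable lborel (\<lambda>y. f y * a y)"
    "\<bar>\<integral>y. f y * a y \<partial>lborel\<bar> \<le> M * (\<integral>y. \<bar>indicator (cball 0 R) y * a y\<bar> \<partial>lborel)"
proof -
  have ai: "integrable lborel (\<lambda>y. indicator (cball 0 R) y * a y)" using a by (auto simp: loc_int_def)
  have eq: "f y * a y = f y * (indicator (cball 0 R) y * a y)" for y
    using M[of y] by (auto simp: indicator_def)
  have le: "\<bar>f y * a y\<bar> \<le> M * \<bar>indicator (cball 0 R) y * a y\<bar>" for y
    using mult_right_mono[OF M[of y], of "\<bar>a y\<bar>"] by (simp add: abs_mult)
  have meas: "(\<lambda>y. f y * a y) \<in> borel_measurable lborel"
    unfolding eq using f borel_measurable_integrable[OF ai] by simp
  show 1: "integrable lborel (\<lambda>y. f y * a y)"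
    by (rule Bochner_Integration.integrable_bound[of _ "\<lambda>y. M * \<bar>indicator (cball 0 R) y * a y\<bar>"])
      (use ai meas le in \<open>auto intro!: AE_I2 intro: order_trans[OF le abs_ge_self]\<close>)
  have "\<bar>\<integral>y. f y * a y \<partial>lborel\<bar> \<le> (\<integral>y. \<bar>f y * a y\<bar> \<partial>lborel)"
    by (rule integral_abs_bound)
  also have "\<dots> \<le> (\<integral>y. M * \<bar>indicator (cball 0 R) y * a y\<bar> \<partial>lborel)"
    using 1 ai le by (intro integral_mono) auto
  finally show "\<bar>\<integral>y. f y * a y \<partial>lborel\<bar> \<le> M * (\<integral>y. \<bar>indicator (cball 0 R) y * a y\<bar> \<partial>lborel)"
    by simp
qed

lemma smooth_measurable: "smooth f \<Longrightarrow> f \<in> borel_measurable borel"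
  by (rule borel_measurable_continuous_onI[OF smooth_continuous])

lemma smooth_measurable_reflect:
  assumes "smooth f" shows "(\<lambda>y. f (x - y)) \<in> borel_measurable borel"
  using smooth_measurable[OF assms] by simp

lemma conv_integrable:
  assumes K: "test_fun UNIV K" and a: "loc_int a"
  shows "integrable lborel (\<lambda>y. K (x - y) * a y)"
proof -
  obtain R where R: "0 < R" "\<And>x. R < norm x \<Longrightarrow> K x = 0" using test_fun_supp_ball[OF K] by blast
  obtain M where M: "0 < M" "\<And>x. norm (K x) \<le> M" using test_fun_bounded[OF K] by blast
  show ?thesis
  proof (rule loc_int_mult[OF a smooth_measurable_reflect[OF test_fun_smooth[OF K]]])
    fix y
    have "K (x - y) = 0" if "y \<notin> cball 0 (norm x + R)"
      using R(2)[of "x - y"] norm_triangle_ineq2[of y x] that by (auto simp: norm_minus_commute)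
    then show "\<bar>K (x - y)\<bar> \<le> M * indicator (cball 0 (norm x + R)) y"
      using M(2)[of "x - y"] by (auto simp: indicator_def)
  qed
qed

lemma conv_real:
  fixes a :: "real^3 \<Rightarrow> real"
  shows "conv K a x = (\<integral>y. K (x - y) * a y \<partial>lborel)"
  by (simp add: conv_def)

text \<open>The Taylor remainder of the kernel is of second order uniformly in the base point, so
  the remainder of the convolution is at most the square of \<open>norm h\<close> times the mass of
  \<open>a\<close> on one fixed ball.\<close>

lemma conv_has_derivative:
  assumes K: "test_fun UNIV K" and a: "loc_int a"
  shows "(conv K a has_derivative (\<lambda>h. \<Sum>j\<in>UNIV. h $ j * conv (pd j K) a x)) (at x)"
proof -
  obtain R where R: "0 < R" "\<And>x. R < norm x \<Longrightarrow> K x = 0" using test_fun_supp_ball[OF K] by blast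
  obtain C where C: "0 < C" "\<And>z h. \<bar>K (z + h) - K z - (\<Sum>j\<in>UNIV. h $ j * pd j K z)\<bar> \<le> C * (norm h)\<^sup>2"
    using test_fun_taylor[OF K] by blast
  have sm: "smooth K" using K by (simp add: test_fun_def)
  have pd0: "pd j K z = 0" if "R < norm z" for j z
  proof -
    have "supp K \<subseteq> cball 0 R" by (rule supp_subset_closed) (use R in force)+
    with that show ?thesis unfolding pd_def by (intro deriv_zero_off_supp) auto
  qed
  \<comment> \<open>For \<open>norm h\<close> at most one, the kernels based at \<open>x\<close> and
    at \<open>x + h\<close> both vanish outside the ball of radius
    \<open>norm x + R + 1\<close>.\<close>
  define B where "B = C * (\<integral>y. \<bar>indicator (cball 0 (norm x + R + 1)) y * a y\<bar> \<partial>lborel)"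
  have key: "\<bar>conv K a (x + h) - conv K a x - (\<Sum>j\<in>UNIV. h $ j * conv (pd j K) a x)\<bar> \<le> B * (norm h)\<^sup>2"
    if h: "norm h \<le> 1" for h
  proof -
    let ?f = "\<lambda>y. K (x + h - y) - K (x - y) - (\<Sum>j\<in>UNIV. h $ j * pd j K (x - y))"
    have "conv K a (x + h) - conv K a x - (\<Sum>j\<in>UNIV. h $ j * conv (pd j K) a x)
       = (\<integral>y. K (x + h - y) * a y - K (x - y) * a y - (\<Sum>j\<in>UNIV. h $ j * (pd j K (x - y) * a y)) \<partial>lborel)"
      unfolding conv_real
      by (simp add: conv_integrable K a test_fun_pd Bochner_Integration.integral_diff
          Bochner_Integration.integrable_diff Bochner_Integration.integrable_sum)
    also have "\<dots> = (\<integral>y. ?f y * a y \<partial>lborel)"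
      by (simp add: algebra_simps sum_distrib_left sum_distrib_right)
    also have "\<bar>\<dots>\<bar> \<le> (C * (norm h)\<^sup>2) * (\<integral>y. \<bar>indicator (cball 0 (norm x + R + 1)) y * a y\<bar> \<partial>lborel)"
    proof (rule loc_int_mult(2)[OF a])
      show "?f \<in> borel_measurable borel"
        by (intro borel_measurable_diff borel_measurable_sum borel_measurable_times
            smooth_measurable_reflect sm smooth_pd borel_measurable_const)
      fix y
      show "\<bar>?f y\<bar> \<le> C * (norm h)\<^sup>2 * indicator (cball 0 (norm x + R + 1)) y"
      proof (cases "y \<in> cball 0 (norm x + R + 1)")
        case True
        then show ?thesis using C(2)[of "x - y" h] by (simp add: algebra_simps)
      next
        case False
        then have y: "norm y > norm x + R + 1" by simp
        have 1: "norm (x - y) > R" using y norm_triangle_ineq2[of y x] by (simp add: norm_minus_commute)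
        have 2: "norm (x + h - y) > R"
          using y norm_triangle_ineq2[of y "x + h"] norm_triangle_ineq[of x h] h by (simp add: norm_minus_commute)
        show ?thesis using R(2)[OF 1] R(2)[OF 2] pd0[OF 1] C(1) by simp
      qed
    qed
    finally show ?thesis by (simp add: B_def mult_ac)
  qed
  show ?thesis unfolding has_derivative_at
  proof (intro conjI)
    show "bounded_linear (\<lambda>h. \<Sum>j\<in>UNIV. h $ j * conv (pd j K) a x)"
      by (intro bounded_linear_sum bounded_linear_compose[OF bounded_linear_mult_left bounded_linear_vec_nth])
    show "(\<lambda>h. norm (conv K a (x + h) - conv K a x - (\<Sum>j\<in>UNIV. h $ j * conv (pd j K) a x)) / norm h) \<midarrow>0\<rightarrow> 0"
    proof (rule Lim_null_comparison[where g="\<lambda>h. B * norm h"])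
      show "\<forall>\<^sub>F h in at 0. norm (norm (conv K a (x + h) - conv K a x - (\<Sum>j\<in>UNIV. h $ j * conv (pd j K) a x)) / norm h) \<le> B * norm h"
        unfolding eventually_at
      proof (intro exI[of _ 1] conjI ballI impI)
        fix h :: "real^3" assume "h \<noteq> 0 \<and> dist h 0 < 1"
        then show "norm (norm (conv K a (x + h) - conv K a x - (\<Sum>j\<in>UNIV. h $ j * conv (pd j K) a x)) / norm h) \<le> B * norm h"
          using key[of h] by (simp add: divide_simps power2_eq_square mult_ac)
      qed simp
      show "((\<lambda>h. B * norm h) \<longlongrightarrow> 0) (at 0)" by (auto intro!: tendsto_eq_intros)
    qed
  qed
qed

lemma pd_conv:
  assumes "test_fun UNIV K" "loc_int a"
  shows "pd j (conv K a) = conv (pd j K) a"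
proof
  fix x
  have "(\<Sum>i\<in>UNIV. axis j 1 $ i * conv (pd i K) a x) = conv (pd j K) a x"
    by (subst sum.cong[where B=UNIV and h="\<lambda>i. if i = j then conv (pd j K) a x else 0"])
      (auto simp: axis_def)
  then show "pd j (conv K a) x = conv (pd j K) a x"
    using pd_has_derivative[OF conv_has_derivative[OF assms], of j x] by simp
qed

text \<open>Every derivative falls on the kernel, which stays a test function; hence the induction
  generalises over \<open>K\<close> and keeps \<open>a\<close> fixed.\<close>

lemma smooth_conv:
  assumes "test_fun UNIV K" and a: "loc_int a"
  shows "smooth (conv K a)"
proof -
  have "Ck n (conv K a)" for n
    using assms(1)
  proof (induction n arbitrary: K)
    case 0
    have "continuous_on UNIV (conv K a)"
      using has_derivative_continuous[OF conv_has_derivative[OF 0 a]]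
      by (auto simp: continuous_on_eq_continuous_at)
    then show ?case by simp
  next
    case (Suc n)
    show ?case
      by (rule Ck_SucI, rule conv_has_derivative[OF Suc.prems a])
       (intro Ck_sum Ck_bounded_linear[OF bounded_linear_mult_right] Suc.IH test_fun_pd Suc.prems)
  qed
  then show ?thesis by (simp add: smooth_def)
qed

lemma loc_int_continuous:
  assumes "continuous_on UNIV a" shows "loc_int a"
  unfolding loc_int_def
proof
  fix R
  show "integrable lborel (\<lambda>y. indicator (cball 0 R) y * a y)"
    using borel_integrable_compact[of "cball 0 R" a] continuous_on_subset[OF assms] by simp
qed

text \<open>\<open>\<integral> K (x - y) dy\<close> does not depend on \<open>x\<close>, hence has derivative zero.\<close>

lemma integral_pd:
  fixes K :: "real^3 \<Rightarrow> real"
  assumes K: "test_fun UNIV K" shows "(\<integral>x. pd j K x \<partial>lborel) = 0"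
proof -
  have refl: "(\<integral>y. f (x - y) \<partial>lborel) = (\<integral>y. f y \<partial>lborel)" if "smooth f" for f :: "real^3 \<Rightarrow> real" and x
    using integral_lborel_affine[OF smooth_measurable[OF that], of "-1" x] by simp
  have l: "loc_int (\<lambda>y. 1::real)" by (intro loc_int_continuous continuous_intros)
  have "conv K (\<lambda>y. 1::real) = (\<lambda>x. \<integral>y. K y \<partial>lborel)"
    using refl[of K] K by (auto simp: conv_real test_fun_def)
  then have "pd j (conv K (\<lambda>y. 1::real)) 0 = 0" by simp
  then have "0 = conv (pd j K) (\<lambda>y. 1::real) 0" by (simp add: pd_conv[OF K l])
  also have "\<dots> = (\<integral>y. pd j K y \<partial>lborel)"
    using refl[of "pd j K" 0] K by (simp add: conv_real test_fun_def smooth_pd)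
  finally show ?thesis by simp
qed

section \<open>Pointwise vorticity identities\<close>

lemma smooth_divide_const:
  fixes f :: "'a::euclidean_space \<Rightarrow> real"
  shows "smooth f \<Longrightarrow> smooth (\<lambda>x. f x / c)"
  by (rule smooth_bounded_linear[OF bounded_linear_divide])

lemma pd_divide_const:
  fixes f :: "real^'n::finite \<Rightarrow> real"
  shows "smooth f \<Longrightarrow> pd i (\<lambda>x. f x / c) x = pd i f x / c"
  by (rule pd_bounded_linear[OF bounded_linear_divide smooth_differentiable])

lemma curl_nth:
  "curl V x $ 1 = pd 2 (\<lambda>y. V y $ 3) x - pd 3 (\<lambda>y. V y $ 2) x"
  "curl V x $ 2 = pd 3 (\<lambda>y. V y $ 1) x - pd 1 (\<lambda>y. V y $ 3) x"
  "curl V x $ 3 = pd 1 (\<lambda>y. V y $ 2) x - pd 2 (\<lambda>y. V y $ 1) x"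
  by (simp_all add: curl_def)

lemma smooth_curl:
  assumes "\<And>k. smooth (\<lambda>y. V y $ k)"
  shows "smooth (\<lambda>y. curl V y $ k)"
proof -
  have "k = 1 \<or> k = 2 \<or> k = 3" by (rule exhaust_3)
  then show ?thesis
    by (elim disjE) (simp_all add: curl_nth smooth_diff smooth_pd assms)
qed

text \<open>The curl of the filtered momentum flux splits into the curl of the subfilter force,
  transport and stretching. Incompressibility enters twice: at every \<open>y\<close>, to replace
  div (U tensor U) by the convective form before differentiating, and at \<open>x\<close>, to remove
  the vorticity times div U that the curl of the convective form produces.\<close>

lemma curl_convection:
  fixes U :: "real^3 \<Rightarrow> real^3"
  assumes U: "\<And>k. smooth (\<lambda>y. U y $ k)" and V: "\<And>k. smooth (\<lambda>y. V y $ k)"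
    and div: "\<And>x. divg U x = 0"
    and S: "\<And>x k. S x $ k = V x $ k + (\<Sum>m\<in>UNIV. pd m (\<lambda>y. U y $ k * U y $ m) x)"
  shows "curl S x $ i = curl V x $ i
    + (\<Sum>j\<in>UNIV. U x $ j * pd j (\<lambda>y. curl U y $ i) x - curl U x $ j * pd j (\<lambda>y. U y $ i) x)"
proof -
  note sm = U V smooth_pd smooth_mult smooth_add smooth_diff
  have S': "(\<lambda>y. S y $ k) = (\<lambda>y. V y $ k + (pd 1 (\<lambda>y. U y $ k) y * U y $ 1
      + pd 2 (\<lambda>y. U y $ k) y * U y $ 2 + pd 3 (\<lambda>y. U y $ k) y * U y $ 3))" for k
  proof
    fix y
    have "pd 1 (\<lambda>y. U y $ 1) y + pd 2 (\<lambda>y. U y $ 2) y + pd 3 (\<lambda>y. U y $ 3) y = 0"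
      using div[of y] by (simp add: divg_def sum_3)
    then have "U y $ k * (pd 1 (\<lambda>y. U y $ 1) y + pd 2 (\<lambda>y. U y $ 2) y + pd 3 (\<lambda>y. U y $ 3) y) = 0"
      by simp
    then show "S y $ k = V y $ k + (pd 1 (\<lambda>y. U y $ k) y * U y $ 1
      + pd 2 (\<lambda>y. U y $ k) y * U y $ 2 + pd 3 (\<lambda>y. U y $ k) y * U y $ 3)"
      by (simp add: S sum_3 pd_mult U algebra_simps)
  qed
  \<comment> \<open>Solving for one diagonal entry, together with a fixed order of the mixed
    derivatives, gives both sides a common normal form.\<close>
  have d0: "pd 3 (\<lambda>y. U y $ 3) x = - pd 1 (\<lambda>y. U y $ 1) x - pd 2 (\<lambda>y. U y $ 2) x"
    using div[of x] by (simp add: divg_def sum_3)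
  have com: "pd 2 (pd 1 (\<lambda>y. U y $ k)) x = pd 1 (pd 2 (\<lambda>y. U y $ k)) x"
    "pd 3 (pd 1 (\<lambda>y. U y $ k)) x = pd 1 (pd 3 (\<lambda>y. U y $ k)) x"
    "pd 3 (pd 2 (\<lambda>y. U y $ k)) x = pd 2 (pd 3 (\<lambda>y. U y $ k)) x" for k
    by (rule pd_commute[OF U])+
  have "i = 1 \<or> i = 2 \<or> i = 3" by (rule exhaust_3)
  then show ?thesis
    by (elim disjE) (simp_all add: curl_nth S' pd_add pd_mult pd_diff sm sum_3 d0 com algebra_simps)
qed

text \<open>Up to the divergence of the field \<open>T\<close>, the identity moves one derivative off every
  second-order term, so that only \<open>|\<nabla>\<Omega>|\<^sup>2\<close>, derivatives of the cutoff and the undifferentiated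
  stress divergence \<open>V\<close> remain.\<close>

lemma enstrophy_identity:
  fixes W U V :: "real^3 \<Rightarrow> real^3" and X :: "real^3 \<Rightarrow> real"
  assumes W: "\<And>k. smooth (\<lambda>y. W y $ k)" and U: "\<And>k. smooth (\<lambda>y. U y $ k)" and V: "\<And>k. smooth (\<lambda>y. V y $ k)"
    and X: "smooth X" and div: "\<And>x. divg U x = 0"
  defines "T j y \<equiv> (\<Sum>i\<in>UNIV. X y * (W y $ i * pd j (\<lambda>y. W y $ i) y))
      - 1 / 2 * (pd j X y * (\<Sum>i\<in>UNIV. W y $ i * W y $ i))
      - 1 / 2 * (X y * (U y $ j * (\<Sum>i\<in>UNIV. W y $ i * W y $ i))) + X y * (cross3 (W y) (V y) $ j)"
  shows "(\<Sum>i\<in>UNIV. X x * (W x $ i * (lapl (\<lambda>y. W y $ i) x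
      - (curl V x $ i + (\<Sum>j\<in>UNIV. U x $ j * pd j (\<lambda>y. W y $ i) x - W x $ j * pd j (\<lambda>y. U y $ i) x)))))
    = - X x * (\<Sum>i\<in>UNIV. \<Sum>j\<in>UNIV. (pd j (\<lambda>y. W y $ i) x)\<^sup>2)
      + 1 / 2 * (norm (W x))\<^sup>2 * (lapl X x + U x \<bullet> grad X x)
      + X x * (\<Sum>i\<in>UNIV. \<Sum>j\<in>UNIV. W x $ i * W x $ j * pd j (\<lambda>y. U y $ i) x)
      - X x * (curl W x \<bullet> V x) - grad X x \<bullet> cross3 (W x) (V x) + (\<Sum>j\<in>UNIV. pd j (T j) x)"
proof -
  note sm = W U V X smooth_pd smooth_mult smooth_add smooth_diff smooth_const
  have d0: "pd 3 (\<lambda>y. U y $ 3) x = - pd 1 (\<lambda>y. U y $ 1) x - pd 2 (\<lambda>y. U y $ 2) x"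
    using div[of x] by (simp add: divg_def sum_3)
  have W2: "(norm (W x))\<^sup>2 = W x $ 1 * W x $ 1 + W x $ 2 * W x $ 2 + W x $ 3 * W x $ 3"
    by (simp add: power2_norm_eq_inner inner_vec_def sum_3)
  have T: "T j = (\<lambda>y. X y * (W y $ 1 * pd j (\<lambda>y. W y $ 1) y) + X y * (W y $ 2 * pd j (\<lambda>y. W y $ 2) y)
      + X y * (W y $ 3 * pd j (\<lambda>y. W y $ 3) y)
      - pd j X y * (W y $ 1 * W y $ 1 + W y $ 2 * W y $ 2 + W y $ 3 * W y $ 3) / 2
      - X y * (U y $ j * (W y $ 1 * W y $ 1 + W y $ 2 * W y $ 2 + W y $ 3 * W y $ 3)) / 2
      + X y * (cross3 (W y) (V y) $ j))" for j
    unfolding T_def sum_3 by (rule ext) simp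
  have cross: "cross3 a b $ 1 = a $ 2 * b $ 3 - a $ 3 * b $ 2" "cross3 a b $ 2 = a $ 3 * b $ 1 - a $ 1 * b $ 3"
    "cross3 a b $ 3 = a $ 1 * b $ 2 - a $ 2 * b $ 1" for a b :: "real^3"
    by (simp_all add: cross3_def)
  have T': "(\<Sum>j\<in>UNIV. pd j (T j) x) = pd 1 (T 1) x + pd 2 (T 2) x + pd 3 (T 3) x"
    by (simp add: sum_3)
  note rules = pd_add pd_mult pd_diff pd_divide_const sm smooth_divide_const
  show ?thesis
    unfolding T' W2
    unfolding T cross
    by (simp add: curl_nth cross lapl_def grad_def inner_vec_def rules sum_3 d0 power2_eq_square)
      (simp add: field_simps)
qed

section \<open>From weak to integrated time derivatives\<close>

text \<open>The vanishing theorem for continuous nonnegative functions concerns integrals over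
  boxes; the bounded support lets the integral over the whole space be read as one over a box whose
  interior contains \<open>x\<close>.\<close>

lemma continuous_nonneg_integral_0:
  fixes f :: "'a::euclidean_space \<Rightarrow> real"
  assumes f: "continuous_on UNIV f" "\<And>x. 0 \<le> f x" "\<And>x. R < norm x \<Longrightarrow> f x = 0"
    and 0: "(\<integral>x. f x \<partial>lborel) = 0"
  shows "f x = 0"
proof (rule ccontr)
  assume fx: "f x \<noteq> 0"
  have "bounded (cball 0 R \<union> {x})" by auto
  then obtain a where a: "cball 0 R \<union> {x} \<subseteq> box (- a) a" using bounded_subset_box_symmetric by blast
  have sub: "box (- a) a \<subseteq> cbox (- a) a" by (rule box_subset_cbox)
  have out: "f y = 0" if "y \<notin> cball 0 R" for y using f(3)[of y] that by auto
  have eq: "f = (\<lambda>y. indicator (cball 0 R) y *\<^sub>R f y)" using out by (auto simp: indicator_def fun_eq_iff)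
  have "integrable lborel f"
    by (subst eq) (intro borel_integrable_compact continuous_on_subset[OF f(1)], auto)
  then have "(f has_integral 0) UNIV" using has_integral_integral_lborel[of f] 0 by simp
  moreover have "(\<lambda>y. if y \<in> cbox (- a) a then f y else 0) = f"
    using a sub out by (auto simp: fun_eq_iff subset_iff)
  ultimately have "(f has_integral 0) (cbox (- a) a)"
    using has_integral_restrict_UNIV[of "cbox (- a) a" f 0] by simp
  moreover have "x \<in> box (- a) a" using a by auto
  ultimately have "f x = 0"
    using sub by (intro has_integral_0_cbox_imp_0[of "- a" a f x] continuous_on_subset[OF f(1)] f(2)) auto
  with fx show False by simp
qed

text \<open>A one-dimensional bump can be cut out of the filter: restrict the kernel to a line
  through a point where it is nonzero, and normalise.\<close>

lemma bump_exists:
  assumes \<phi>: "filter_kernel \<phi>"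
  obtains \<eta> :: "real \<Rightarrow> real" where "smooth \<eta>" "\<And>t. 0 \<le> \<eta> t" "\<And>t. 1 \<le> \<bar>t\<bar> \<Longrightarrow> \<eta> t = 0" "(\<integral>t. \<eta> t \<partial>lborel) = 1"
proof -
  have sm: "smooth \<phi>" and nn: "\<And>x. 0 \<le> \<phi> x" and i1: "(\<integral>x. \<phi> x \<partial>lborel) = 1" and sp: "supp \<phi> \<subseteq> ball 0 1"
    using \<phi> by (auto simp: filter_kernel_def test_fun_def)
  have "\<not> (\<forall>z. \<phi> z = 0)"
  proof
    assume "\<forall>z. \<phi> z = 0"
    then have "\<phi> = (\<lambda>z. 0)" by auto
    then show False using i1 by simp
  qed
  then obtain z where z: "\<phi> z \<noteq> 0" by auto
  have z1: "norm z < 1" using z not_supp[of z \<phi>] sp by (auto simp: subset_iff)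
  \<comment> \<open>Since \<open>norm z < 1\<close>, a displacement of length at least 2 leaves the
    unit ball. The factor 2 thus confines the support to parameters of absolute value below
    one.\<close>
  define g where "g t = \<phi> (z + t *\<^sub>R (2 *\<^sub>R axis 1 1))" for t :: real
  have gs: "smooth g" unfolding g_def
    by (rule smooth_affine[OF _ sm]) (rule bounded_linear_scaleR_left)
  have g0: "g t = 0" if "1 \<le> \<bar>t\<bar>" for t
  proof -
    have "norm (t *\<^sub>R ((2 *\<^sub>R axis 1 1) :: real^3)) = 2 * \<bar>t\<bar>"
      by simp
    then have "1 \<le> norm (z + t *\<^sub>R (2 *\<^sub>R axis 1 1))"
      using norm_triangle_ineq2[of "t *\<^sub>R (2 *\<^sub>R axis 1 1)" "- z"] z1 that by (simp add: add.commute)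
    then show ?thesis unfolding g_def using sp by (intro not_supp) (auto simp: subset_iff)
  qed
  have tf: "test_fun UNIV g"
    by (rule test_funI[OF gs, of "cbox (-1) 1"], simp, simp) (use g0 in \<open>force simp: abs_if\<close>)+
  have int: "integrable lborel g" by (rule test_fun_integrable[OF tf])
  have pos: "0 < (\<integral>t. g t \<partial>lborel)"
  proof -
    have "(\<integral>t. g t \<partial>lborel) \<noteq> 0"
    proof
      assume "(\<integral>t. g t \<partial>lborel) = 0"
      note zero = this
      have "g 0 = 0"
      proof (rule continuous_nonneg_integral_0[OF smooth_continuous[OF gs]])
        show "g t = 0" if "1 < norm t" for t using g0[of t] that by simp
      qed (use zero in \<open>simp_all add: g_def nn\<close>)
      then show False using z by (simp add: g_def)
    qed
    moreover have "0 \<le> (\<integral>t. g t \<partial>lborel)" by (rule Bochner_Integration.integral_nonneg) (simp add: g_def nn)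
    ultimately show ?thesis by simp
  qed
  show ?thesis
  proof (rule that[of "\<lambda>t. g t / (\<integral>t. g t \<partial>lborel)"])
    show "smooth (\<lambda>t. g t / (\<integral>t. g t \<partial>lborel))" by (rule smooth_divide_const[OF gs])
    show "0 \<le> g t / (\<integral>t. g t \<partial>lborel)" for t using pos nn by (simp add: g_def)
    show "g t / (\<integral>t. g t \<partial>lborel) = 0" if "1 \<le> \<bar>t\<bar>" for t using g0[OF that] by simp
    show "(\<integral>t. g t / (\<integral>t. g t \<partial>lborel) \<partial>lborel) = 1" using pos int by simp
  qed
qed

text \<open>\<open>H\<close> is the primitive of the bump that vanishes at -1; its value at 1 is the
  mass of the bump, which is one.\<close>

lemma smooth_step_exists:
  assumes \<phi>: "filter_kernel \<phi>"
  obtains \<eta> H :: "real \<Rightarrow> real" where "smooth \<eta>" "\<And>t. 0 \<le> \<eta> t" "\<And>t. 1 \<le> \<bar>t\<bar> \<Longrightarrow> \<eta> t = 0" "(\<integral>t. \<eta> t \<partial>lborel) = 1"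
    "smooth H" "\<And>t. (H has_real_derivative \<eta> t) (at t)"
    "\<And>t. t \<le> -1 \<Longrightarrow> H t = 0" "\<And>t. 1 \<le> t \<Longrightarrow> H t = 1" "\<And>t. 0 \<le> H t" "\<And>t. H t \<le> 1"
proof -
  obtain \<eta> :: "real \<Rightarrow> real" where \<eta>: "smooth \<eta>" "\<And>t. 0 \<le> \<eta> t" "\<And>t. 1 \<le> \<bar>t\<bar> \<Longrightarrow> \<eta> t = 0" "(\<integral>t. \<eta> t \<partial>lborel) = 1"
    using bump_exists[OF \<phi>] by blast
  have "isCont \<eta> x" for x
    using smooth_continuous[OF \<eta>(1), of UNIV] by (simp add: continuous_on_eq_continuous_at)
  then obtain P where P: "\<And>x. (P has_vector_derivative \<eta> x) (at x)"
    using einterval_antiderivative[of "-\<infinity>" "\<infinity>" \<eta>] by auto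
  define H where "H t = P t - P (-1)" for t
  have H': "(H has_real_derivative \<eta> t) (at t)" for t
    using P[of t] unfolding H_def has_real_derivative_iff_has_vector_derivative
    by (auto intro!: derivative_eq_intros)
  have mono: "H s \<le> H t" if "s \<le> t" for s t
    by (rule DERIV_nonneg_imp_nondecreasing[OF that]) (use H' \<eta>(2) in blast)
  have const: "H s = H t" if "s < t" "\<And>x. s < x \<Longrightarrow> x < t \<Longrightarrow> \<eta> x = 0" for s t
  proof (rule DERIV_isconst_end[OF that(1), symmetric])
    show "continuous_on {s..t} H"
      using H' by (intro continuous_at_imp_continuous_on ballI DERIV_isCont) auto
    show "DERIV H x :> 0" if "s < x" "x < t" for x
      using H'[of x] \<open>\<And>x. s < x \<Longrightarrow> x < t \<Longrightarrow> \<eta> x = 0\<close>[OF that] by simp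
  qed
  have H0: "H t = 0" if "t \<le> -1" for t
  proof -
    have "H (-1) = 0" by (simp add: H_def)
    then show ?thesis using const[of t "-1"] \<eta>(3) that by (cases "t = -1") auto
  qed
  have "(\<eta> has_integral (H 1 - H (-1))) {-1..1}"
    by (rule fundamental_theorem_of_calculus)
      (use H' in \<open>auto simp: has_real_derivative_iff_has_vector_derivative intro: has_vector_derivative_at_within\<close>)
  then have 1: "integral {-1..1} \<eta> = H 1" using H0[of "-1"] by (simp add: integral_unique)
  have "set_integrable lborel {-1..1} \<eta>"
    unfolding set_integrable_def by (rule borel_integrable_compact) (auto intro: smooth_continuous \<eta>(1))
  from set_borel_integral_eq_integral(2)[OF this]
  have "set_lebesgue_integral lborel {-1..1} \<eta> = H 1" using 1 by simp
  moreover have "set_lebesgue_integral lborel {-1..1} \<eta> = (\<integral>t. \<eta> t \<partial>lborel)"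
    unfolding set_lebesgue_integral_def
  proof (rule Bochner_Integration.integral_cong[OF refl])
    fix t show "indicator {- 1..1} t *\<^sub>R \<eta> t = \<eta> t"
      using \<eta>(3)[of t] by (cases "t \<in> {-1..1}") (auto simp: abs_if split: if_splits)
  qed
  ultimately have "H 1 = 1" using \<eta>(4) by simp
  then have H1: "H t = 1" if "1 \<le> t" for t
    using const[of 1 t] \<eta>(3) that by (cases "t = 1") auto
  \<comment> \<open>The derivative \<open>\<eta>\<close> is already smooth, so a case split on the
    order replaces an induction.\<close>
  have Hs: "smooth H" unfolding smooth_def
  proof
    fix n show "Ck n H"
    proof (cases n)
      case 0
      then show ?thesis using H' by (auto intro!: DERIV_isCont simp: continuous_on_eq_continuous_at)
    next
      case (Suc m)
      show ?thesis unfolding Suc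
        by (rule Ck_SucI[where f'="\<lambda>x h. \<eta> x * h"])
          (use H' \<eta>(1) in \<open>auto simp: has_field_derivative_def smooth_def\<close>)
    qed
  qed
  show ?thesis
  proof (rule that[OF \<eta> Hs H' H0 H1])
    show "0 \<le> H t" for t using mono[of "min t (-1)" t] H0[of "min t (-1)"] by simp
    show "H t \<le> 1" for t using mono[of t "max t 1"] H1[of "max t 1"] by simp
  qed
qed

text \<open>A primitive of a bounded function is Lipschitz, so the candidate difference \<open>D\<close> of the two
  sides satisfies \<open>|D b - D a| \<le> C (b - a)\<^sup>2\<close> and is constant.\<close>

lemma product_rule_primitives:
  fixes f g F G :: "real \<Rightarrow> real"
  assumes st: "s \<le> t" and B: "0 \<le> B"
    and f: "\<And>a b. s \<le> a \<Longrightarrow> a \<le> b \<Longrightarrow> b \<le> t \<Longrightarrow> (F has_integral (f b - f a)) {a..b}"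
    and g: "\<And>a b. s \<le> a \<Longrightarrow> a \<le> b \<Longrightarrow> b \<le> t \<Longrightarrow> (G has_integral (g b - g a)) {a..b}"
    and FB: "\<And>x. x \<in> {s..t} \<Longrightarrow> \<bar>F x\<bar> \<le> B" and GB: "\<And>x. x \<in> {s..t} \<Longrightarrow> \<bar>G x\<bar> \<le> B"
    and int: "(\<lambda>x. F x * g x + f x * G x) integrable_on {s..t}"
  shows "integral {s..t} (\<lambda>x. F x * g x + f x * G x) = f t * g t - f s * g s"
proof -
  let ?h = "\<lambda>x. F x * g x + f x * G x"
  define D where "D x = f x * g x - integral {s..x} ?h" for x
  have lip: "\<bar>f b - f a\<bar> \<le> B * (b - a)" "\<bar>g b - g a\<bar> \<le> B * (b - a)" if "s \<le> a" "a \<le> b" "b \<le> t" for a b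
    using has_integral_bound_real[OF B finite.emptyI f[OF that]] has_integral_bound_real[OF B finite.emptyI g[OF that]]
      that FB GB by auto
  have key: "\<bar>D b - D a\<bar> \<le> 2 * B * B * (b - a)\<^sup>2" if ab: "s \<le> a" "a \<le> b" "b \<le> t" for a b
  proof -
    have i1: "?h integrable_on {s..b}" "?h integrable_on {a..b}"
      using int ab by (auto intro: integrable_on_subinterval)
    have "integral {s..b} ?h = integral {s..a} ?h + integral {a..b} ?h"
      using Henstock_Kurzweil_Integration.integral_combine[OF ab(1,2) i1(1)] by simp
    \<comment> \<open>Freezing \<open>g\<close> at the right end and \<open>f\<close> at the left
      end makes the integral exactly \<open>f b * g b - f a * g a\<close>. Only the error of
      freezing remains, and it is quadratic in \<open>b - a\<close> because \<open>f\<close> and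
      \<open>g\<close> are Lipschitz.\<close>
    moreover have "((\<lambda>x. F x * g b + f a * G x) has_integral ((f b - f a) * g b + f a * (g b - g a))) {a..b}"
      by (intro has_integral_add has_integral_mult_left has_integral_mult_right f g ab)
    then have "((\<lambda>x. F x * g b + f a * G x - ?h x) has_integral
        ((f b - f a) * g b + f a * (g b - g a) - integral {a..b} ?h)) {a..b}"
      by (intro has_integral_diff integrable_integral i1)
    ultimately have "((\<lambda>x. F x * g b + f a * G x - ?h x) has_integral (D b - D a)) {a..b}"
      by (simp add: D_def algebra_simps)
    then have "norm (D b - D a) \<le> (2 * B * B * (b - a)) * Henstock_Kurzweil_Integration.content {a..b}"
    proof (rule has_integral_bound_real[OF _ finite.emptyI, rotated])
      fix x assume "x \<in> {a..b} - {}"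
      then have x: "a \<le> x" "x \<le> b" by auto
      have "\<bar>F x * (g b - g x)\<bar> \<le> B * (B * (b - a))"
        unfolding abs_mult using lip(2)[of x b] FB[of x] x ab B mult_left_mono[of "b - x" "b - a" B]
        by (intro mult_mono) auto
      moreover have "\<bar>(f a - f x) * G x\<bar> \<le> (B * (b - a)) * B"
        unfolding abs_mult using lip(1)[of a x] GB[of x] x ab B mult_left_mono[of "x - a" "b - a" B]
        by (intro mult_mono) auto
      ultimately show "norm (F x * g b + f a * G x - ?h x) \<le> 2 * B * B * (b - a)"
        by (simp add: algebra_simps)
    qed (use B ab in auto)
    then show ?thesis using ab by (simp add: power2_eq_square)
  qed
  have sym: "\<bar>D y - D x\<bar> \<le> 2 * B * B * (y - x)\<^sup>2" if "x \<in> {s..t}" "y \<in> {s..t}" for x y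
    using key[of x y] key[of y x] that by (cases "x \<le> y") (auto simp: abs_minus_commute power2_commute)
  have "D t = D s"
  proof (rule has_field_derivative_zero_constant[of "{s..t}" D, THEN exE])
    show "(D has_field_derivative 0) (at x within {s..t})" if x: "x \<in> {s..t}" for x
      unfolding has_field_derivative_iff
    proof (rule Lim_null_comparison[where g="\<lambda>y. 2 * B * B * \<bar>y - x\<bar>"])
      show "\<forall>\<^sub>F y in at x within {s..t}. norm ((D y - D x) / (y - x)) \<le> 2 * B * B * \<bar>y - x\<bar>"
        unfolding eventually_at_filter
      proof (intro always_eventually allI impI)
        fix y assume y: "y \<noteq> x" "y \<in> {s..t}"
        then have "0 < \<bar>y - x\<bar>" by simp
        moreover have "\<bar>D y - D x\<bar> \<le> (2 * B * B * \<bar>y - x\<bar>) * \<bar>y - x\<bar>"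
        proof -
          have "\<bar>y - x\<bar> * \<bar>y - x\<bar> = (y - x)\<^sup>2" by (simp add: power2_eq_square)
          then show ?thesis using sym[OF x y(2)] by (simp add: mult.assoc)
        qed
        ultimately show "norm ((D y - D x) / (y - x)) \<le> 2 * B * B * \<bar>y - x\<bar>"
          by (simp add: pos_divide_le_eq)
      qed
      show "((\<lambda>y. 2 * B * B * \<bar>y - x\<bar>) \<longlongrightarrow> 0) (at x within {s..t})"
        by (auto intro!: tendsto_eq_intros)
    qed
  qed (use st in auto)
  then show ?thesis by (simp add: D_def)
qed

text \<open>Testing against \<open>\<theta>(t) = H((t - a)/\<epsilon>) - H((t - b)/\<epsilon>)\<close>, a smoothed indicator of \<open>[a, b]\<close>.\<close>

lemma weak_derivative_integral:
  fixes f F :: "real \<Rightarrow> real"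
  assumes \<phi>: "filter_kernel \<phi>"
    and ab: "\<alpha> < a" "a \<le> b" "b < \<beta>"
    and f: "continuous_on {\<alpha>..\<beta>} f" "f \<in> borel_measurable borel" "\<And>t. \<bar>f t\<bar> \<le> B"
    and F: "F \<in> borel_measurable borel" "\<And>t. \<bar>F t\<bar> \<le> B"
    and weak: "\<And>\<theta> \<theta>'. test_fun {\<alpha><..<\<beta>} \<theta> \<Longrightarrow> (\<And>t. (\<theta> has_real_derivative \<theta>' t) (at t)) \<Longrightarrow>
      (\<integral>t. \<theta>' t * f t + \<theta> t * F t \<partial>lborel) = 0"
  shows "(F has_integral (f b - f a)) {a..b}"
proof -
  obtain \<eta> H :: "real \<Rightarrow> real" where \<eta>: "smooth \<eta>" "\<And>t. 0 \<le> \<eta> t" "\<And>t. 1 \<le> \<bar>t\<bar> \<Longrightarrow> \<eta> t = 0" "(\<integral>t. \<eta> t \<partial>lborel) = 1"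
    and H: "smooth H" "\<And>t. (H has_real_derivative \<eta> t) (at t)"
    "\<And>t. t \<le> -1 \<Longrightarrow> H t = 0" "\<And>t. 1 \<le> t \<Longrightarrow> H t = 1" "\<And>t. 0 \<le> H t" "\<And>t. H t \<le> 1"
    using smooth_step_exists[OF \<phi>] by blast
  have B0: "0 \<le> B" using F(2)[of 0] by simp
  have icc: "integrable lborel (indicat_real {c..d})" for c d :: real
    by (rule integrable_real_indicator) (auto simp: emeasure_lborel_Icc_eq)
  have bdd_int: "integrable lborel (\<lambda>t. indicator {c..d} t * h t)"
    if "h \<in> borel_measurable borel" "\<And>t. \<bar>h t\<bar> \<le> C" for h :: "real \<Rightarrow> real" and c d C
  proof (rule Bochner_Integration.integrable_bound[where f="\<lambda>t. C * indicator {c..d} t"])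
    show "AE t in lborel. norm (indicator {c..d} t * h t) \<le> norm (C * indicator {c..d} t)"
      using that(2) by (auto simp: indicator_def intro: order_trans[OF _ abs_ge_self])
    show "integrable lborel (\<lambda>t. C * indicat_real {c..d} t)" using icc by (rule integrable_mult_right)
  qed (use that(1) in auto)
  have Fint: "set_integrable lborel {a..b} F"
    unfolding set_integrable_def using bdd_int[OF F] by simp
  define J where "J = (\<integral>t. indicator {a..b} t * F t \<partial>lborel)"
  \<comment> \<open>The derivative of the step rescaled at \<open>c\<close>: an approximate identity
    of mass one, vanishing at distance \<open>\<epsilon>\<close> from \<open>c\<close> and
    beyond.\<close>
  define e where "e c \<epsilon> t = \<eta> ((t - c) / \<epsilon>) / \<epsilon>" for c \<epsilon> t :: real
  have mollify: "integrable lborel (\<lambda>t. e c \<epsilon> t * f t)"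
      "\<bar>(\<integral>t. e c \<epsilon> t * f t \<partial>lborel) - f c\<bar> \<le> \<omega>"
    if \<epsilon>: "0 < \<epsilon>" and \<omega>: "\<And>t. \<bar>t - c\<bar> \<le> \<epsilon> \<Longrightarrow> \<bar>f t - f c\<bar> \<le> \<omega>" for c \<epsilon> \<omega>
  proof -
    have em: "e c \<epsilon> \<in> borel_measurable borel"
      unfolding e_def using smooth_measurable[OF \<eta>(1)] by simp
    have e_out: "e c \<epsilon> t = 0" if "\<epsilon> \<le> \<bar>t - c\<bar>" for t
      using \<eta>(3)[of "(t - c) / \<epsilon>"] that \<epsilon> by (simp add: e_def)
    obtain M where M: "\<And>t. \<bar>\<eta> t\<bar> \<le> M"
    proof -
      have "test_fun UNIV \<eta>"
        by (rule test_funI[OF \<eta>(1), of "cbox (-1) 1"], simp, simp) (rule \<eta>(3), force simp: abs_if)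
      from test_fun_bounded[OF this] show ?thesis using that by (metis real_norm_def)
    qed
    have eb: "\<bar>e c \<epsilon> t\<bar> \<le> M / \<epsilon>" for t using M[of "(t - c) / \<epsilon>"] \<epsilon> by (simp add: e_def divide_right_mono)
    have ind: "e c \<epsilon> t * h = indicator {c - \<epsilon>..c + \<epsilon>} t * (e c \<epsilon> t * h)" for t h
      using e_out[of t] \<epsilon> by (cases "t \<in> {c - \<epsilon>..c + \<epsilon>}") (auto simp: abs_if split: if_splits)
    have ei: "integrable lborel (e c \<epsilon>)"
    proof -
      have "e c \<epsilon> = (\<lambda>t. indicator {c - \<epsilon>..c + \<epsilon>} t * e c \<epsilon> t)" using ind[of _ 1] by auto
      then show ?thesis using bdd_int[OF em eb, of "c - \<epsilon>" "c + \<epsilon>"] by simp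
    qed
    have "\<bar>e c \<epsilon> t * f t\<bar> \<le> M / \<epsilon> * B" for t
      unfolding abs_mult using eb[of t] f(3)[of t] by (intro mult_mono) auto
    then have "integrable lborel (\<lambda>t. indicator {c - \<epsilon>..c + \<epsilon>} t * (e c \<epsilon> t * f t))"
      by (rule bdd_int[rotated]) (use em f(2) in simp)
    then show efi: "integrable lborel (\<lambda>t. e c \<epsilon> t * f t)" by (simp flip: ind)
    have mass: "(\<integral>t. e c \<epsilon> t \<partial>lborel) = 1"
      using \<epsilon> \<eta>(4) integral_lborel_affine[of "e c \<epsilon>" \<epsilon> c] em by (simp add: e_def)
    have "\<bar>(\<integral>t. e c \<epsilon> t * f t \<partial>lborel) - f c\<bar> = \<bar>\<integral>t. e c \<epsilon> t * f t - e c \<epsilon> t * f c \<partial>lborel\<bar>"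
      using efi ei mass by simp
    also have "\<dots> \<le> (\<integral>t. \<bar>e c \<epsilon> t * f t - e c \<epsilon> t * f c\<bar> \<partial>lborel)" by (rule integral_abs_bound)
    also have "\<dots> \<le> (\<integral>t. e c \<epsilon> t * \<omega> \<partial>lborel)"
    proof (rule integral_mono)
      fix t
      have e0: "0 \<le> e c \<epsilon> t" using \<eta>(2) \<epsilon> by (simp add: e_def)
      have "\<bar>e c \<epsilon> t * f t - e c \<epsilon> t * f c\<bar> = e c \<epsilon> t * \<bar>f t - f c\<bar>"
        using e0 by (simp add: abs_mult flip: right_diff_distrib)
      also have "\<dots> \<le> e c \<epsilon> t * \<omega>"
        using \<omega>[of t] e_out[of t] e0 by (cases "\<bar>t - c\<bar> \<le> \<epsilon>") (auto intro: mult_left_mono)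
      finally show "\<bar>e c \<epsilon> t * f t - e c \<epsilon> t * f c\<bar> \<le> e c \<epsilon> t * \<omega>" .
    qed (use efi ei in auto)
    also have "\<dots> = \<omega>" using mass by simp
    finally show "\<bar>(\<integral>t. e c \<epsilon> t * f t \<partial>lborel) - f c\<bar> \<le> \<omega>" .
  qed
  have "\<bar>f b - f a - J\<bar> \<le> (2 + 8 * B) * \<delta>" if \<delta>: "0 < \<delta>" for \<delta>
  proof -
    have ctd: "\<exists>d>0. \<forall>t. \<bar>t - c\<bar> \<le> d \<longrightarrow> \<bar>f t - f c\<bar> \<le> \<delta>" if "\<alpha> < c" "c < \<beta>" for c
    proof -
      have "isCont f c"
        using continuous_on_interior[OF f(1), of c] that by simp
      then obtain d where d: "0 < d" "\<And>t. \<bar>t - c\<bar> < d \<Longrightarrow> \<bar>f t - f c\<bar> < \<delta>"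
        using \<delta> unfolding continuous_at_eps_delta dist_real_def by blast
      have "\<bar>f t - f c\<bar> \<le> \<delta>" if "\<bar>t - c\<bar> \<le> d / 2" for t
        using d(1) that by (intro less_imp_le d(2)) linarith
      then show ?thesis using d(1) by (intro exI[of _ "d / 2"]) auto
    qed
    obtain d1 where d1: "0 < d1" "\<And>t. \<bar>t - a\<bar> \<le> d1 \<Longrightarrow> \<bar>f t - f a\<bar> \<le> \<delta>" using ctd[of a] ab by auto
    obtain d2 where d2: "0 < d2" "\<And>t. \<bar>t - b\<bar> \<le> d2 \<Longrightarrow> \<bar>f t - f b\<bar> \<le> \<delta>" using ctd[of b] ab by auto
    \<comment> \<open>\<open>d1\<close> and \<open>d2\<close> control the oscillation of
      \<open>f\<close> at the two ends, \<open>\<delta>\<close> bounds the length of the transition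
      zones, and the last two entries keep the support of \<open>\<theta>\<close> inside the open
      interval.\<close>
    define \<epsilon> where "\<epsilon> = Min {d1, d2, \<delta>, (a - \<alpha>) / 2, (\<beta> - b) / 2}"
    have \<epsilon>: "0 < \<epsilon>" "\<epsilon> \<le> d1" "\<epsilon> \<le> d2" "\<epsilon> \<le> \<delta>" "\<epsilon> \<le> (a - \<alpha>) / 2" "\<epsilon> \<le> (\<beta> - b) / 2"
    proof -
      show "0 < \<epsilon>" using d1(1) d2(1) \<delta> ab by (simp add: \<epsilon>_def)
      show "\<epsilon> \<le> d1" "\<epsilon> \<le> d2" "\<epsilon> \<le> \<delta>" "\<epsilon> \<le> (a - \<alpha>) / 2" "\<epsilon> \<le> (\<beta> - b) / 2"
        unfolding \<epsilon>_def by (rule Min.coboundedI; simp)+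
    qed
    define \<theta> where "\<theta> t = H ((t - a) / \<epsilon>) - H ((t - b) / \<epsilon>)" for t
    have "smooth (\<lambda>t. H (- c / \<epsilon> + t / \<epsilon>))" for c
      by (rule smooth_affine[OF bounded_linear_divide H(1)])
    then have th_s: "smooth \<theta>"
      unfolding \<theta>_def by (intro smooth_diff) (simp_all add: diff_divide_distrib)
    have th0: "\<theta> t = 0" if "t \<notin> {a - \<epsilon>..b + \<epsilon>}" for t
    proof -
      from that consider "t < a - \<epsilon>" | "t > b + \<epsilon>" by fastforce
      then show ?thesis
      proof cases
        case 1
        then have "(t - a) / \<epsilon> \<le> -1" "(t - b) / \<epsilon> \<le> -1" using \<epsilon>(1) ab(2) by (auto simp: divide_simps)
        then show ?thesis by (simp add: \<theta>_def H)
      next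
        case 2
        then have "1 \<le> (t - a) / \<epsilon>" "1 \<le> (t - b) / \<epsilon>" using \<epsilon>(1) ab(2) by (auto simp: divide_simps)
        then show ?thesis by (simp add: \<theta>_def H)
      qed
    qed
    have tf: "test_fun {\<alpha><..<\<beta>} \<theta>"
      by (rule test_funI[OF th_s, of "{a - \<epsilon>..b + \<epsilon>}"]) (use \<epsilon> ab th0 in auto)
    have der: "(\<theta> has_real_derivative (e a \<epsilon> t - e b \<epsilon> t)) (at t)" for t
    proof -
      have "((\<lambda>t. H ((t - c) / \<epsilon>)) has_real_derivative e c \<epsilon> t) (at t)" for c
      proof -
        have "((\<lambda>t. (t - c) / \<epsilon>) has_real_derivative 1 / \<epsilon>) (at t)"
          using \<epsilon>(1) by (auto intro!: derivative_eq_intros)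
        from DERIV_chain2[OF H(2) this] show ?thesis by (simp add: e_def)
      qed
      then show ?thesis unfolding \<theta>_def by (intro DERIV_diff)
    qed
    have mol_a: "integrable lborel (\<lambda>t. e a \<epsilon> t * f t)" "\<bar>(\<integral>t. e a \<epsilon> t * f t \<partial>lborel) - f a\<bar> \<le> \<delta>"
      using mollify[OF \<epsilon>(1), of a \<delta>] d1(2) \<epsilon>(2) by auto
    have mol_b: "integrable lborel (\<lambda>t. e b \<epsilon> t * f t)" "\<bar>(\<integral>t. e b \<epsilon> t * f t \<partial>lborel) - f b\<bar> \<le> \<delta>"
      using mollify[OF \<epsilon>(1), of b \<delta>] d2(2) \<epsilon>(3) by auto
    have thmeas: "\<theta> \<in> borel_measurable borel" by (rule smooth_measurable[OF th_s])
    have thb: "\<bar>\<theta> t\<bar> \<le> 1" for t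
      using H(5)[of "(t - a) / \<epsilon>"] H(6)[of "(t - a) / \<epsilon>"] H(5)[of "(t - b) / \<epsilon>"] H(6)[of "(t - b) / \<epsilon>"]
      by (simp add: \<theta>_def)
    have thFb: "\<bar>\<theta> t * F t\<bar> \<le> B" for t
      unfolding abs_mult using mult_mono[OF thb[of t] F(2)[of t]] by simp
    have eqi: "\<theta> t * F t = indicator {a - \<epsilon>..b + \<epsilon>} t * (\<theta> t * F t)" for t
      using th0[of t] by (auto simp: indicator_def)
    have "integrable lborel (\<lambda>t. indicator {a - \<epsilon>..b + \<epsilon>} t * (\<theta> t * F t))"
      by (rule bdd_int[OF _ thFb]) (use thmeas F(1) in simp)
    then have thFi: "integrable lborel (\<lambda>t. \<theta> t * F t)" by (simp flip: eqi)
    have inF: "integrable lborel (\<lambda>t. indicator {a..b} t * F t)" by (rule bdd_int[OF F])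
    have "\<bar>(\<integral>t. \<theta> t * F t \<partial>lborel) - J\<bar> = \<bar>\<integral>t. \<theta> t * F t - indicator {a..b} t * F t \<partial>lborel\<bar>"
      using thFi inF by (simp add: J_def)
    also have "\<dots> \<le> (\<integral>t. \<bar>\<theta> t * F t - indicator {a..b} t * F t\<bar> \<partial>lborel)" by (rule integral_abs_bound)
    \<comment> \<open>\<open>\<theta>\<close> differs from the indicator only in two windows of
      length \<open>2 * \<epsilon>\<close>, where the integrand is at most \<open>2 * B\<close>;
      this yields \<open>8 * B * \<epsilon>\<close>.\<close>
    also have "\<dots> \<le> (\<integral>t. 2 * B * indicator {a - \<epsilon>..a + \<epsilon>} t + 2 * B * indicator {b - \<epsilon>..b + \<epsilon>} t \<partial>lborel)"
    proof (rule integral_mono)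
      fix t
      have small: "\<bar>\<theta> t * F t - indicator {a..b} t * F t\<bar> \<le> 2 * B"
        using thFb[of t] F(2)[of t] B0 by (auto simp: indicator_def)
      have "\<theta> t = indicator {a..b} t" if "t \<notin> {a - \<epsilon>..a + \<epsilon>}" "t \<notin> {b - \<epsilon>..b + \<epsilon>}"
      proof -
        from that consider "t < a - \<epsilon>" | "t > b + \<epsilon>" | "a + \<epsilon> < t" "t < b - \<epsilon>" using ab by fastforce
        then show ?thesis
        proof cases
          case 3
          then have "1 \<le> (t - a) / \<epsilon>" "(t - b) / \<epsilon> \<le> -1" using \<epsilon>(1) by (auto simp: divide_simps)
          then show ?thesis using 3 \<epsilon>(1) by (simp add: \<theta>_def H)
        qed (use th0[of t] \<epsilon>(1) ab in auto)
      qed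
      then show "\<bar>\<theta> t * F t - indicator {a..b} t * F t\<bar>
          \<le> 2 * B * indicator {a - \<epsilon>..a + \<epsilon>} t + 2 * B * indicator {b - \<epsilon>..b + \<epsilon>} t"
        using small B0 by (cases "t \<in> {a - \<epsilon>..a + \<epsilon>}"; cases "t \<in> {b - \<epsilon>..b + \<epsilon>}") auto
    qed (use thFi inF icc in auto)
    also have "\<dots> = 8 * B * \<epsilon>" using \<epsilon>(1) by simp
    also have "\<dots> \<le> 8 * B * \<delta>" using \<epsilon>(4) B0 by (simp add: mult_left_mono)
    finally have 3: "\<bar>(\<integral>t. \<theta> t * F t \<partial>lborel) - J\<bar> \<le> 8 * B * \<delta>" .
    have "0 = (\<integral>t. (e a \<epsilon> t * f t - e b \<epsilon> t * f t) + \<theta> t * F t \<partial>lborel)"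
      using weak[OF tf der] by (simp add: left_diff_distrib)
    also have "\<dots> = (\<integral>t. e a \<epsilon> t * f t \<partial>lborel) - (\<integral>t. e b \<epsilon> t * f t \<partial>lborel) + (\<integral>t. \<theta> t * F t \<partial>lborel)"
      using mol_a(1) mol_b(1) thFi by simp
    finally show ?thesis using mol_a(2) mol_b(2) 3 by (simp add: algebra_simps)
  qed
  note bound = this
  have "\<bar>f b - f a - J\<bar> \<le> 0"
  proof (rule field_le_epsilon)
    fix x :: real assume "0 < x"
    then show "\<bar>f b - f a - J\<bar> \<le> 0 + x" using bound[of "x / (2 + 8 * B)"] B0 by simp
  qed
  then have "J = f b - f a" by simp
  moreover have "(F has_integral J) {a..b}"
    using set_borel_integral_eq_integral[OF Fint] integrable_integral
    by (auto simp: J_def set_lebesgue_integral_def)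
  ultimately show ?thesis by simp
qed

section \<open>The filtered flow\<close>

text \<open>A class closed under sums and products that contains the filtered fields and the
  derivatives in use. Multiplied by a continuous function, its members are integrable on compact
  sets, which is what Fubini asks for later.\<close>

definition bounded_meas :: "(real \<Rightarrow> real^3 \<Rightarrow> real) \<Rightarrow> bool" where
  "bounded_meas f \<longleftrightarrow> (\<lambda>(t, x). f t x) \<in> borel_measurable borel \<and> (\<exists>C. \<forall>t x. \<bar>f t x\<bar> \<le> C)"

lemma bounded_meas_add: "bounded_meas f \<Longrightarrow> bounded_meas g \<Longrightarrow> bounded_meas (\<lambda>t x. f t x + g t x)"
proof -
  assume f: "bounded_meas f" and g: "bounded_meas g"
  obtain C D where C: "\<And>t x. \<bar>f t x\<bar> \<le> C" and D: "\<And>t x. \<bar>g t x\<bar> \<le> D"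
    using f g unfolding bounded_meas_def by blast
  have "\<bar>f t x + g t x\<bar> \<le> C + D" for t x
    using C[of t x] D[of t x] by linarith
  then show ?thesis using f g unfolding bounded_meas_def split_beta by auto
qed

lemma bounded_meas_mult: "bounded_meas f \<Longrightarrow> bounded_meas g \<Longrightarrow> bounded_meas (\<lambda>t x. f t x * g t x)"
proof -
  assume f: "bounded_meas f" and g: "bounded_meas g"
  obtain C D where C: "\<And>t x. \<bar>f t x\<bar> \<le> C" and D: "\<And>t x. \<bar>g t x\<bar> \<le> D"
    using f g unfolding bounded_meas_def by blast
  have "\<bar>f t x * g t x\<bar> \<le> C * D" for t x
    unfolding abs_mult by (rule mult_mono[OF C D]) (use C[of 0 0] in auto)
  then show ?thesis using f g unfolding bounded_meas_def split_beta by auto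
qed

lemma bounded_meas_const: "bounded_meas (\<lambda>t x. c)"
  unfolding bounded_meas_def by auto

lemma bounded_meas_minus: "bounded_meas f \<Longrightarrow> bounded_meas (\<lambda>t x. - f t x)"
  using bounded_meas_mult[OF bounded_meas_const[of "-1"]] by simp

lemma bounded_meas_diff: "bounded_meas f \<Longrightarrow> bounded_meas g \<Longrightarrow> bounded_meas (\<lambda>t x. f t x - g t x)"
  using bounded_meas_add[OF _ bounded_meas_minus, of f g] by simp

lemma bounded_meas_sum: "(\<And>i. i \<in> A \<Longrightarrow> bounded_meas (f i)) \<Longrightarrow> bounded_meas (\<lambda>t x. \<Sum>i\<in>A. f i t x)"
  by (induction A rule: infinite_finite_induct) (auto intro: bounded_meas_add bounded_meas_const)

lemmas bounded_meas_intros = bounded_meas_add bounded_meas_mult bounded_meas_const bounded_meas_minus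
  bounded_meas_diff bounded_meas_sum

section \<open>Slices, reflections and the curl kernel\<close>

lemma borel_measurable_slice:
  fixes f :: "real \<Rightarrow> real^3 \<Rightarrow> 'b::second_countable_topology"
  assumes "(\<lambda>(t, x). f t x) \<in> borel_measurable borel"
  shows "f t \<in> borel_measurable borel" "(\<lambda>t. f t x) \<in> borel_measurable borel"
proof -
  have "(\<lambda>x. (t, x)) \<in> borel \<rightarrow>\<^sub>M (borel :: (real \<times> (real^3)) measure)"
    "(\<lambda>t. (t, x)) \<in> borel \<rightarrow>\<^sub>M (borel :: (real \<times> (real^3)) measure)"
    by (simp_all add: borel_prod[symmetric])
  from measurable_compose[OF this(1) assms] measurable_compose[OF this(2) assms]
  show "f t \<in> borel_measurable borel" "(\<lambda>t. f t x) \<in> borel_measurable borel" by simp_all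
qed

lemma test_fun_abs_bounded:
  fixes f :: "'a::euclidean_space \<Rightarrow> real"
  assumes "test_fun A f" obtains M where "\<And>x. \<bar>f x\<bar> \<le> M"
  using test_fun_bounded[OF assms] unfolding real_norm_def by blast

lemma pd_reflect:
  fixes f :: "real^'n::finite \<Rightarrow> real"
  assumes "smooth f" shows "pd j (\<lambda>y. f (x - y)) y = - pd j f (x - y)"
proof -
  have lin: "linear (frechet_derivative f (at z))" for z
    using smooth_has_derivative[OF assms] by (intro bounded_linear.linear has_derivative_bounded_linear)
  have "pd j (\<lambda>y. f (x + - y)) y = frechet_derivative f (at (x + - y)) (- axis j 1)"
    unfolding pd_def
    by (subst frechet_derivative_affine[OF bounded_linear_minus[OF bounded_linear_ident] smooth_differentiable[OF assms]]) simp
  then show ?thesis by (simp add: linear_neg[OF lin] pd_def)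
qed

lemma smooth_reflect:
  fixes f :: "'a::euclidean_space \<Rightarrow> 'b::real_normed_vector"
  shows "smooth f \<Longrightarrow> smooth (\<lambda>y. f (x - y))"
  using smooth_affine[OF bounded_linear_minus[OF bounded_linear_ident], of f x] by simp

lemma test_fun_reflect:
  fixes K :: "real^'n::finite \<Rightarrow> real"
  assumes "test_fun UNIV K" shows "test_fun UNIV (\<lambda>y. K (x - y))"
proof -
  obtain R where R: "\<And>z. R < norm z \<Longrightarrow> K z = 0" using test_fun_supp_ball[OF assms] by blast
  show ?thesis
  proof (rule test_funI[of _ "cball x R"])
    show "smooth (\<lambda>y. K (x - y))" using assms by (intro smooth_reflect) (simp add: test_fun_def)
    show "K (x - y) = 0" if "y \<notin> cball x R" for y using that R by (simp add: dist_norm)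
  qed auto
qed

text \<open>\<open>rotker \<Phi> i k\<close> is the \<open>(i, k)\<close> entry of the matrix kernel whose convolution with \<open>v\<close> is
  \<open>curl (\<Phi> * v)\<close>.\<close>

definition rotker :: "(real^3 \<Rightarrow> real) \<Rightarrow> 3 \<Rightarrow> 3 \<Rightarrow> real^3 \<Rightarrow> real" where
  "rotker \<Phi> i k z = curl (\<lambda>y. axis k (\<Phi> y)) z $ i"

lemma rotker_simps:
  "rotker \<Phi> 1 1 = (\<lambda>z. 0)" "rotker \<Phi> 1 2 = (\<lambda>z. - pd 3 \<Phi> z)" "rotker \<Phi> 1 3 = pd 2 \<Phi>"
  "rotker \<Phi> 2 1 = pd 3 \<Phi>" "rotker \<Phi> 2 2 = (\<lambda>z. 0)" "rotker \<Phi> 2 3 = (\<lambda>z. - pd 1 \<Phi> z)"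
  "rotker \<Phi> 3 1 = (\<lambda>z. - pd 2 \<Phi> z)" "rotker \<Phi> 3 2 = pd 1 \<Phi>" "rotker \<Phi> 3 3 = (\<lambda>z. 0)"
  by (auto simp: rotker_def curl_nth axis_def)

lemma test_fun_rotker:
  assumes "test_fun UNIV \<Phi>" shows "test_fun UNIV (rotker \<Phi> i k)"
proof -
  have "i = 1 \<or> i = 2 \<or> i = 3" "k = 1 \<or> k = 2 \<or> k = 3" by (rule exhaust_3)+
  then show ?thesis
    by (elim disjE) (simp_all add: rotker_simps test_fun_zero test_fun_minus test_fun_pd assms)
qed

text \<open>Row \<open>i\<close> of the matrix is minus the curl of \<open>\<Phi>\<close> times the
  \<open>i\<close>-th unit vector, hence solenoidal. This admits the row as a test field in the
  pressure-free formulation.\<close>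

lemma rotker_div:
  assumes "smooth \<Phi>" shows "(\<Sum>k\<in>UNIV. pd k (rotker \<Phi> i k) z) = 0"
proof -
  have "i = 1 \<or> i = 2 \<or> i = 3" by (rule exhaust_3)
  then show ?thesis
    by (elim disjE)
      (simp_all add: rotker_simps sum_3 pd_minus smooth_pd assms
        pd_commute[OF assms, of 2 1] pd_commute[OF assms, of 3 1] pd_commute[OF assms, of 3 2])
qed

lemma integrable_kernel_scaleR:
  fixes g :: "real^3 \<Rightarrow> 'b::euclidean_space"
  assumes K: "test_fun UNIV K" and g: "g \<in> borel_measurable borel"
    and e: "integrable lborel e" "\<And>y. norm (g y) \<le> 1 + e y"
  shows "integrable lborel (\<lambda>y. K (x - y) *\<^sub>R g y)"
proof -
  obtain M where M: "\<And>z. \<bar>K z\<bar> \<le> M" using test_fun_abs_bounded[OF K] by blast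
  have M0: "0 \<le> M" using M[of 0] by simp
  have Kx: "test_fun UNIV (\<lambda>y. K (x - y))" by (rule test_fun_reflect[OF K])
  show ?thesis
  proof (rule Bochner_Integration.integrable_bound)
    show "integrable lborel (\<lambda>y. \<bar>K (x - y)\<bar> + M * \<bar>e y\<bar>)"
      using test_fun_integrable[OF Kx] e(1) by simp
    show "(\<lambda>y. K (x - y) *\<^sub>R g y) \<in> borel_measurable lborel"
      using g smooth_measurable[OF test_fun_smooth[OF Kx]] by simp
    show "AE y in lborel. norm (K (x - y) *\<^sub>R g y) \<le> norm (\<bar>K (x - y)\<bar> + M * \<bar>e y\<bar>)"
    proof (rule AE_I2)
      fix y
      have "norm (K (x - y) *\<^sub>R g y) \<le> \<bar>K (x - y)\<bar> * (1 + \<bar>e y\<bar>)"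
        using e(2)[of y] by (auto intro!: mult_left_mono)
      also have "\<dots> \<le> \<bar>K (x - y)\<bar> + M * \<bar>e y\<bar>"
        using M[of "x - y"] by (simp add: distrib_left mult_right_mono)
      finally show "norm (K (x - y) *\<^sub>R g y) \<le> norm (\<bar>K (x - y)\<bar> + M * \<bar>e y\<bar>)" using M0 by simp
    qed
  qed
qed

text \<open>What is used of a Leray--Hopf solution on \<open>[t0 - 1, t0]\<close>. In the application \<open>v\<close> is the solution
  extended by zero to all times, so that no measurability or integrability is relative to \<open>I\<close>.\<close>

locale flow =
  fixes v :: "real \<Rightarrow> real^3 \<Rightarrow> real^3" and t0 B :: real
  assumes meas: "(\<lambda>(t, x). v t x) \<in> borel_measurable borel"
    and sq: "integrable lborel (\<lambda>x. (norm (v t x))\<^sup>2)"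
    and energy: "(\<integral>x. (norm (v t x))\<^sup>2 \<partial>lborel) \<le> B"
    and div_free: "weakly_div_free (v t)"
    and weak_cont: "square_integrable w \<Longrightarrow> continuous_on {t0 - 1..t0} (\<lambda>t. \<integral>x. v t x \<bullet> w x \<partial>lborel)"
    and weak_ns: "test_fun ({t0 - 1<..<t0} \<times> UNIV) \<psi> \<Longrightarrow> (\<And>t x. divg (\<lambda>y. \<psi> (t, y)) x = 0) \<Longrightarrow>
      (\<integral>(t, x). v t x \<bullet> vector_derivative (\<lambda>s. \<psi> (s, x)) (at t)
          + (\<Sum>i\<in>UNIV. \<Sum>j\<in>UNIV. v t x $ i * v t x $ j * pd j (\<lambda>y. \<psi> (t, y) $ i) x)
          + v t x \<bullet> lapl (\<lambda>y. \<psi> (t, y)) x \<partial>lborel) = 0"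
begin

text \<open>The bound covers the components of \<open>v\<close> as well as their products, so the
  linear and the quadratic terms of the equation share one convolution theory.\<close>

definition dominated :: "(real \<Rightarrow> real^3 \<Rightarrow> real) \<Rightarrow> bool" where
  "dominated a \<longleftrightarrow> (\<lambda>(t, x). a t x) \<in> borel_measurable borel \<and> (\<forall>t x. \<bar>a t x\<bar> \<le> 1 + (norm (v t x))\<^sup>2)"

lemma meas_component: "(\<lambda>(t, x). v t x $ k) \<in> borel_measurable borel"
proof -
  have "(\<lambda>p. (case p of (t, x) \<Rightarrow> v t x) $ k) \<in> borel_measurable borel"
    by (rule measurable_compose[OF meas]) (intro borel_measurable_continuous_onI continuous_intros)
  then show ?thesis by (simp add: split_beta)
qed

lemma dominated_component: "dominated (\<lambda>t x. v t x $ k)"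
proof -
  have "\<bar>v t x $ k\<bar> \<le> 1 + (norm (v t x))\<^sup>2" for t x
  proof -
    have "\<bar>v t x $ k\<bar> \<le> norm (v t x)" by (rule component_le_norm_cart)
    also have "\<dots> \<le> 1 + (norm (v t x))\<^sup>2"
      using zero_le_power2[of "norm (v t x) - 1"] norm_ge_zero[of "v t x"]
      unfolding power2_diff one_power2 mult_1_right by linarith
    finally show ?thesis .
  qed
  then show ?thesis using meas_component unfolding dominated_def by blast
qed

lemma dominated_product: "dominated (\<lambda>t x. v t x $ i * v t x $ k)"
proof -
  have "\<bar>v t x $ i * v t x $ k\<bar> \<le> 1 + (norm (v t x))\<^sup>2" for t x
  proof -
    have "\<bar>v t x $ i * v t x $ k\<bar> \<le> norm (v t x) * norm (v t x)"
      unfolding abs_mult by (intro mult_mono component_le_norm_cart) auto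
    then show ?thesis by (simp add: power2_eq_square)
  qed
  moreover have "(\<lambda>(t, x). v t x $ i * v t x $ k) \<in> borel_measurable borel"
    using borel_measurable_times[OF meas_component[of i] meas_component[of k]] by (simp add: split_beta)
  ultimately show ?thesis unfolding dominated_def by blast
qed

lemma dominated_slice: "dominated a \<Longrightarrow> a t \<in> borel_measurable borel"
  unfolding dominated_def using borel_measurable_slice(1) by blast

lemma loc_int_dominated:
  assumes "dominated a" shows "loc_int (a t)"
  unfolding loc_int_def
proof
  fix R :: real
  show "integrable lborel (\<lambda>y. indicator (cball 0 R) y * a t y)"
  proof (rule Bochner_Integration.integrable_bound[where f="\<lambda>y. indicator (cball 0 R) y + (norm (v t y))\<^sup>2"])
    have "integrable lborel (indicat_real (cball (0::real^3) R))"
      using emeasure_lborel_cball_finite[of 0 R] by (intro integrable_real_indicator) auto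
    then show "integrable lborel (\<lambda>y. indicator (cball 0 R) y + (norm (v t y))\<^sup>2)"
      using sq by auto
    show "(\<lambda>y. indicator (cball 0 R) y * a t y) \<in> borel_measurable lborel"
      using dominated_slice[OF assms, of t] by (intro borel_measurable_times borel_measurable_indicator) simp_all
    show "AE y in lborel. norm (indicat_real (cball 0 R) y * a t y) \<le> norm (indicat_real (cball 0 R) y + (norm (v t y))\<^sup>2)"
      using assms unfolding dominated_def by (intro AE_I2) (simp add: indicator_def)
  qed
qed

text \<open>The bound is uniform in \<open>t\<close> and \<open>x\<close>: the constant 1
  contributes the L1 norm of the kernel, and the square of \<open>v\<close> contributes the supremum
  of the kernel times the energy bound \<open>B\<close>.\<close>

lemma conv_bounded:
  assumes a: "dominated a" and K: "test_fun UNIV K"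
  shows "\<exists>C\<ge>0. \<forall>t x. (\<integral>y. \<bar>K (x - y) * a t y\<bar> \<partial>lborel) \<le> C"
proof -
  obtain M where M: "\<And>z. \<bar>K z\<bar> \<le> M" using test_fun_abs_bounded[OF K] by blast
  have M0: "0 \<le> M" using M[of 0] by simp
  have Ki: "integrable lborel (\<lambda>y. \<bar>K (x - y)\<bar>)" for x
    using test_fun_integrable[OF test_fun_reflect[OF K]] by simp
  have "(\<integral>y. \<bar>K (x - y) * a t y\<bar> \<partial>lborel) \<le> (\<integral>y. \<bar>K y\<bar> \<partial>lborel) + M * B" for t x
  proof -
    have "(\<integral>y. \<bar>K (x - y) * a t y\<bar> \<partial>lborel) \<le> (\<integral>y. \<bar>K (x - y)\<bar> + M * (norm (v t y))\<^sup>2 \<partial>lborel)"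
    proof (rule integral_mono)
      show "integrable lborel (\<lambda>y. \<bar>K (x - y) * a t y\<bar>)"
        using conv_integrable[OF K loc_int_dominated[OF a]] by simp
      show "integrable lborel (\<lambda>y. \<bar>K (x - y)\<bar> + M * (norm (v t y))\<^sup>2)" using Ki sq by simp
      fix y
      have "\<bar>K (x - y) * a t y\<bar> \<le> \<bar>K (x - y)\<bar> * (1 + (norm (v t y))\<^sup>2)"
        unfolding abs_mult using a by (intro mult_left_mono) (auto simp: dominated_def)
      also have "\<dots> \<le> \<bar>K (x - y)\<bar> + M * (norm (v t y))\<^sup>2"
        using M[of "x - y"] by (simp add: distrib_left mult_right_mono)
      finally show "\<bar>K (x - y) * a t y\<bar> \<le> \<bar>K (x - y)\<bar> + M * (norm (v t y))\<^sup>2" .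
    qed
    also have "\<dots> = (\<integral>y. \<bar>K (x - y)\<bar> \<partial>lborel) + M * (\<integral>y. (norm (v t y))\<^sup>2 \<partial>lborel)"
      using Ki sq by simp
    also have "(\<integral>y. \<bar>K (x - y)\<bar> \<partial>lborel) = (\<integral>y. \<bar>K y\<bar> \<partial>lborel)"
      using integral_lborel_affine[of "\<lambda>y. \<bar>K y\<bar>" "-1" x] smooth_measurable[OF test_fun_smooth[OF K]] by simp
    finally show ?thesis using mult_left_mono[OF energy[of t] M0] by linarith
  qed
  note b = this
  have "0 \<le> (\<integral>y. \<bar>K (0 - y) * a 0 y\<bar> \<partial>lborel)" by simp
  with b[of 0 0] have "0 \<le> (\<integral>y. \<bar>K y\<bar> \<partial>lborel) + M * B" by linarith
  then show ?thesis using b by (intro exI[of _ "(\<integral>y. \<bar>K y\<bar> \<partial>lborel) + M * B"]) simp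
qed

lemma conv_kernel_measurable:
  assumes a: "dominated a" and K: "test_fun UNIV K"
  shows "(\<lambda>p. K (snd (fst p) - snd p) * a (fst (fst p)) (snd p)) \<in> borel_measurable borel"
proof -
  have "(\<lambda>p. snd (fst p) - snd p) \<in> borel_measurable (borel :: ((real \<times> (real^3)) \<times> (real^3)) measure)"
    by (rule borel_measurable_continuous_onI) (intro continuous_intros)
  from measurable_compose[OF this smooth_measurable[OF test_fun_smooth[OF K]]]
  have 1: "(\<lambda>p. K (snd (fst p) - snd p)) \<in> borel_measurable (borel :: ((real \<times> (real^3)) \<times> (real^3)) measure)" .
  have 2: "(\<lambda>p. (fst (fst p), snd p)) \<in> borel_measurable (borel :: ((real \<times> (real^3)) \<times> (real^3)) measure)"
    by (rule borel_measurable_continuous_onI) (intro continuous_intros)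
  have "(\<lambda>p. a (fst p) (snd p)) \<in> borel_measurable borel"
    using a unfolding dominated_def split_beta by blast
  note 3 = measurable_compose[OF 2 this, unfolded fst_conv snd_conv]
  show ?thesis by (rule borel_measurable_times[OF 1 3])
qed

lemma bounded_meas_conv:
  assumes a: "dominated a" and K: "test_fun UNIV K"
  shows "bounded_meas (\<lambda>t. conv K (a t))"
proof -
  from conv_bounded[OF a K] obtain C
    where C: "0 \<le> C" "\<And>t x. (\<integral>y. \<bar>K (x - y) * a t y\<bar> \<partial>lborel) \<le> C"
    by auto
  have bd: "\<bar>conv K (a t) x\<bar> \<le> C" for t x
    unfolding conv_real using integral_abs_bound[of lborel "\<lambda>y. K (x - y) * a t y"] C(2)[of x t]
    by (rule order_trans)
  have "(\<lambda>p. \<integral>y. K (snd p - y) * a (fst p) y \<partial>lborel) \<in> borel_measurable borel"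
  proof (rule lborel.borel_measurable_lebesgue_integral)
    have "(\<lambda>p. K (snd (fst p) - snd p) * a (fst (fst p)) (snd p)) \<in> borel_measurable (borel \<Otimes>\<^sub>M borel)"
      unfolding borel_prod by (rule conv_kernel_measurable[OF a K])
    then show "(\<lambda>(p, y). K (snd p - y) * a (fst p) y) \<in> borel_measurable (borel \<Otimes>\<^sub>M lborel)"
      unfolding split_beta measurable_cong_sets[OF sets_pair_measure_cong[OF refl sets_lborel] refl] .
  qed
  then have "(\<lambda>(t, x). conv K (a t) x) \<in> borel_measurable borel"
    unfolding conv_real split_beta .
  with bd show ?thesis unfolding bounded_meas_def by blast
qed

text \<open>Fubini with the space variable inside. It reduces the space-time weak formulation at a
  fixed \<open>x\<close> to a scalar identity in time.\<close>

lemma space_time_integral: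
  assumes a: "dominated a" and K: "test_fun UNIV K" and \<theta>: "integrable lborel \<theta>"
  shows "integrable lborel (\<lambda>(t, y). \<theta> t * (K (x - y) * a t y))"
    "(\<integral>(t, y). \<theta> t * (K (x - y) * a t y) \<partial>lborel) = (\<integral>t. \<theta> t * conv K (a t) x \<partial>lborel)"
proof -
  from conv_bounded[OF a K] obtain C
    where C: "0 \<le> C" "\<And>t x. (\<integral>y. \<bar>K (x - y) * a t y\<bar> \<partial>lborel) \<le> C"
    by auto
  have th: "\<theta> \<in> borel_measurable borel" using borel_measurable_integrable[OF \<theta>] by simp
  have m0: "(\<lambda>(t, y). K (x - y) * a t y) \<in> borel_measurable (borel \<Otimes>\<^sub>M borel)"
  proof -
    have "(\<lambda>p. ((fst p, x), snd p)) \<in> borel_measurable (borel :: (real \<times> (real^3)) measure)"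
      by (rule borel_measurable_continuous_onI) (intro continuous_intros)
    from measurable_compose[OF this conv_kernel_measurable[OF a K]]
    show ?thesis by (simp add: borel_prod split_beta)
  qed
  have m: "(\<lambda>(t, y). \<theta> t * (K (x - y) * a t y)) \<in> borel_measurable (lborel \<Otimes>\<^sub>M lborel)"
  proof -
    have "(\<lambda>p::real \<times> (real^3). \<theta> (fst p)) \<in> borel_measurable (borel \<Otimes>\<^sub>M borel)"
      by (rule measurable_compose[OF measurable_fst th])
    from borel_measurable_times[OF this m0] show ?thesis by (simp add: split_beta cong: measurable_cong_sets)
  qed
  have int: "integrable (lborel \<Otimes>\<^sub>M lborel) (\<lambda>(t, y). \<theta> t * (K (x - y) * a t y))"
  proof (rule lborel_pair.Fubini_integrable[OF m])
    show "integrable lborel (\<lambda>t. \<integral>y. norm (case (t, y) of (t, y) \<Rightarrow> \<theta> t * (K (x - y) * a t y)) \<partial>lborel)"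
    proof (rule Bochner_Integration.integrable_bound[OF integrable_mult_right[OF \<theta>, of C]])
      show "(\<lambda>t. \<integral>y. norm (case (t, y) of (t, y) \<Rightarrow> \<theta> t * (K (x - y) * a t y)) \<partial>lborel) \<in> borel_measurable lborel"
        using measurable_compose[OF m borel_measurable_norm] by (intro lborel.borel_measurable_lebesgue_integral) (simp add: split_beta)
      show "AE t in lborel. norm (\<integral>y. norm (case (t, y) of (t, y) \<Rightarrow> \<theta> t * (K (x - y) * a t y)) \<partial>lborel) \<le> norm (C * \<theta> t)"
      proof (rule AE_I2)
        fix t
        show "norm (\<integral>y. norm (case (t, y) of (t, y) \<Rightarrow> \<theta> t * (K (x - y) * a t y)) \<partial>lborel) \<le> norm (C * \<theta> t)"
          using mult_left_mono[OF C(2)[of x t], of "\<bar>\<theta> t\<bar>"] C(1) by (simp add: abs_mult mult_ac)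
      qed
    qed
    show "AE t in lborel. integrable lborel (\<lambda>y. case (t, y) of (t, y) \<Rightarrow> \<theta> t * (K (x - y) * a t y))"
      using conv_integrable[OF K loc_int_dominated[OF a]] by (intro AE_I2) simp
  qed
  then show "integrable lborel (\<lambda>(t, y). \<theta> t * (K (x - y) * a t y))" by (simp add: lborel_prod)
  show "(\<integral>(t, y). \<theta> t * (K (x - y) * a t y) \<partial>lborel) = (\<integral>t. \<theta> t * conv K (a t) x \<partial>lborel)"
    using lborel_pair.integral_fst'[OF int] by (simp add: lborel_prod conv_real)
qed

lemma Ufil_nth:
  assumes "test_fun UNIV (scaled \<phi> l)"
  shows "Ufil \<phi> l v t x $ k = conv (scaled \<phi> l) (\<lambda>y. v t y $ k) x"
proof -
  have "norm (v t y) \<le> 1 + (norm (v t y))\<^sup>2" for y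
    using zero_le_power2[of "norm (v t y) - 1"] norm_ge_zero[of "v t y"]
    unfolding power2_diff one_power2 mult_1_right by linarith
  then have "integrable lborel (\<lambda>y. scaled \<phi> l (x - y) *\<^sub>R v t y)"
    using sq borel_measurable_slice(1)[OF meas] by (intro integrable_kernel_scaleR[OF assms])
  from integral_bounded_linear[OF bounded_linear_vec_nth this, of k]
  show ?thesis by (simp add: Ufil_def conv_def)
qed

lemma Rfil_nth:
  assumes K: "test_fun UNIV (scaled \<phi> l)"
  shows "Rfil \<phi> l v t x $ i $ k = conv (scaled \<phi> l) (\<lambda>y. v t y $ i * v t y $ k) x
    - Ufil \<phi> l v t x $ i * Ufil \<phi> l v t x $ k"
proof -
  \<comment> \<open>As a finite combination of matrix units with product coefficients, the outer
    product is measurable term by term.\<close>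
  have o: "outer a b = (\<Sum>i\<in>UNIV. \<Sum>j\<in>UNIV. (a $ i * b $ j) *\<^sub>R axis i (axis j 1))" for a b :: "real^3"
    by (simp add: outer_def vec_eq_iff axis_def sum_3 forall_3)
  have om: "(\<lambda>y. outer (v t y) (v t y)) \<in> borel_measurable borel"
    unfolding o using dominated_slice[OF dominated_product]
    by (intro borel_measurable_sum borel_measurable_scaleR) auto
  \<comment> \<open>The two sides are in fact equal, so the energy dominates the matrix-valued
    integrand too and the convolution may be read off entry by entry.\<close>
  have "norm (outer a a) \<le> (norm a)\<^sup>2" for a :: "real^3"
  proof -
    have "(norm (outer a a))\<^sup>2 = ((norm a)\<^sup>2)\<^sup>2"
      unfolding power2_norm_eq_inner
      by (simp add: outer_def inner_vec_def sum_3 power2_eq_square algebra_simps)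
    then have "(norm (outer a a))\<^sup>2 \<le> ((norm a)\<^sup>2)\<^sup>2" by (rule eq_refl)
    then show ?thesis by (rule power2_le_imp_le) (rule zero_le_power2)
  qed
  then have "norm (outer (v t y) (v t y)) \<le> 1 + (norm (v t y))\<^sup>2" for y
    by (rule order_trans) simp
  then have int: "integrable lborel (\<lambda>y. scaled \<phi> l (x - y) *\<^sub>R outer (v t y) (v t y))"
    using sq om by (intro integrable_kernel_scaleR[OF K])
  have "conv (scaled \<phi> l) (\<lambda>y. outer (v t y) (v t y)) x $ i $ k
      = conv (scaled \<phi> l) (\<lambda>y. outer (v t y) (v t y) $ i $ k) x"
    using integral_bounded_linear[OF bounded_linear_compose[OF bounded_linear_vec_nth[of k] bounded_linear_vec_nth[of i]] int]
    by (simp add: conv_def)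
  then show ?thesis by (simp add: Rfil_def outer_def)
qed

text \<open>The right-hand side of the vorticity equation, with all derivatives on the kernel.\<close>

definition vort_rhs :: "(real^3 \<Rightarrow> real) \<Rightarrow> real \<Rightarrow> real^3 \<Rightarrow> 3 \<Rightarrow> real" where
  "vort_rhs \<Phi> t x i = (\<Sum>k\<in>UNIV. \<Sum>j\<in>UNIV. conv (pd j (pd j (rotker \<Phi> i k))) (\<lambda>y. v t y $ k) x)
     - (\<Sum>k\<in>UNIV. \<Sum>j\<in>UNIV. conv (pd j (rotker \<Phi> i k)) (\<lambda>y. v t y $ k * v t y $ j) x)"

definition vort :: "(real^3 \<Rightarrow> real) \<Rightarrow> real \<Rightarrow> real^3 \<Rightarrow> 3 \<Rightarrow> real" where
  "vort \<Phi> t x i = (\<Sum>k\<in>UNIV. conv (rotker \<Phi> i k) (\<lambda>y. v t y $ k) x)"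

lemma bounded_meas_vort: "test_fun UNIV \<Phi> \<Longrightarrow> bounded_meas (\<lambda>t x. vort \<Phi> t x i)"
  unfolding vort_def
  by (intro bounded_meas_sum bounded_meas_conv[OF dominated_component] test_fun_rotker)

lemma bounded_meas_vort_rhs: "test_fun UNIV \<Phi> \<Longrightarrow> bounded_meas (\<lambda>t x. vort_rhs \<Phi> t x i)"
  unfolding vort_rhs_def
  by (intro bounded_meas_diff bounded_meas_sum bounded_meas_conv dominated_component dominated_product
      test_fun_pd test_fun_rotker)

text \<open>The test field is \<open>\<theta> t\<close> times row \<open>i\<close> of the curl
  kernel reflected about \<open>x\<close>. It is solenoidal, so the equation may be tested with it;
  each space derivative of the reflected kernel costs a sign, one for convection and two for
  diffusion.\<close>

lemma vorticity_weak:
  assumes \<Phi>: "test_fun UNIV \<Phi>" and \<theta>: "test_fun {t0 - 1<..<t0} \<theta>"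
    and \<theta>': "\<And>t. (\<theta> has_real_derivative \<theta>' t) (at t)"
  shows "(\<integral>t. \<theta>' t * vort \<Phi> t x i + \<theta> t * vort_rhs \<Phi> t x i \<partial>lborel) = 0"
proof -
  let ?w = "rotker \<Phi> i"
  have w: "test_fun UNIV (?w k)" for k by (rule test_fun_rotker[OF \<Phi>])
  note ws = test_fun_smooth[OF w]
  define \<psi> where "\<psi> p = \<theta> (fst p) *\<^sub>R (\<chi> k. ?w k (x - snd p))" for p :: "real \<times> (real^3)"
  \<comment> \<open>The three support radii are replaced by their sum, which bounds them
    all.\<close>
  obtain R where R: "\<And>k z. R < norm z \<Longrightarrow> ?w k z = 0"
  proof -
    have "\<exists>R>0. \<forall>z. R < norm z \<longrightarrow> ?w k z = 0" for k using test_fun_supp_ball[OF w, of k] by metis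
    then obtain R where R: "\<And>k. 0 < R k" "\<And>k z. R k < norm z \<Longrightarrow> ?w k z = 0" by metis
    have "R k \<le> (\<Sum>k\<in>UNIV. R k)" for k by (rule member_le_sum) (use R(1) in \<open>auto intro: less_imp_le\<close>)
    then show ?thesis using that[of "\<Sum>k\<in>UNIV. R k"] R(2) by (meson le_less_trans)
  qed
  have th_smooth: "smooth \<theta>" using \<theta> by (simp add: test_fun_def)
  have sm_psi: "smooth \<psi>"
  proof (rule smooth_vec)
    fix k
    have "smooth (\<lambda>p::real \<times> (real^3). \<theta> (0 + fst p))"
      by (rule smooth_affine[OF bounded_linear_fst th_smooth])
    moreover have "smooth (\<lambda>p::real \<times> (real^3). ?w k (x + - snd p))"
      by (rule smooth_affine[OF bounded_linear_minus[OF bounded_linear_snd] ws])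
    ultimately show "smooth (\<lambda>p. \<psi> p $ k)"
      using smooth_mult by (fastforce simp: \<psi>_def)
  qed
  have test_psi: "test_fun ({t0 - 1<..<t0} \<times> UNIV) \<psi>"
  proof (rule test_funI[OF sm_psi, of "supp \<theta> \<times> cball x R"])
    show "compact (supp \<theta> \<times> cball x R)" using \<theta> by (intro compact_Times) (auto simp: test_fun_def)
    show "supp \<theta> \<times> cball x R \<subseteq> {t0 - 1<..<t0} \<times> UNIV" using \<theta> by (auto simp: test_fun_def)
    show "\<psi> p = 0" if "p \<notin> supp \<theta> \<times> cball x R" for p
    proof (cases "fst p \<in> supp \<theta>")
      case True
      then have "R < norm (x - snd p)" using that by (cases p) (auto simp: dist_norm)
      then show ?thesis using R by (simp add: \<psi>_def vec_eq_iff)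
    next
      case False
      then show ?thesis using not_supp[of "fst p" \<theta>] by (simp add: \<psi>_def)
    qed
  qed
  have psi_nth: "(\<lambda>y. \<psi> (t, y) $ k) = (\<lambda>y. \<theta> t * ?w k (x - y))" for t k by (simp add: \<psi>_def)
  have pd_psi: "pd j (\<lambda>y. \<psi> (t, y) $ k) = (\<lambda>y. - \<theta> t * pd j (?w k) (x - y))" for t j k
  proof
    fix y
    show "pd j (\<lambda>y. \<psi> (t, y) $ k) y = - \<theta> t * pd j (?w k) (x - y)"
      unfolding psi_nth using pd_mult[OF smooth_const[of "\<theta> t"] smooth_reflect[OF ws], where i=j and x=y]
      by (simp add: pd_reflect[OF ws])
  qed
  have pd2_psi: "pd j (pd j (\<lambda>y. \<psi> (t, y) $ k)) y = \<theta> t * pd j (pd j (?w k)) (x - y)" for t j k y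
    unfolding pd_psi
    using pd_mult[OF smooth_const[of "- \<theta> t"] smooth_reflect[OF smooth_pd[OF ws]], where i=j and x=y]
    by (simp add: pd_reflect[OF smooth_pd[OF ws]])
  have sm_psi_y: "smooth (\<lambda>y. \<psi> (t, y))" for t
    by (rule smooth_vec) (simp add: psi_nth smooth_mult smooth_const smooth_reflect ws)
  have pd_vec: "pd j (\<lambda>y. \<psi> (t, y)) y $ k = pd j (\<lambda>y. \<psi> (t, y) $ k) y" for j t y k
    by (rule pd_nth[symmetric, OF smooth_differentiable[OF sm_psi_y]])
  have lapl_psi: "lapl (\<lambda>y. \<psi> (t, y)) y $ k = (\<Sum>j\<in>UNIV. \<theta> t * pd j (pd j (?w k)) (x - y))" for t y k
    using pd_nth[OF smooth_differentiable[OF smooth_pd[OF sm_psi_y]], symmetric]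
    by (simp add: lapl_def pd_vec pd2_psi)
  have dt_psi: "vector_derivative (\<lambda>s. \<psi> (s, y)) (at t) = \<theta>' t *\<^sub>R (\<chi> k. ?w k (x - y))" for t y
    unfolding \<psi>_def fst_conv snd_conv
    by (rule vector_derivative_at)
      (use \<theta>'[of t] in \<open>auto intro!: has_vector_derivative_scaleR[where g'=0, simplified] derivative_eq_intros\<close>)
  have div_psi: "divg (\<lambda>y. \<psi> (t, y)) y = 0" for t y
    using rotker_div[OF test_fun_smooth[OF \<Phi>], of i "x - y"]
    by (simp add: divg_def pd_psi sum_negf flip: sum_distrib_left)
  have th_int: "integrable lborel \<theta>" by (rule test_fun_integrable[OF \<theta>])
  have th'_int: "integrable lborel \<theta>'"
  proof -
    have "frechet_derivative \<theta> (at t) 1 = \<theta>' t" for t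
      using fun_cong[OF frechet_derivative_at[OF \<theta>'[of t, unfolded has_field_derivative_def]], of 1] by simp
    moreover have "test_fun {t0 - 1<..<t0} (\<lambda>t. frechet_derivative \<theta> (at t) 1)"
      by (rule test_funI[where S="supp \<theta>"])
        (use \<theta> in \<open>auto simp: test_fun_def deriv_zero_off_supp intro: smooth_deriv\<close>)
    ultimately have "test_fun {t0 - 1<..<t0} \<theta>'" by simp
    then show ?thesis by (rule test_fun_integrable)
  qed
  note si1 = space_time_integral[OF dominated_component w th'_int, where x=x]
  note si2 = space_time_integral[OF dominated_component test_fun_pd[OF test_fun_pd[OF w]] th_int, where x=x]
  note si3 = space_time_integral[OF dominated_product test_fun_pd[OF w] th_int, where x=x]
  have "0 = (\<integral>(t, y). v t y \<bullet> vector_derivative (\<lambda>s. \<psi> (s, y)) (at t)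
          + (\<Sum>k\<in>UNIV. \<Sum>j\<in>UNIV. v t y $ k * v t y $ j * pd j (\<lambda>y. \<psi> (t, y) $ k) y)
          + v t y \<bullet> lapl (\<lambda>y. \<psi> (t, y)) y \<partial>lborel)"
    using weak_ns[OF test_psi div_psi] by simp
  also have "\<dots> = (\<integral>p. (\<Sum>k\<in>UNIV. (case p of (t, y) \<Rightarrow> \<theta>' t * (?w k (x - y) * v t y $ k)))
      + ((\<Sum>k\<in>UNIV. \<Sum>j\<in>UNIV. (case p of (t, y) \<Rightarrow> \<theta> t * (pd j (pd j (?w k)) (x - y) * v t y $ k)))
       - (\<Sum>k\<in>UNIV. \<Sum>j\<in>UNIV. (case p of (t, y) \<Rightarrow> \<theta> t * (pd j (?w k) (x - y) * (v t y $ k * v t y $ j))))) \<partial>lborel)"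
    by (rule Bochner_Integration.integral_cong[OF refl])
      (simp add: split_beta dt_psi pd_psi lapl_psi inner_vec_def sum_distrib_left sum_negf mult_ac)
  also have "\<dots> = (\<Sum>k\<in>UNIV. \<integral>t. \<theta>' t * conv (?w k) (\<lambda>y. v t y $ k) x \<partial>lborel)
      + ((\<Sum>k\<in>UNIV. \<Sum>j\<in>UNIV. \<integral>t. \<theta> t * conv (pd j (pd j (?w k))) (\<lambda>y. v t y $ k) x \<partial>lborel)
       - (\<Sum>k\<in>UNIV. \<Sum>j\<in>UNIV. \<integral>t. \<theta> t * conv (pd j (?w k)) (\<lambda>y. v t y $ k * v t y $ j) x \<partial>lborel))"
    using si1(1) si2(1) si3(1) si1(2) si2(2) si3(2)
    by (simp add: Bochner_Integration.integral_add Bochner_Integration.integral_diff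
        Bochner_Integration.integral_sum Bochner_Integration.integrable_sum)
  also have "\<dots> = (\<integral>t. \<theta>' t * vort \<Phi> t x i + \<theta> t * vort_rhs \<Phi> t x i \<partial>lborel)"
  proof -
    have mb: "integrable lborel (\<lambda>t. h t * f t x)" if h: "integrable lborel h" and f: "bounded_meas f" for h f
    proof -
      obtain C where C: "\<And>t x. \<bar>f t x\<bar> \<le> C" using f by (auto simp: bounded_meas_def)
      show ?thesis
      proof (rule Bochner_Integration.integrable_bound[OF integrable_mult_right[OF h, of C]])
        show "(\<lambda>t. h t * f t x) \<in> borel_measurable lborel"
          using h f borel_measurable_slice(2)[of f x] unfolding bounded_meas_def
          by (intro borel_measurable_times) auto
        show "AE t in lborel. norm (h t * f t x) \<le> norm (C * h t)"
          using C by (intro AE_I2) (auto simp: abs_mult mult.commute[of "\<bar>h _\<bar>"] intro!: mult_right_mono intro: order_trans[OF _ abs_ge_self])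
      qed
    qed
    note m1 = mb[OF th'_int bounded_meas_conv[OF dominated_component w]]
    note m2 = mb[OF th_int bounded_meas_conv[OF dominated_component test_fun_pd[OF test_fun_pd[OF w]]]]
    note m3 = mb[OF th_int bounded_meas_conv[OF dominated_product test_fun_pd[OF w]]]
    show ?thesis
      unfolding vort_def vort_rhs_def right_diff_distrib sum_distrib_left
      using m1 m2 m3
      by (simp add: Bochner_Integration.integral_add Bochner_Integration.integral_diff
        Bochner_Integration.integral_sum Bochner_Integration.integrable_sum)
  qed
  finally show ?thesis by simp
qed

end

section \<open>The filtered fields and their vorticity equation\<close>

locale filtered_flow = flow +
  fixes \<phi> :: "real^3 \<Rightarrow> real" and l :: real
  assumes kernel: "filter_kernel \<phi>" and scaled_test: "test_fun UNIV (scaled \<phi> l)"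
begin

abbreviation "\<Phi> \<equiv> scaled \<phi> l"
abbreviation "U \<equiv> Ufil \<phi> l v"
abbreviation "Om \<equiv> Omfil \<phi> l v"
abbreviation "R \<equiv> Rfil \<phi> l v"
abbreviation "V t \<equiv> div_mat (R t)"

lemma loc_int_component: "loc_int (\<lambda>y. v t y $ k)"
  by (rule loc_int_dominated[OF dominated_component])

lemma loc_int_product: "loc_int (\<lambda>y. v t y $ i * v t y $ k)"
  by (rule loc_int_dominated[OF dominated_product])

lemma U_nth: "(\<lambda>y. U t y $ k) = conv \<Phi> (\<lambda>y. v t y $ k)"
  by (rule ext) (rule Ufil_nth[OF scaled_test])

lemma smooth_U: "smooth (\<lambda>y. U t y $ k)"
  unfolding U_nth by (rule smooth_conv[OF scaled_test loc_int_component])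

lemma pd_U: "pd j (\<lambda>y. U t y $ k) = conv (pd j \<Phi>) (\<lambda>y. v t y $ k)"
  unfolding U_nth by (rule pd_conv[OF scaled_test loc_int_component])

lemma bounded_meas_U: "bounded_meas (\<lambda>t x. U t x $ k)"
  unfolding fun_cong[OF U_nth] by (rule bounded_meas_conv[OF dominated_component scaled_test])

lemma bounded_meas_pd_U: "bounded_meas (\<lambda>t. pd j (\<lambda>y. U t y $ k))"
  unfolding pd_U by (rule bounded_meas_conv[OF dominated_component test_fun_pd[OF scaled_test]])

text \<open>Filtering upgrades weak incompressibility to a pointwise one: the kernel reflected about
  \<open>x\<close> is the test function.\<close>

lemma divg_U: "divg (U t) x = 0"
proof -
  have g: "grad (\<lambda>y. \<Phi> (x - y)) y = - (\<chi> j. pd j \<Phi> (x - y))" for y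
    by (simp add: grad_def vec_eq_iff pd_reflect[OF test_fun_smooth[OF scaled_test]])
  have "divg (U t) x = (\<Sum>k\<in>UNIV. \<integral>y. pd k \<Phi> (x - y) * v t y $ k \<partial>lborel)"
    by (simp add: divg_def pd_U conv_real)
  also have "\<dots> = (\<integral>y. (\<Sum>k\<in>UNIV. pd k \<Phi> (x - y) * v t y $ k) \<partial>lborel)"
    by (rule Bochner_Integration.integral_sum[symmetric])
      (rule conv_integrable[OF test_fun_pd[OF scaled_test] loc_int_component])
  also have "\<dots> = - (\<integral>y. v t y \<bullet> grad (\<lambda>y. \<Phi> (x - y)) y \<partial>lborel)"
    by (simp add: g inner_vec_def sum_negf mult.commute)
  also have "\<dots> = 0"
    using div_free[of t] test_fun_reflect[OF scaled_test, of x] by (simp add: weakly_div_free_def)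
  finally show ?thesis .
qed

lemma Om_nth: "Om t x $ i = vort \<Phi> t x i"
proof -
  have neg: "conv (\<lambda>z. - K z) a x = - conv K a x" for K and a :: "real^3 \<Rightarrow> real"
    by (simp add: conv_real)
  have zero: "conv (\<lambda>z. 0) a x = 0" for a :: "real^3 \<Rightarrow> real"
    by (simp add: conv_real)
  have "i = 1 \<or> i = 2 \<or> i = 3" by (rule exhaust_3)
  then show ?thesis
    by (elim disjE) (simp_all add: Omfil_def curl_nth pd_U vort_def sum_3 rotker_simps neg zero)
qed

lemma smooth_Om: "smooth (\<lambda>y. Om t y $ i)"
  unfolding Omfil_def by (rule smooth_curl[OF smooth_U])

lemma bounded_meas_Om: "bounded_meas (\<lambda>t x. Om t x $ i)"
  unfolding Om_nth by (rule bounded_meas_vort[OF scaled_test])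

lemma pd_Om: "pd j (\<lambda>y. Om t y $ i) x = (\<Sum>k\<in>UNIV. conv (pd j (rotker \<Phi> i k)) (\<lambda>y. v t y $ k) x)"
  unfolding Om_nth vort_def
  by (subst pd_sum)
    (simp_all add: smooth_conv test_fun_rotker scaled_test loc_int_component pd_conv)

lemma bounded_meas_pd_Om: "bounded_meas (\<lambda>t. pd j (\<lambda>y. Om t y $ i))"
  unfolding pd_Om[abs_def]
  by (intro bounded_meas_sum bounded_meas_conv dominated_component test_fun_pd test_fun_rotker scaled_test)

lemma lapl_Om: "lapl (\<lambda>y. Om t y $ i) x
    = (\<Sum>k\<in>UNIV. \<Sum>j\<in>UNIV. conv (pd j (pd j (rotker \<Phi> i k))) (\<lambda>y. v t y $ k) x)"
proof -
  have "pd j (pd j (\<lambda>y. Om t y $ i)) x = (\<Sum>k\<in>UNIV. conv (pd j (pd j (rotker \<Phi> i k))) (\<lambda>y. v t y $ k) x)" for j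
    unfolding pd_Om[abs_def]
    by (subst pd_sum)
      (simp_all add: smooth_conv test_fun_rotker test_fun_pd scaled_test loc_int_component pd_conv)
  then show ?thesis unfolding lapl_def by (simp only:) (rule sum.swap)
qed

lemma R_nth: "(\<lambda>y. R t y $ i $ k) = (\<lambda>y. conv \<Phi> (\<lambda>y. v t y $ i * v t y $ k) y - U t y $ i * U t y $ k)"
  by (rule ext) (rule Rfil_nth[OF scaled_test])

lemma smooth_R: "smooth (\<lambda>y. R t y $ i $ k)"
  unfolding R_nth by (intro smooth_diff smooth_mult smooth_U smooth_conv scaled_test loc_int_product)

lemma V_nth: "V t x $ i = (\<Sum>j\<in>UNIV. conv (pd j \<Phi>) (\<lambda>y. v t y $ i * v t y $ j) x
    - (pd j (\<lambda>y. U t y $ i) x * U t x $ j + U t x $ i * pd j (\<lambda>y. U t y $ j) x))"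
  unfolding div_mat_def R_nth
  by (simp add: pd_diff smooth_mult smooth_U smooth_conv scaled_test loc_int_product pd_mult pd_conv)

lemma smooth_V: "smooth (\<lambda>y. V t y $ i)"
  unfolding div_mat_def by (simp add: smooth_sum smooth_pd smooth_R)

lemma bounded_meas_V: "bounded_meas (\<lambda>t x. V t x $ i)"
  unfolding V_nth
  by (intro bounded_meas_intros bounded_meas_U bounded_meas_pd_U bounded_meas_conv dominated_product
      test_fun_pd scaled_test)

text \<open>\<open>S\<close> is the divergence of the filtered tensor product of \<open>v\<close>
  with itself, that is, \<open>V\<close> plus the divergence of U tensor U. Computed on the kernel,
  its curl is the quadratic part of \<open>vort_rhs\<close>; computed by
  \<open>curl_convection\<close>, it is subfilter force, transport and stretching.\<close>

lemma vort_rhs_eq: "vort_rhs \<Phi> t x i = lapl (\<lambda>y. Om t y $ i) x - (curl (V t) x $ i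
    + (\<Sum>j\<in>UNIV. U t x $ j * pd j (\<lambda>y. Om t y $ i) x - Om t x $ j * pd j (\<lambda>y. U t y $ i) x))"
proof -
  define S where "S y = (\<chi> k. \<Sum>m\<in>UNIV. conv (pd m \<Phi>) (\<lambda>y. v t y $ k * v t y $ m) y)" for y
  have S: "S y $ k = V t y $ k + (\<Sum>m\<in>UNIV. pd m (\<lambda>y. U t y $ k * U t y $ m) y)" for y k
    by (simp add: S_def V_nth pd_mult smooth_U sum_subtractf)
  have conv_S: "pd j (\<lambda>y. S y $ k) x = (\<Sum>m\<in>UNIV. conv (pd m (pd j \<Phi>)) (\<lambda>y. v t y $ k * v t y $ m) x)" for j k
  proof -
    have "pd j (pd m \<Phi>) = pd m (pd j \<Phi>)" for m
      by (rule ext) (rule pd_commute[OF test_fun_smooth[OF scaled_test]])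
    then show ?thesis
      unfolding S_def
      by (simp, subst pd_sum) (simp_all add: smooth_conv test_fun_pd scaled_test loc_int_product pd_conv)
  qed
  have neg: "conv (pd j (\<lambda>z. - pd m \<Phi> z)) a x = - conv (pd j (pd m \<Phi>)) a x" for j m and a :: "real^3 \<Rightarrow> real"
    by (simp add: conv_real pd_minus smooth_pd test_fun_smooth[OF scaled_test])
  have zero: "conv (pd j (\<lambda>z. 0)) a x = 0" for j and a :: "real^3 \<Rightarrow> real"
    by (simp add: conv_real)
  have "i = 1 \<or> i = 2 \<or> i = 3" by (rule exhaust_3)
  then have "curl S x $ i = (\<Sum>k\<in>UNIV. \<Sum>j\<in>UNIV. conv (pd j (rotker \<Phi> i k)) (\<lambda>y. v t y $ k * v t y $ j) x)"
    by (elim disjE) (simp_all add: curl_nth conv_S rotker_simps sum_3 neg zero)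
  moreover have "curl S x $ i = curl (V t) x $ i
      + (\<Sum>j\<in>UNIV. U t x $ j * pd j (\<lambda>y. Om t y $ i) x - Om t x $ j * pd j (\<lambda>y. U t y $ i) x)"
    unfolding Omfil_def by (rule curl_convection[OF smooth_U smooth_V divg_U S])
  ultimately show ?thesis by (simp add: vort_rhs_def lapl_Om)
qed

text \<open>At a fixed \<open>x\<close> each component of \<open>Om\<close> is the pairing of
  \<open>v t\<close> with a fixed square-integrable field, so weak continuity makes it continuous in
  time. Combined with the weak identity this gives the increment between any two interior times, not
  just almost all.\<close>

lemma vorticity_equation:
  assumes ab: "t0 - 1 < a" "a \<le> b" "b < t0"
  shows "((\<lambda>t. vort_rhs \<Phi> t x i) has_integral (Om b x $ i - Om a x $ i)) {a..b}"
proof -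
  have bm: "bounded_meas (\<lambda>t x. vort \<Phi> t x i)" "bounded_meas (\<lambda>t x. vort_rhs \<Phi> t x i)"
    by (rule bounded_meas_vort[OF scaled_test], rule bounded_meas_vort_rhs[OF scaled_test])
  obtain C where C: "\<And>t x. \<bar>vort \<Phi> t x i\<bar> \<le> C" using bm(1) by (auto simp: bounded_meas_def)
  obtain D where D: "\<And>t x. \<bar>vort_rhs \<Phi> t x i\<bar> \<le> D" using bm(2) by (auto simp: bounded_meas_def)
  let ?w = "\<lambda>y. (\<chi> k. rotker \<Phi> i k (x - y))"
  have w: "test_fun UNIV (\<lambda>y. rotker \<Phi> i k (x - y))" for k
    by (rule test_fun_reflect[OF test_fun_rotker[OF scaled_test]])
  have "smooth ?w" by (rule smooth_vec) (simp add: test_fun_smooth[OF w])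
  moreover have "integrable lborel (\<lambda>y. (norm (?w y))\<^sup>2)"
    unfolding power2_norm_eq_inner inner_vec_def
    by (simp add: test_fun_integrable[OF test_fun_mult[OF w test_fun_smooth[OF w]]])
  ultimately have "square_integrable ?w"
    unfolding square_integrable_def using smooth_measurable by blast
  from weak_cont[OF this] have "continuous_on {t0 - 1..t0} (\<lambda>t. \<integral>y. v t y \<bullet> ?w y \<partial>lborel)" .
  moreover have "(\<integral>y. v t y \<bullet> ?w y \<partial>lborel) = vort \<Phi> t x i" for t
    unfolding vort_def conv_real inner_vec_def
    using conv_integrable[OF test_fun_rotker[OF scaled_test] loc_int_component, of i _ x t]
    by (subst Bochner_Integration.integral_sum[symmetric])
      (simp_all add: mult.commute[of "v t _ $ _"])
  ultimately have cont: "continuous_on {t0 - 1..t0} (\<lambda>t. vort \<Phi> t x i)" by simp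
  have "((\<lambda>t. vort_rhs \<Phi> t x i) has_integral (vort \<Phi> b x i - vort \<Phi> a x i)) {a..b}"
  proof (rule weak_derivative_integral[OF kernel ab cont])
    show "(\<lambda>t. vort \<Phi> t x i) \<in> borel_measurable borel" "(\<lambda>t. vort_rhs \<Phi> t x i) \<in> borel_measurable borel"
      using bm borel_measurable_slice(2) unfolding bounded_meas_def by blast+
    show "\<bar>vort \<Phi> t x i\<bar> \<le> max C D" "\<bar>vort_rhs \<Phi> t x i\<bar> \<le> max C D" for t
      using C[of t x] D[of t x] by linarith+
  qed (rule vorticity_weak[OF scaled_test])
  then show ?thesis by (simp add: Om_nth)
qed

end

section \<open>Enstrophy balance\<close>

lemma set_integrable_continuous_bounded:
  fixes g h :: "'a::euclidean_space \<Rightarrow> real"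
  assumes S: "compact S" and g: "continuous_on UNIV g"
    and h: "h \<in> borel_measurable borel" "\<And>z. \<bar>h z\<bar> \<le> C"
  shows "set_integrable lborel S (\<lambda>z. g z * h z)"
proof -
  have gS: "integrable lborel (\<lambda>z. indicator S z *\<^sub>R g z)"
    by (rule borel_integrable_compact[OF S continuous_on_subset[OF g]]) simp
  have gm: "g \<in> borel_measurable borel" by (rule borel_measurable_continuous_onI[OF g])
  show ?thesis unfolding set_integrable_def
  proof (rule Bochner_Integration.integrable_bound[OF integrable_mult_right[OF gS, of C]])
    show "(\<lambda>z. indicator S z *\<^sub>R (g z * h z)) \<in> borel_measurable lborel"
      using gm h(1) borel_compact[OF S] by simp
    show "AE z in lborel. norm (indicator S z *\<^sub>R (g z * h z)) \<le> norm (C * (indicator S z *\<^sub>R g z))"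
    proof (rule AE_I2)
      fix z
      have "\<bar>g z\<bar> * \<bar>h z\<bar> \<le> \<bar>C\<bar> * \<bar>g z\<bar>"
        using h(2)[of z] by (subst mult.commute) (intro mult_right_mono, auto)
      then show "norm (indicator S z *\<^sub>R (g z * h z)) \<le> norm (C * (indicator S z *\<^sub>R g z))"
        by (simp add: indicator_def abs_mult)
    qed
  qed
qed

lemma bounded_meas_joint: "bounded_meas f \<Longrightarrow> (\<lambda>p. f (fst p) (snd p)) \<in> borel_measurable borel"
  unfolding bounded_meas_def split_beta by blast

lemma bounded_meas_slice:
  assumes "bounded_meas f"
  shows "f t \<in> borel_measurable borel" "(\<lambda>t. f t x) \<in> borel_measurable borel"
  using assms borel_measurable_slice unfolding bounded_meas_def by blast+

lemma bounded_meas_bound: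
  assumes "bounded_meas f" shows "\<exists>C. \<forall>t x. \<bar>f t x\<bar> \<le> C"
  using assms unfolding bounded_meas_def by (rule conjunct2)

lemma set_integrable_sum:
  fixes f :: "'i \<Rightarrow> 'a \<Rightarrow> real"
  assumes "\<And>i. i \<in> A \<Longrightarrow> set_integrable M S (f i)"
  shows "set_integrable M S (\<lambda>x. \<Sum>i\<in>A. f i x)"
  using assms unfolding set_integrable_def scaleR_sum_right
  by (rule Bochner_Integration.integrable_sum)

text \<open>Partial derivatives of a jointly smooth function are taken from its full derivative:
  this keeps them continuous in time and space together, which derivatives of separate slices would
  not show.\<close>

definition sdx :: "'n::finite \<Rightarrow> (real \<times> (real^'n) \<Rightarrow> real) \<Rightarrow> real \<times> (real^'n) \<Rightarrow> real" where
  "sdx i H p = frechet_derivative H (at p) (0, axis i 1)"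

definition sdt :: "(real \<times> (real^'n::finite) \<Rightarrow> real) \<Rightarrow> real \<times> (real^'n) \<Rightarrow> real" where
  "sdt H p = frechet_derivative H (at p) (1, 0)"

lemma smooth_sdx: "smooth H \<Longrightarrow> smooth (sdx i H)"
  unfolding sdx_def[abs_def] by (rule smooth_deriv) (auto simp: Basis_prod_def)

lemma smooth_sdt: "smooth H \<Longrightarrow> smooth (sdt H)"
  unfolding sdt_def[abs_def] by (rule smooth_deriv) (auto simp: Basis_prod_def)

lemma smooth_space_slice:
  fixes H :: "real \<times> (real^'n::finite) \<Rightarrow> real"
  assumes "smooth H" shows "smooth (\<lambda>x. H (t, x))"
  using smooth_affine[OF bounded_linear_Pair[OF bounded_linear_zero bounded_linear_ident] assms, of "(t, 0)"] by simp

lemma pd_space_slice: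
  assumes "smooth H" shows "pd i (\<lambda>x. H (t, x)) = (\<lambda>x. sdx i H (t, x))"
proof
  fix x
  have "pd i (\<lambda>x. H ((t, 0) + (0, x))) x = frechet_derivative H (at ((t, 0) + (0, x))) (0, axis i 1)"
    unfolding pd_def
    by (subst frechet_derivative_affine[OF bounded_linear_Pair[OF bounded_linear_zero bounded_linear_ident] smooth_differentiable[OF assms]]) simp
  then show "pd i (\<lambda>x. H (t, x)) x = sdx i H (t, x)" by (simp add: sdx_def)
qed

lemma has_derivative_time_slice:
  assumes "smooth H" shows "((\<lambda>t. H (t, x)) has_real_derivative sdt H (t, x)) (at t)"
proof -
  have lin: "linear (frechet_derivative H (at p))" for p
    using smooth_has_derivative[OF assms] by (intro bounded_linear.linear has_derivative_bounded_linear)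
  have "((\<lambda>t. H (t, x)) has_derivative (\<lambda>h. frechet_derivative H (at (t, x)) (h, 0))) (at t)"
    by (rule has_derivative_compose[where g=H and f="\<lambda>t. (t, x)", OF _ smooth_has_derivative[OF assms]])
      (auto intro!: derivative_eq_intros)
  moreover have "frechet_derivative H (at (t, x)) (h, 0) = sdt H (t, x) * h" for h
    using linear_scale[OF lin, of "(t, x)" h "(1, 0)"] by (simp add: sdt_def)
  ultimately show ?thesis by (simp add: has_field_derivative_def)
qed

lemma grad_sq_eq:
  assumes "\<And>i. smooth (\<lambda>y. W y $ i)"
  shows "grad_sq W x = (\<Sum>i\<in>UNIV. \<Sum>j\<in>UNIV. (pd j (\<lambda>y. W y $ i) x)\<^sup>2)"
proof -
  have "pd j W x $ i = pd j (\<lambda>y. W y $ i) x" for i j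
    by (rule pd_nth[symmetric, OF smooth_differentiable[OF smooth_vec[OF assms]]])
  then have "grad_sq W x = (\<Sum>j\<in>UNIV. \<Sum>i\<in>UNIV. (pd j (\<lambda>y. W y $ i) x)\<^sup>2)"
    unfolding grad_sq_def power2_norm_eq_inner inner_vec_def by (simp add: power2_eq_square)
  then show ?thesis by (simp only:) (rule sum.swap)
qed

lemma norm_sq_vec: "(norm (a :: real^'n::finite))\<^sup>2 = (\<Sum>i\<in>UNIV. a $ i * a $ i)"
  unfolding power2_norm_eq_inner inner_vec_def by simp

text \<open>\<open>G\<close> is smooth on the whole of space-time but constrained only on the slab.
  Its values at other times are arbitrary, so every vanishing statement is confined to
  \<open>t\<close> between \<open>s0\<close> and \<open>s1\<close>.\<close>

locale cutoff_flow = filtered_flow +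
  fixes G :: "real \<times> (real^3) \<Rightarrow> real" and s0 s1 :: real and C :: "(real^3) set"
  assumes G_smooth: "smooth G" and s0: "t0 - 1 < s0" and s01: "s0 < s1" and s1: "s1 < t0"
    and C_compact: "compact C" and G_zero: "t \<in> {s0..s1} \<Longrightarrow> x \<notin> C \<Longrightarrow> G (t, x) = 0"
begin

abbreviation "X t x \<equiv> G (t, x)"
abbreviation "S \<equiv> {s0..s1} \<times> C"

text \<open>The time derivative of the square of \<open>norm (Om t x)\<close>, in the integrated
  sense of \<open>norm_Om_has_integral\<close>.\<close>

definition rate :: "real \<Rightarrow> real^3 \<Rightarrow> real" where
  "rate t x = (\<Sum>i\<in>UNIV. 2 * (Om t x $ i * vort_rhs \<Phi> t x i))"

definition stretch :: "real \<Rightarrow> real^3 \<Rightarrow> real" where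
  "stretch t x = (\<Sum>i\<in>UNIV. \<Sum>j\<in>UNIV. Om t x $ i * Om t x $ j * pd j (\<lambda>y. U t y $ i) x)"

lemma bounded_meas_norm_Om: "bounded_meas (\<lambda>t x. (norm (Om t x))\<^sup>2)"
  unfolding norm_sq_vec by (intro bounded_meas_intros bounded_meas_Om)

lemma bounded_meas_norm_V: "bounded_meas (\<lambda>t x. (norm (V t x))\<^sup>2)"
  unfolding norm_sq_vec by (intro bounded_meas_intros bounded_meas_V)

lemma bounded_meas_rate: "bounded_meas rate"
  unfolding rate_def[abs_def]
  by (intro bounded_meas_intros bounded_meas_Om bounded_meas_vort_rhs scaled_test)

lemma bounded_meas_stretch: "bounded_meas stretch"
  unfolding stretch_def[abs_def]
  by (intro bounded_meas_intros bounded_meas_Om bounded_meas_pd_U)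

lemma bounded_meas_grad_sq: "bounded_meas (\<lambda>t. grad_sq (Om t))"
  unfolding grad_sq_eq[OF smooth_Om, abs_def] power2_eq_square
  by (intro bounded_meas_intros bounded_meas_pd_Om)

lemma bounded_meas_curl: "bounded_meas (\<lambda>t x. curl (Om t) x $ i)"
proof -
  have "i = 1 \<or> i = 2 \<or> i = 3" by (rule exhaust_3)
  then show ?thesis
    by (elim disjE; simp only: curl_nth) (intro bounded_meas_diff bounded_meas_pd_Om)+
qed

lemma bounded_meas_curl_V: "bounded_meas (\<lambda>t x. curl (Om t) x \<bullet> V t x)"
  unfolding inner_vec_def inner_real_def by (intro bounded_meas_intros bounded_meas_V bounded_meas_curl)

lemma bounded_meas_cross: "bounded_meas (\<lambda>t x. cross3 (Om t x) (V t x) $ i)"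
proof -
  have "i = 1 \<or> i = 2 \<or> i = 3" by (rule exhaust_3)
  then show ?thesis
    by (elim disjE; simp add: cross3_def; intro bounded_meas_intros bounded_meas_V bounded_meas_Om)
qed

lemma set_integrable_S:
  assumes "continuous_on UNIV g" "bounded_meas f"
  shows "set_integrable lborel S (\<lambda>p. g p * f (fst p) (snd p))"
proof -
  obtain B where B: "\<And>t x. \<bar>f t x\<bar> \<le> B" using bounded_meas_bound[OF assms(2)] by blast
  show ?thesis
    by (rule set_integrable_continuous_bounded[OF compact_Times[OF compact_Icc C_compact] assms(1) bounded_meas_joint[OF assms(2)] B])
qed

lemma X_deriv_zero:
  assumes "t \<in> {s0..s1}" "x \<notin> C"
  shows "pd i (X t) x = 0" "grad (X t) x = 0" "lapl (X t) x = 0" "sdt G (t, x) = 0"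
proof -
  have sub: "supp (X t) \<subseteq> C" using assms(1) by (intro supp_subset_closed compact_imp_closed[OF C_compact] G_zero)
  then have z: "pd j (X t) y = 0" if "y \<notin> C" for j y
    using that unfolding pd_def by (intro deriv_zero_off_supp) auto
  then show "pd i (X t) x = 0" "grad (X t) x = 0" using assms(2) by (auto simp: grad_def vec_eq_iff)
  have "pd j (pd j (X t)) x = 0" for j
  proof -
    have "supp (pd j (X t)) \<subseteq> C" by (intro supp_subset_closed compact_imp_closed[OF C_compact] z)
    then show ?thesis using assms(2) unfolding pd_def[of j "pd j (X t)"] by (intro deriv_zero_off_supp) auto
  qed
  then show "lapl (X t) x = 0" by (simp add: lapl_def)
  \<comment> \<open>At the ends of the slab only one side is known. Derivatives within a
    nondegenerate interval are unique, so the full time derivative of \<open>G\<close> equals the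
    one-sided one, which is zero.\<close>
  have "((\<lambda>t. G (t, x)) has_vector_derivative sdt G (t, x)) (at t within {s0..s1})"
    using has_derivative_time_slice[OF G_smooth, of x t]
    by (simp add: has_real_derivative_iff_has_vector_derivative has_vector_derivative_at_within)
  moreover have "((\<lambda>t. G (t, x)) has_vector_derivative 0) (at t within {s0..s1})"
    by (rule has_vector_derivative_transform[where f="\<lambda>t. 0"]) (use assms G_zero in auto)
  ultimately show "sdt G (t, x) = 0"
    using vector_derivative_unique_within_closed_interval[of s0 s1 t] s01 assms(1) by (auto simp: cbox_interval)
qed

lemma integrable_on_slice:
  assumes g: "continuous_on UNIV g" and f: "bounded_meas f"
  shows "set_integrable lborel {a..b} (\<lambda>t. g t * f t x)" "(\<lambda>t. g t * f t x) integrable_on {a..b}"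
proof -
  obtain B where B: "\<And>t x. \<bar>f t x\<bar> \<le> B" using bounded_meas_bound[OF f] by blast
  show 1: "set_integrable lborel {a..b} (\<lambda>t. g t * f t x)"
    by (rule set_integrable_continuous_bounded[OF compact_Icc g bounded_meas_slice(2)[OF f] B])
  show "(\<lambda>t. g t * f t x) integrable_on {a..b}"
    by (rule set_borel_integral_eq_integral(1)[OF 1])
qed

text \<open>The product rule for primitives, applied with both factors equal to the same component
  of \<open>Om\<close>.\<close>

lemma norm_Om_has_integral:
  assumes ab: "t0 - 1 < a" "a \<le> b" "b < t0"
  shows "((\<lambda>t. rate t x) has_integral ((norm (Om b x))\<^sup>2 - (norm (Om a x))\<^sup>2)) {a..b}"
proof -
  have "((\<lambda>t. 2 * (Om t x $ i * vort_rhs \<Phi> t x i)) has_integral (Om b x $ i * Om b x $ i - Om a x $ i * Om a x $ i)) {a..b}" for i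
  proof -
    obtain B where B: "\<And>t x. \<bar>vort_rhs \<Phi> t x i\<bar> \<le> B"
      using bounded_meas_bound[OF bounded_meas_vort_rhs[OF scaled_test]] by blast
    have B0: "0 \<le> B" using B[of 0 0] by linarith
    have bm: "bounded_meas (\<lambda>t x. vort_rhs \<Phi> t x i * Om t x $ i + Om t x $ i * vort_rhs \<Phi> t x i)"
      by (intro bounded_meas_intros bounded_meas_Om bounded_meas_vort_rhs scaled_test)
    have int: "(\<lambda>t. vort_rhs \<Phi> t x i * Om t x $ i + Om t x $ i * vort_rhs \<Phi> t x i) integrable_on {a..b}"
      using integrable_on_slice(2)[OF continuous_on_const[of _ 1] bm, of x a b] by simp
    have val: "integral {a..b} (\<lambda>t. vort_rhs \<Phi> t x i * Om t x $ i + Om t x $ i * vort_rhs \<Phi> t x i)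
        = Om b x $ i * Om b x $ i - Om a x $ i * Om a x $ i"
    proof (rule product_rule_primitives[OF ab(2) B0 _ _ B B int])
      show "((\<lambda>t. vort_rhs \<Phi> t x i) has_integral Om d x $ i - Om c x $ i) {c..d}"
        if "a \<le> c" "c \<le> d" "d \<le> b" for c d
        using that ab by (intro vorticity_equation) auto
      then show "((\<lambda>t. vort_rhs \<Phi> t x i) has_integral Om d x $ i - Om c x $ i) {c..d}"
        if "a \<le> c" "c \<le> d" "d \<le> b" for c d using that .
    qed
    have "(\<lambda>t. vort_rhs \<Phi> t x i * Om t x $ i + Om t x $ i * vort_rhs \<Phi> t x i)
        = (\<lambda>t. 2 * (Om t x $ i * vort_rhs \<Phi> t x i))"
      by (rule ext) simp
    then show ?thesis using integrable_integral[OF int, unfolded val] by (simp only:)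
  qed
  then have "((\<lambda>t. \<Sum>i\<in>UNIV. 2 * (Om t x $ i * vort_rhs \<Phi> t x i)) has_integral
      (\<Sum>i\<in>UNIV. Om b x $ i * Om b x $ i - Om a x $ i * Om a x $ i)) {a..b}"
    by (intro has_integral_sum) auto
  then show ?thesis unfolding rate_def norm_sq_vec by (simp add: sum_subtractf)
qed

text \<open>The product rule for primitives at a fixed \<open>x\<close>: the cutoff is a primitive
  of its time derivative by the fundamental theorem, the squared vorticity one of
  \<open>rate\<close>. The bound \<open>B1\<close> may depend on \<open>x\<close>.\<close>

lemma cutoff_enstrophy_increment:
  "X s1 x * (norm (Om s1 x))\<^sup>2 - X s0 x * (norm (Om s0 x))\<^sup>2
   = (LINT t:{s0..s1}|lborel. sdt G (t, x) * (norm (Om t x))\<^sup>2 + X t x * rate t x)"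
proof -
  have cont: "continuous_on UNIV (\<lambda>t. H (t, x))" if "smooth H" for H :: "real \<times> (real^3) \<Rightarrow> real"
    by (rule continuous_on_compose2[OF smooth_continuous[OF that, of UNIV]]) (auto intro: continuous_intros)
  note cG = cont[OF G_smooth] and cdG = cont[OF smooth_sdt[OF G_smooth]]
  have si: "set_integrable lborel {s0..s1} (\<lambda>t. sdt G (t, x) * (norm (Om t x))\<^sup>2 + X t x * rate t x)"
    by (intro set_integral_add(1) integrable_on_slice(1) cG cdG bounded_meas_norm_Om bounded_meas_rate)
  have "bounded ((\<lambda>t. sdt G (t, x)) ` {s0..s1})"
    by (intro compact_imp_bounded compact_continuous_image continuous_on_subset[OF cdG]) auto
  then obtain B1 where "\<forall>z\<in>(\<lambda>t. sdt G (t, x)) ` {s0..s1}. norm z \<le> B1" unfolding bounded_iff by blast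
  then have B1: "\<bar>sdt G (t, x)\<bar> \<le> B1" if "t \<in> {s0..s1}" for t using that by simp
  obtain B2 where B2: "\<And>t x. \<bar>rate t x\<bar> \<le> B2" using bounded_meas_bound[OF bounded_meas_rate] by blast
  have "integral {s0..s1} (\<lambda>t. sdt G (t, x) * (norm (Om t x))\<^sup>2 + X t x * rate t x)
      = X s1 x * (norm (Om s1 x))\<^sup>2 - X s0 x * (norm (Om s0 x))\<^sup>2"
  proof (rule product_rule_primitives[where B="max B1 B2"])
    show "s0 \<le> s1" using s01 by simp
    show "0 \<le> max B1 B2" using B2[of 0 0] by linarith
    show "((\<lambda>t. sdt G (t, x)) has_integral X b x - X a x) {a..b}" if "s0 \<le> a" "a \<le> b" "b \<le> s1" for a b
      using has_derivative_time_slice[OF G_smooth]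
      by (intro fundamental_theorem_of_calculus that)
        (auto simp: has_real_derivative_iff_has_vector_derivative intro: has_vector_derivative_at_within)
    show "((\<lambda>t. rate t x) has_integral (norm (Om b x))\<^sup>2 - (norm (Om a x))\<^sup>2) {a..b}"
      if "s0 \<le> a" "a \<le> b" "b \<le> s1" for a b
      using that s0 s1 by (intro norm_Om_has_integral) auto
    show "\<bar>sdt G (t, x)\<bar> \<le> max B1 B2" if "t \<in> {s0..s1}" for t using B1[OF that] by linarith
    show "\<bar>rate t x\<bar> \<le> max B1 B2" for t using B2[of t x] by linarith
  qed (rule set_borel_integral_eq_integral(1)[OF si])
  then show ?thesis using set_borel_integral_eq_integral(2)[OF si] by simp
qed

text \<open>The divergence term of the pointwise identity drops out because \<open>T\<close> has compact support in \<open>x\<close>.\<close>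

lemma slice_identity:
  assumes t: "t \<in> {s0..s1}"
  shows "(LINT x:C|lborel. X t x * rate t x / 2)
    = (LINT x:C|lborel. - (X t x * grad_sq (Om t) x)
      + 1 / 2 * (norm (Om t x))\<^sup>2 * (lapl (X t) x + U t x \<bullet> grad (X t) x)
      + X t x * stretch t x
      - (X t x * (curl (Om t) x \<bullet> V t x) + grad (X t) x \<bullet> cross3 (Om t x) (V t x)))"
proof -
  define T where "T j y = (\<Sum>i\<in>UNIV. X t y * (Om t y $ i * pd j (\<lambda>y. Om t y $ i) y))
      - 1 / 2 * (pd j (X t) y * (\<Sum>i\<in>UNIV. Om t y $ i * Om t y $ i))
      - 1 / 2 * (X t y * (U t y $ j * (\<Sum>i\<in>UNIV. Om t y $ i * Om t y $ i))) + X t y * (cross3 (Om t y) (V t y) $ j)" for j y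
  have Xs: "smooth (X t)" by (rule smooth_space_slice[OF G_smooth])
  note sm = smooth_sum smooth_mult smooth_diff smooth_add smooth_const smooth_pd Xs smooth_Om smooth_U smooth_V
  have cross_s: "smooth (\<lambda>y. cross3 (Om t y) (V t y) $ j)" for j
  proof -
    have "j = 1 \<or> j = 2 \<or> j = 3" by (rule exhaust_3)
    then show ?thesis
      by (elim disjE; simp add: cross3_def; intro smooth_diff smooth_mult smooth_Om smooth_V)
  qed
  have T_test: "test_fun UNIV (T j)" for j
  proof (rule test_funI[of _ C])
    show "smooth (T j)" unfolding T_def[abs_def] by (intro sm cross_s)
    show "T j x = 0" if "x \<notin> C" for x
      using G_zero[OF t that] X_deriv_zero(1)[OF t that] by (simp add: T_def)
  qed (use C_compact in auto)
  have rate2: "X t x * rate t x / 2 = (\<Sum>i\<in>UNIV. X t x * (Om t x $ i * vort_rhs \<Phi> t x i))" for x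
    by (simp add: rate_def sum_distrib_left sum_divide_distrib)
  let ?r = "\<lambda>x. - (X t x * grad_sq (Om t) x)
      + 1 / 2 * (norm (Om t x))\<^sup>2 * (lapl (X t) x + U t x \<bullet> grad (X t) x)
      + X t x * stretch t x
      - (X t x * (curl (Om t) x \<bullet> V t x) + grad (X t) x \<bullet> cross3 (Om t x) (V t x))"
  have eq: "X t x * rate t x / 2 = ?r x + (\<Sum>j\<in>UNIV. pd j (T j) x)" for x
    unfolding rate2 vort_rhs_eq
    unfolding enstrophy_identity[OF smooth_Om smooth_U smooth_V Xs divg_U]
    by (simp add: grad_sq_eq[OF smooth_Om] stretch_def T_def[abs_def])
  have Ti: "integrable lborel (\<lambda>x. \<Sum>j\<in>UNIV. pd j (T j) x)"
    using test_fun_integrable[OF test_fun_pd[OF T_test]] by (intro Bochner_Integration.integrable_sum)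
  have T0: "(\<integral>x. (\<Sum>j\<in>UNIV. pd j (T j) x) \<partial>lborel) = 0"
    using test_fun_integrable[OF test_fun_pd[OF T_test]]
    by (subst Bochner_Integration.integral_sum) (auto simp: integral_pd[OF T_test])
  have restr: "(\<lambda>x. indicator C x *\<^sub>R h x) = h" if "\<And>x. x \<notin> C \<Longrightarrow> h x = 0" for h :: "real^3 \<Rightarrow> real"
    using that by (auto simp: indicator_def fun_eq_iff)
  have r0: "?r x = 0" if "x \<notin> C" for x
    using G_zero[OF t that] X_deriv_zero[OF t that] by simp
  have l0: "X t x * rate t x / 2 = 0" if "x \<notin> C" for x
    using G_zero[OF t that] by simp
  have li: "integrable lborel (\<lambda>x. X t x * rate t x / 2)"
  proof -
    obtain B where B: "\<And>t x. \<bar>rate t x\<bar> \<le> B" using bounded_meas_bound[OF bounded_meas_rate] by blast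
    have "set_integrable lborel C (\<lambda>x. X t x * rate t x)"
      by (rule set_integrable_continuous_bounded[OF C_compact smooth_continuous[OF Xs] bounded_meas_slice(1)[OF bounded_meas_rate] B])
    then have "integrable lborel (\<lambda>x. X t x * rate t x)"
      unfolding set_integrable_def using restr[of "\<lambda>x. X t x * rate t x"] G_zero[OF t] by simp
    then show ?thesis by simp
  qed
  have "(\<integral>x. X t x * rate t x / 2 \<partial>lborel) = (\<integral>x. X t x * rate t x / 2 - (\<Sum>j\<in>UNIV. pd j (T j) x) \<partial>lborel)"
    using li Ti T0 by simp
  also have "\<dots> = (\<integral>x. ?r x \<partial>lborel)"
  proof (rule Bochner_Integration.integral_cong[OF refl])
    fix x show "X t x * rate t x / 2 - (\<Sum>j\<in>UNIV. pd j (T j) x) = ?r x" unfolding eq by simp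
  qed
  finally have main: "(\<integral>x. X t x * rate t x / 2 \<partial>lborel) = (\<integral>x. ?r x \<partial>lborel)" .
  have drop: "(LINT x:C|lborel. h x) = (\<integral>x. h x \<partial>lborel)" if "\<And>x. x \<notin> C \<Longrightarrow> h x = 0" for h :: "real^3 \<Rightarrow> real"
    unfolding set_lebesgue_integral_def by (rule arg_cong[OF restr[OF that]])
  show ?thesis
    by (rule trans[OF drop trans[OF main drop[symmetric]]]) (rule l0, assumption, rule r0, assumption)
qed

text \<open>Both orders are used: space inside for the integration by parts at fixed
  \<open>t\<close>, time inside for the product rule at fixed \<open>x\<close>.\<close>

lemma integrable_S_slice:
  fixes f :: "real \<times> (real^3) \<Rightarrow> real"
  assumes f: "set_integrable lborel S f"
  shows "(LINT p:S|lborel. f p) = (LINT t:{s0..s1}|lborel. (LINT x:C|lborel. f (t, x)))"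
    "(LINT p:S|lborel. f p) = (LINT x:C|lborel. (LINT t:{s0..s1}|lborel. f (t, x)))"
proof -
  have int: "integrable (lborel \<Otimes>\<^sub>M lborel) (\<lambda>p. indicator S p *\<^sub>R f p)"
    using f unfolding set_integrable_def lborel_prod .
  have ind: "indicator S (t, x) *\<^sub>R f (t, x) = indicator {s0..s1} t *\<^sub>R (indicator C x *\<^sub>R f (t, x))" for t x
    by (auto simp: indicator_def)
  have ind': "indicator S (t, x) *\<^sub>R f (t, x) = indicator C x *\<^sub>R (indicator {s0..s1} t *\<^sub>R f (t, x))" for t x
    by (auto simp: indicator_def)
  have "(LINT p:S|lborel. f p) = (\<integral>t. (\<integral>x. indicator S (t, x) *\<^sub>R f (t, x) \<partial>lborel) \<partial>lborel)"
    using lborel_pair.integral_fst'[OF int] by (simp add: set_lebesgue_integral_def lborel_prod)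
  then show "(LINT p:S|lborel. f p) = (LINT t:{s0..s1}|lborel. (LINT x:C|lborel. f (t, x)))"
    unfolding ind set_lebesgue_integral_def by simp
  have "integrable (lborel \<Otimes>\<^sub>M lborel) (\<lambda>(t, x). indicator S (t, x) *\<^sub>R f (t, x))"
    using int by (simp add: split_beta')
  from lborel_pair.integral_snd[OF this]
  have "(LINT p:S|lborel. f p) = (\<integral>x. (\<integral>t. indicator S (t, x) *\<^sub>R f (t, x) \<partial>lborel) \<partial>lborel)"
    by (simp add: set_lebesgue_integral_def lborel_prod split_beta')
  then show "(LINT p:S|lborel. f p) = (LINT x:C|lborel. (LINT t:{s0..s1}|lborel. f (t, x)))"
    unfolding ind' set_lebesgue_integral_def by simp
qed

lemma grad_X_nth: "grad (X t) x $ i = sdx i G (t, x)"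
  by (simp add: grad_def pd_space_slice[OF G_smooth])

lemma lapl_X: "lapl (X t) x = (\<Sum>i\<in>UNIV. sdx i (sdx i G) (t, x))"
  by (simp add: lapl_def pd_space_slice G_smooth smooth_sdx)

lemma set_integrable_residual:
  "set_integrable lborel S (\<lambda>(t, x). (norm (Om t x))\<^sup>2 * (sdt G (t, x) + lapl (X t) x + U t x \<bullet> grad (X t) x))"
proof -
  note c = smooth_continuous[OF smooth_sdt[OF G_smooth]] smooth_continuous[OF smooth_sdx[OF G_smooth]]
    smooth_continuous[OF smooth_sdx[OF smooth_sdx[OF G_smooth]]]
  have "set_integrable lborel S (\<lambda>p. sdt G p * (norm (Om (fst p) (snd p)))\<^sup>2
      + (\<Sum>i\<in>UNIV. sdx i (sdx i G) p * (norm (Om (fst p) (snd p)))\<^sup>2)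
      + (\<Sum>i\<in>UNIV. sdx i G p * (U (fst p) (snd p) $ i * (norm (Om (fst p) (snd p)))\<^sup>2)))"
    by (intro set_integral_add(1) set_integrable_sum set_integrable_S c bounded_meas_mult bounded_meas_norm_Om bounded_meas_U)
  then show ?thesis
    by (simp add: split_beta' lapl_X inner_vec_def grad_X_nth algebra_simps sum_distrib_left sum_distrib_right)
qed

lemma set_integrable_X:
  assumes "bounded_meas f" shows "set_integrable lborel S (\<lambda>(t, x). X t x * f t x)"
  using set_integrable_S[OF smooth_continuous[OF G_smooth] assms] by (simp add: split_beta')

lemma set_integrable_grad_cross:
  "set_integrable lborel S (\<lambda>(t, x). grad (X t) x \<bullet> cross3 (Om t x) (V t x))"
proof -
  have "set_integrable lborel S (\<lambda>p. \<Sum>i\<in>UNIV. sdx i G p * cross3 (Om (fst p) (snd p)) (V (fst p) (snd p)) $ i)"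
    by (intro set_integrable_sum set_integrable_S smooth_continuous smooth_sdx G_smooth bounded_meas_cross)
  then show ?thesis by (simp add: split_beta' inner_vec_def grad_X_nth)
qed

text \<open>The left side is a space integral of increments in time. Fubini turns it into the
  space-time integral of the time derivative of the weighted enstrophy; for the half containing
  \<open>rate\<close>, Fubini in the other order permits \<open>slice_identity\<close> at every
  \<open>t\<close>.\<close>

lemma enstrophy_balance:
  "(\<integral>x. X s1 x * (norm (Om s1 x))\<^sup>2 \<partial>lborel) / 2 - (\<integral>x. X s0 x * (norm (Om s0 x))\<^sup>2 \<partial>lborel) / 2
   = (LINT (t, x):S|lborel. (norm (Om t x))\<^sup>2 * (sdt G (t, x) + lapl (X t) x + U t x \<bullet> grad (X t) x)) / 2
     - (LINT (t, x):S|lborel. X t x * grad_sq (Om t) x)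
     + (LINT (t, x):S|lborel. X t x * stretch t x)
     - (LINT (t, x):S|lborel. X t x * (curl (Om t) x \<bullet> V t x))
     - (LINT (t, x):S|lborel. grad (X t) x \<bullet> cross3 (Om t x) (V t x))"
proof -
  let ?N = "\<lambda>t x. (norm (Om t x))\<^sup>2"
  have NI: "integrable lborel (\<lambda>x. X t x * ?N t x)" if t: "t \<in> {s0..s1}" for t
  proof -
    obtain B where B: "\<And>t x. \<bar>?N t x\<bar> \<le> B" using bounded_meas_bound[OF bounded_meas_norm_Om] by blast
    have "set_integrable lborel C (\<lambda>x. X t x * ?N t x)"
      by (rule set_integrable_continuous_bounded[OF C_compact smooth_continuous[OF smooth_space_slice[OF G_smooth]]
          bounded_meas_slice(1)[OF bounded_meas_norm_Om] B])
    moreover have "(\<lambda>x. indicator C x *\<^sub>R (X t x * ?N t x)) = (\<lambda>x. X t x * ?N t x)"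
      using G_zero[OF t] by (auto simp: indicator_def fun_eq_iff)
    ultimately show ?thesis unfolding set_integrable_def by simp
  qed
  let ?E = "\<lambda>t x. sdt G (t, x) * ?N t x + X t x * rate t x"
  have Ei: "set_integrable lborel S (\<lambda>p. ?E (fst p) (snd p))"
    using set_integral_add(1)[OF set_integrable_S[OF smooth_continuous[OF smooth_sdt[OF G_smooth]] bounded_meas_norm_Om]
      set_integrable_S[OF smooth_continuous[OF G_smooth] bounded_meas_rate]] by simp
  have DC: "(\<lambda>x. X s1 x * ?N s1 x - X s0 x * ?N s0 x)
      = (\<lambda>x. indicator C x *\<^sub>R (X s1 x * ?N s1 x - X s0 x * ?N s0 x))"
    using G_zero[of s1] G_zero[of s0] s01 by (auto simp: indicator_def fun_eq_iff)
  have "(\<integral>x. X s1 x * ?N s1 x \<partial>lborel) - (\<integral>x. X s0 x * ?N s0 x \<partial>lborel)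
      = (\<integral>x. X s1 x * ?N s1 x - X s0 x * ?N s0 x \<partial>lborel)"
    using NI[of s1] NI[of s0] s01 by simp
  also have "\<dots> = (LINT x:C|lborel. (LINT t:{s0..s1}|lborel. ?E t x))"
    by (subst DC) (simp only: cutoff_enstrophy_increment set_lebesgue_integral_def)
  also have "\<dots> = (LINT p:S|lborel. ?E (fst p) (snd p))"
    using integrable_S_slice(2)[OF Ei] by simp
  also have "\<dots> = (LINT p:S|lborel. sdt G p * ?N (fst p) (snd p)) + (LINT p:S|lborel. X (fst p) (snd p) * rate (fst p) (snd p))"
    using set_integral_add(2)[OF set_integrable_S[OF smooth_continuous[OF smooth_sdt[OF G_smooth]] bounded_meas_norm_Om]
      set_integrable_S[OF smooth_continuous[OF G_smooth] bounded_meas_rate]] by simp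
  finally have 1: "(\<integral>x. X s1 x * ?N s1 x \<partial>lborel) - (\<integral>x. X s0 x * ?N s0 x \<partial>lborel)
    = (LINT p:S|lborel. sdt G p * ?N (fst p) (snd p)) + (LINT p:S|lborel. X (fst p) (snd p) * rate (fst p) (snd p))" .
  let ?r1 = "\<lambda>p. X (fst p) (snd p) * grad_sq (Om (fst p)) (snd p)"
  let ?r2 = "\<lambda>p. ?N (fst p) (snd p) * (lapl (X (fst p)) (snd p) + U (fst p) (snd p) \<bullet> grad (X (fst p)) (snd p))"
  let ?r3 = "\<lambda>p. X (fst p) (snd p) * stretch (fst p) (snd p)"
  let ?r4 = "\<lambda>p. X (fst p) (snd p) * (curl (Om (fst p)) (snd p) \<bullet> V (fst p) (snd p))"
  let ?r5 = "\<lambda>p. grad (X (fst p)) (snd p) \<bullet> cross3 (Om (fst p) (snd p)) (V (fst p) (snd p))"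
  let ?q = "\<lambda>p. sdt G p * ?N (fst p) (snd p)"
  have i0: "set_integrable lborel S ?q"
    by (rule set_integrable_S[OF smooth_continuous[OF smooth_sdt[OF G_smooth]] bounded_meas_norm_Om])
  have i1: "set_integrable lborel S ?r1"
    using set_integrable_X[OF bounded_meas_grad_sq] by (simp add: split_beta')
  have i3: "set_integrable lborel S ?r3"
    using set_integrable_X[OF bounded_meas_stretch] by (simp add: split_beta')
  have i4: "set_integrable lborel S ?r4"
    using set_integrable_X[OF bounded_meas_curl_V] by (simp add: split_beta')
  have i5: "set_integrable lborel S ?r5"
    using set_integrable_grad_cross by (simp add: split_beta')
  have i02: "set_integrable lborel S (\<lambda>p. ?q p + ?r2 p)"
    using set_integrable_residual by (simp add: split_beta' algebra_simps)
  have i2: "set_integrable lborel S ?r2"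
    using set_integral_diff(1)[OF i02 i0] by simp
  have i2': "set_integrable lborel S (\<lambda>p. 1 / 2 * ?r2 p)"
    using i2 by (rule set_integrable_mult_right)
  let ?tot = "\<lambda>p. 1 / 2 * ?r2 p - ?r1 p + ?r3 p - (?r4 p + ?r5 p)"
  have ir: "set_integrable lborel S ?tot"
    by (intro set_integral_add(1) set_integral_diff(1) i1 i2' i3 i4 i5)
  have irate: "set_integrable lborel S (\<lambda>p. X (fst p) (snd p) * rate (fst p) (snd p) / 2)"
    using set_integrable_S[OF smooth_continuous[OF G_smooth] bounded_meas_rate]
    by (simp add: set_integrable_divide)
  have "(LINT p:S|lborel. X (fst p) (snd p) * rate (fst p) (snd p) / 2)
      = (LINT t:{s0..s1}|lborel. (LINT x:C|lborel. X t x * rate t x / 2))"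
    using integrable_S_slice(1)[OF irate] by simp
  also have "\<dots> = (LINT t:{s0..s1}|lborel. (LINT x:C|lborel. ?tot (t, x)))"
  proof (rule set_lebesgue_integral_cong)
    show "\<forall>t. t \<in> {s0..s1} \<longrightarrow> (LINT x:C|lborel. X t x * rate t x / 2) = (LINT x:C|lborel. ?tot (t, x))"
      using slice_identity by (simp add: algebra_simps)
  qed simp
  also have "\<dots> = (LINT p:S|lborel. ?tot p)"
    by (rule integrable_S_slice(1)[OF ir, symmetric])
  also have "\<dots> = (LINT p:S|lborel. 1 / 2 * ?r2 p) - (LINT p:S|lborel. ?r1 p) + (LINT p:S|lborel. ?r3 p)
      - ((LINT p:S|lborel. ?r4 p) + (LINT p:S|lborel. ?r5 p))"
    using i1 i2' i3 i4 i5 by (simp add: set_integral_add set_integral_diff)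
  finally have 2: "(LINT p:S|lborel. X (fst p) (snd p) * rate (fst p) (snd p) / 2)
      = (LINT p:S|lborel. ?r2 p) / 2 - (LINT p:S|lborel. ?r1 p) + (LINT p:S|lborel. ?r3 p)
      - ((LINT p:S|lborel. ?r4 p) + (LINT p:S|lborel. ?r5 p))"
    by simp
  \<comment> \<open>The residual is reassembled from two sources: its time derivative comes from the
    product rule in time, its Laplacian and drift from the integration by parts in space.\<close>
  have 3: "(LINT (t, x):S|lborel. ?N t x * (sdt G (t, x) + lapl (X t) x + U t x \<bullet> grad (X t) x))
      = (LINT p:S|lborel. ?q p) + (LINT p:S|lborel. ?r2 p)"
  proof -
    have "(\<lambda>(t, x). ?N t x * (sdt G (t, x) + lapl (X t) x + U t x \<bullet> grad (X t) x)) = (\<lambda>p. ?q p + ?r2 p)"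
      by (auto simp: fun_eq_iff algebra_simps)
    then show ?thesis using set_integral_add(2)[OF i0 i2] by (simp only:)
  qed
  show ?thesis
    using 1 2 unfolding 3 by (simp add: split_beta' field_simps)
qed

end

section \<open>Estimates for the filter kernel\<close>

lemma smooth_scaled:
  assumes "smooth \<phi>" shows "smooth (scaled \<phi> l)"
  unfolding scaled_def[abs_def]
  using smooth_divide_const[OF smooth_affine[OF bounded_linear_scaleR_right assms, of 0 "inverse l"], of "l ^ 3"] by simp

lemma pd_scaled:
  assumes "smooth \<phi>" shows "pd j (scaled \<phi> l) x = pd j \<phi> (x /\<^sub>R l) / l ^ 4"
proof -
  have lin: "linear (frechet_derivative \<phi> (at z))" for z
    using smooth_has_derivative[OF assms] by (intro bounded_linear.linear has_derivative_bounded_linear)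
  have "pd j (\<lambda>x. \<phi> (0 + inverse l *\<^sub>R x)) x = inverse l * pd j \<phi> (x /\<^sub>R l)"
    unfolding pd_def
    by (subst frechet_derivative_affine[OF bounded_linear_scaleR_right smooth_differentiable[OF assms]])
      (simp add: linear_scale[OF lin])
  moreover have "pd j (scaled \<phi> l) x = pd j (\<lambda>x. \<phi> (0 + inverse l *\<^sub>R x)) x / l ^ 3"
    unfolding scaled_def[abs_def]
    using pd_divide_const[OF smooth_affine[OF bounded_linear_scaleR_right assms, of 0 "inverse l"], of j "l ^ 3" x] by simp
  ultimately show ?thesis by (simp add: field_simps power_eq_if)
qed

lemma test_fun_scaled:
  assumes \<phi>: "test_fun A \<phi>" and l: "0 < l" shows "test_fun UNIV (scaled \<phi> l)"
proof -
  obtain R where R: "0 < R" "\<And>z. R < norm z \<Longrightarrow> \<phi> z = 0" using test_fun_supp_ball[OF \<phi>] by blast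
  show ?thesis
  proof (rule test_funI[of _ "cball 0 (l * R)"])
    show "smooth (scaled \<phi> l)" using \<phi> by (simp add: test_fun_def smooth_scaled)
    show "scaled \<phi> l x = 0" if "x \<notin> cball 0 (l * R)" for x
    proof -
      have "R < norm (x /\<^sub>R l)" using that l by (simp add: field_simps)
      then show ?thesis using R(2) by (simp add: scaled_def)
    qed
  qed auto
qed

lemma integral_scaled:
  assumes "smooth \<phi>" "0 < l" shows "(\<integral>x. scaled \<phi> l x \<partial>lborel) = (\<integral>x. \<phi> x \<partial>lborel)"
  using integral_lborel_affine[OF smooth_measurable[OF smooth_scaled[OF assms(1)]], of l l 0] assms(2)
  by (simp add: scaled_def)

lemma grad_scaled:
  assumes "smooth \<phi>" shows "grad (scaled \<phi> l) x = grad \<phi> (x /\<^sub>R l) /\<^sub>R l ^ 4"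
  by (simp add: grad_def vec_eq_iff pd_scaled[OF assms] field_simps)

lemma grad_continuous:
  assumes "smooth f" shows "continuous_on A (grad f)"
  unfolding grad_def[abs_def] by (intro continuous_on_vec_lambda smooth_continuous smooth_pd assms)

lemma grad_measurable: "smooth f \<Longrightarrow> grad f \<in> borel_measurable borel"
  by (rule borel_measurable_continuous_onI[OF grad_continuous])

text \<open>A kernel with vanishing gradient would be constant, hence zero by its compact support,
  against its unit mass. Positivity makes the normalisation of \<open>mu\<close> meaningful.\<close>

lemma kernel_grad_pos:
  assumes "filter_kernel \<phi>" shows "0 < (\<integral>x. norm (grad \<phi> x) \<partial>lborel)"
proof -
  have sm: "smooth \<phi>" and i1: "(\<integral>x. \<phi> x \<partial>lborel) = 1" and tf: "test_fun UNIV \<phi>"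
    using assms test_fun_mono[of "ball 0 1" \<phi> UNIV] by (auto simp: filter_kernel_def test_fun_def)
  obtain R where R: "0 < R" "\<And>z. R < norm z \<Longrightarrow> \<phi> z = 0" using test_fun_supp_ball[OF tf] by blast
  have "(\<integral>x. norm (grad \<phi> x) \<partial>lborel) \<noteq> 0"
  proof
    assume 0: "(\<integral>x. norm (grad \<phi> x) \<partial>lborel) = 0"
    have out: "norm (grad \<phi> x) = 0" if "R < norm x" for x
    proof -
      have "supp \<phi> \<subseteq> cball 0 R" by (rule supp_subset_closed) (use R in force)+
      with that have "pd j \<phi> x = 0" for j unfolding pd_def by (intro deriv_zero_off_supp) auto
      then show ?thesis by (simp add: grad_def vec_eq_iff)
    qed
    have "norm (grad \<phi> x) = 0" for x
      by (rule continuous_nonneg_integral_0[OF _ _ out 0]) (auto intro: continuous_intros grad_continuous sm)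
    then have "pd j \<phi> x = 0" for j x by (simp add: grad_def vec_eq_iff)
    then have "frechet_derivative \<phi> (at x) = (\<lambda>h. 0)" for x
      using frechet_pd[OF sm] by (auto simp: fun_eq_iff)
    then have "(\<phi> has_derivative (\<lambda>h. 0)) (at x within UNIV)" for x
      using smooth_has_derivative[OF sm, of x] by simp
    then obtain c where c: "\<And>x. \<phi> x = c"
      using has_derivative_zero_constant[OF convex_UNIV, of \<phi>] by blast
    have "c = 0" using R(2)[of "(2 * R) *\<^sub>R axis 1 1"] R(1) c by simp
    then have "\<phi> = (\<lambda>x. 0)" using c by auto
    then show False using i1 by simp
  qed
  moreover have "0 \<le> (\<integral>x. norm (grad \<phi> x) \<partial>lborel)" by (rule Bochner_Integration.integral_nonneg) simp
  ultimately show ?thesis by (metis less_le)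
qed

section \<open>Moment inequalities and integrability under reflection\<close>

lemma integral_Cauchy_Schwarz:
  fixes f g :: "'a \<Rightarrow> real"
  assumes f: "integrable M (\<lambda>x. (f x)\<^sup>2)" and g: "integrable M (\<lambda>x. (g x)\<^sup>2)" and fg: "integrable M (\<lambda>x. f x * g x)"
  shows "(\<integral>x. f x * g x \<partial>M)\<^sup>2 \<le> (\<integral>x. (f x)\<^sup>2 \<partial>M) * (\<integral>x. (g x)\<^sup>2 \<partial>M)"
proof -
  let ?F = "\<integral>x. (f x)\<^sup>2 \<partial>M" and ?G = "\<integral>x. (g x)\<^sup>2 \<partial>M" and ?P = "\<integral>x. f x * g x \<partial>M"
  \<comment> \<open>A quadratic in \<open>s\<close> that is never negative; when \<open>?G\<close>
    is positive, its value at the minimiser \<open>?P / ?G\<close> is the claim.\<close>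
  have q: "0 \<le> ?F - 2 * s * ?P + s\<^sup>2 * ?G" for s
  proof -
    have "0 \<le> (\<integral>x. (f x - s * g x)\<^sup>2 \<partial>M)" by simp
    also have "\<dots> = (\<integral>x. (f x)\<^sup>2 - 2 * s * (f x * g x) + s\<^sup>2 * (g x)\<^sup>2 \<partial>M)"
      by (simp add: power2_diff power_mult_distrib algebra_simps)
    also have "\<dots> = ?F - 2 * s * ?P + s\<^sup>2 * ?G" using f g fg by simp
    finally show ?thesis .
  qed
  have G0: "0 \<le> ?G" by simp
  show ?thesis
  proof (cases "?G = 0")
    case True
    have "?P = 0"
    proof (rule ccontr)
      assume "?P \<noteq> 0"
      \<comment> \<open>With \<open>?G\<close> zero the expression is linear in \<open>s\<close>,
        and this \<open>s\<close> gives it the value -1.\<close>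
      then show False using q[of "(?F + 1) / (2 * ?P)"] True by simp
    qed
    then show ?thesis using True by simp
  next
    case False
    with G0 have "0 < ?G" by linarith
    then show ?thesis using q[of "?P / ?G"] by (simp add: field_simps power2_eq_square)
  qed
qed

text \<open>On a space of mass at most one the L^q norm is at most the L^p norm, infinite values
  included. Young's inequality bounds the \<open>q\<close>-th power by an affine function of the
  \<open>p\<close>-th power, and integrating that function gives at most the claimed value.\<close>

lemma nn_integral_powr_Jensen:
  fixes f :: "'a \<Rightarrow> real"
  assumes m: "emeasure M (space M) \<le> 1" and f: "f \<in> borel_measurable M" "\<And>x. 0 \<le> f x"
    and q: "0 < q" "q \<le> p"
  shows "(\<integral>\<^sup>+x. ennreal (f x powr q) \<partial>M) \<le> epowr (epowr (\<integral>\<^sup>+x. ennreal (f x powr p) \<partial>M) (1 / p)) q"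
proof (cases "(\<integral>\<^sup>+x. ennreal (f x powr p) \<partial>M) = \<infinity>")
  case True
  then show ?thesis by (simp add: epowr_def)
next
  case False
  let ?N = "\<integral>\<^sup>+x. ennreal (f x powr p) \<partial>M"
  define n where "n = enn2real ?N"
  have N: "?N = ennreal n" using False by (simp add: n_def less_top)
  have n0: "0 \<le> n" by (simp add: n_def)
  have p0: "0 < p" using q by simp
  show ?thesis
  proof (cases "n = 0")
    case True
    then have "?N = 0" using N by simp
    then have "AE x in M. ennreal (f x powr p) = 0"
      using nn_integral_0_iff_AE[of "\<lambda>x. ennreal (f x powr p)" M] f(1) by simp
    then have "AE x in M. ennreal (f x powr q) = 0"
      by (rule eventually_mono) (simp add: ennreal_eq_0_iff powr_nonneg_iff)
    then have "(\<integral>\<^sup>+x. ennreal (f x powr q) \<partial>M) = 0"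
      using nn_integral_0_iff_AE[of "\<lambda>x. ennreal (f x powr q)" M] f(1) by simp
    then show ?thesis by simp
  next
    case False
    with n0 have n: "0 < n" by simp
    define \<theta> where "\<theta> = q / p"
    have th: "0 < \<theta>" "\<theta> \<le> 1" using q by (auto simp: \<theta>_def)
    \<comment> \<open>Weighted arithmetic-geometric mean of \<open>f x powr p / n\<close> and 1 with
      weight \<open>q / p\<close>. Dividing by the moment \<open>n\<close> is what makes
      \<open>\<alpha> * n + \<beta>\<close> collapse to \<open>n powr \<theta>\<close>.\<close>
    have young: "f x powr q \<le> n powr \<theta> * (\<theta> / n * (f x powr p) + (1 - \<theta>))" for x
    proof (cases "f x = 0")
      case True
      then show ?thesis using th n by simp
    next
      case False
      then have fx: "0 < f x" using f(2)[of x] by linarith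
      have "(f x powr p / n) powr \<theta> * 1 powr (1 - \<theta>) \<le> \<theta> * (f x powr p / n) + (1 - \<theta>) * 1"
        using th n fx by (intro Youngs_inequality_0) auto
      moreover have "(f x powr p / n) powr \<theta> = f x powr q / n powr \<theta>"
        using n p0 by (simp add: powr_divide powr_powr \<theta>_def)
      ultimately show ?thesis using n by (simp add: field_simps)
    qed
    define \<alpha> \<beta> where "\<alpha> = n powr \<theta> * (\<theta> / n)" and "\<beta> = n powr \<theta> * (1 - \<theta>)"
    have ab: "0 \<le> \<alpha>" "0 \<le> \<beta>" "\<alpha> * n + \<beta> = n powr \<theta>"
      using th n by (auto simp: \<alpha>_def \<beta>_def algebra_simps)
    have "(\<integral>\<^sup>+x. ennreal (f x powr q) \<partial>M) \<le> (\<integral>\<^sup>+x. ennreal \<alpha> * ennreal (f x powr p) + ennreal \<beta> \<partial>M)"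
    proof (rule nn_integral_mono)
      fix x
      have "ennreal (f x powr q) \<le> ennreal (\<alpha> * (f x powr p) + \<beta>)"
        using young[of x] by (intro ennreal_leI) (simp add: \<alpha>_def \<beta>_def algebra_simps)
      also have "\<dots> = ennreal \<alpha> * ennreal (f x powr p) + ennreal \<beta>"
        using ab(1,2) by (simp add: ennreal_mult)
      finally show "ennreal (f x powr q) \<le> \<dots>" .
    qed
    also have "\<dots> = ennreal \<alpha> * ?N + ennreal \<beta> * emeasure M (space M)"
      using f(1) by (subst nn_integral_add) (auto simp: nn_integral_cmult)
    also have "\<dots> \<le> ennreal \<alpha> * ennreal n + ennreal \<beta> * 1"
      unfolding N by (intro add_left_mono mult_left_mono m) simp
    also have "\<dots> = ennreal (\<alpha> * n + \<beta>)"
      using ab(1,2) n0 by (simp add: ennreal_mult)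
    also have "\<dots> = ennreal (n powr \<theta>)" by (simp only: ab)
    also have "n powr \<theta> = (n powr (1 / p)) powr q" by (simp add: powr_powr \<theta>_def)
    finally show ?thesis using N n0 by (simp add: epowr_def)
  qed
qed

lemma integrable_reflect:
  fixes f :: "real^'n::finite \<Rightarrow> real"
  assumes "integrable lborel f" shows "integrable lborel (\<lambda>z. f (x - z))"
proof (rule integrableI_bounded)
  have fm: "f \<in> borel_measurable borel" using borel_measurable_integrable[OF assms] by simp
  then show "(\<lambda>z. f (x - z)) \<in> borel_measurable lborel" by simp
  have "(\<integral>\<^sup>+z. ennreal (norm (f z)) \<partial>lborel) = (\<integral>\<^sup>+z. ennreal (norm (f (x - z))) \<partial>lborel)"
    using nn_integral_lborel_affine[of "\<lambda>z. ennreal (norm (f z))" "-1" x] fm by simp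
  then show "(\<integral>\<^sup>+z. ennreal (norm (f (x - z))) \<partial>lborel) < \<infinity>"
    using assms by (simp add: integrable_iff_bounded)
qed

lemma loc_int_bound:
  assumes a: "a \<in> borel_measurable borel" and e: "integrable lborel e" "\<And>z. \<bar>a z\<bar> \<le> c + e z"
  shows "loc_int a"
  unfolding loc_int_def
proof
  fix R :: real
  have i: "integrable lborel (indicat_real (cball (0::real^3) R))"
    using emeasure_lborel_cball_finite[of 0 R] by (intro integrable_real_indicator) auto
  show "integrable lborel (\<lambda>y. indicator (cball 0 R) y * a y)"
  proof (rule Bochner_Integration.integrable_bound)
    show "integrable lborel (\<lambda>y. c * indicator (cball 0 R) y + \<bar>e y\<bar>)" using i e(1) by simp
    show "(\<lambda>y. indicator (cball 0 R) y * a y) \<in> borel_measurable lborel"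
      using a by (intro borel_measurable_times borel_measurable_indicator) simp_all
    show "AE y in lborel. norm (indicat_real (cball 0 R) y * a y) \<le> norm (c * indicat_real (cball 0 R) y + \<bar>e y\<bar>)"
    proof (rule AE_I2)
      fix y
      show "norm (indicat_real (cball 0 R) y * a y) \<le> norm (c * indicat_real (cball 0 R) y + \<bar>e y\<bar>)"
        using e(2)[of y] by (auto simp: indicator_def)
    qed
  qed
qed

lemma test_fun_loc_int:
  assumes K: "test_fun UNIV K" and a: "loc_int a"
  shows "integrable lborel (\<lambda>z. K z * a z)"
  using conv_integrable[OF test_fun_reflect[OF K, of 0] a, of 0] by simp

section \<open>Pointwise bounds on the gradient of U and on div R\<close>

context filtered_flow
begin

text \<open>Subtracting the constant \<open>v t x\<close> inside the filter leaves the subfilter stress unchanged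
  and turns \<open>div R\<close> into an expression in increments only.\<close>

lemma V_increments:
  fixes t :: real and x :: "real^3"
  assumes l: "0 < l"
  defines "d i z \<equiv> v t (x - z) $ i - v t x $ i"
  shows "V t x $ i = (\<Sum>j\<in>UNIV. (\<integral>z. pd j \<Phi> z * (d i z * d j z) \<partial>lborel)
    - (\<integral>z. pd j \<Phi> z * d i z \<partial>lborel) * (\<integral>z. \<Phi> z * d j z \<partial>lborel)
    - (\<integral>z. \<Phi> z * d i z \<partial>lborel) * (\<integral>z. pd j \<Phi> z * d j z \<partial>lborel))"
proof -
  have mass: "(\<integral>z. \<Phi> z \<partial>lborel) = 1"
    using kernel integral_scaled[OF _ l, of \<phi>] by (simp add: filter_kernel_def test_fun_def)
  have di: "test_fun UNIV (pd j \<Phi>)" for j by (rule test_fun_pd[OF scaled_test])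
  have vm: "(\<lambda>z. v t (x - z) $ k) \<in> borel_measurable borel" for k
    using borel_measurable_slice(1)[OF meas_component[of k], of t] by simp
  have li1: "loc_int (\<lambda>z. v t (x - z) $ k)" for k
  proof (rule loc_int_bound[OF vm integrable_reflect[OF sq[of t], of x], where c=1])
    show "\<bar>v t (x - z) $ k\<bar> \<le> 1 + (norm (v t (x - z)))\<^sup>2" for z
      using dominated_component[of k] unfolding dominated_def by blast
  qed
  have li2: "loc_int (\<lambda>z. v t (x - z) $ k * v t (x - z) $ m)" for k m
  proof (rule loc_int_bound[OF borel_measurable_times[OF vm vm] integrable_reflect[OF sq[of t], of x], where c=1])
    show "\<bar>v t (x - z) $ k * v t (x - z) $ m\<bar> \<le> 1 + (norm (v t (x - z)))\<^sup>2" for z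
      using dominated_product[of k m] unfolding dominated_def by blast
  qed
  have conv_reflect: "conv K (\<lambda>y. a y) x = (\<integral>z. K z * a (x - z) \<partial>lborel)"
    if "test_fun UNIV K" "a \<in> borel_measurable borel" for K a
  proof -
    have "(\<lambda>y. K (x - y) * a y) \<in> borel_measurable borel"
      using smooth_measurable_reflect[OF test_fun_smooth[OF that(1)]] that(2) by (intro borel_measurable_times)
    then show ?thesis unfolding conv_real using integral_lborel_affine[of "\<lambda>y. K (x - y) * a y" "-1" x] by simp
  qed
  note cm = borel_measurable_slice(1)[OF meas_component]
  have i0: "integrable lborel K" if "test_fun UNIV K" for K :: "real^3 \<Rightarrow> real" by (rule test_fun_integrable[OF that])
  note i1 = test_fun_loc_int[OF _ li1] and i2 = test_fun_loc_int[OF _ li2]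
  have e1: "(\<integral>z. K z * d k z \<partial>lborel) = conv K (\<lambda>y. v t y $ k) x - v t x $ k * (\<integral>z. K z \<partial>lborel)"
    if K: "test_fun UNIV K" for K k
    unfolding d_def conv_reflect[OF K cm] right_diff_distrib using i1[OF K, of k] i0[OF K] by simp
  have e2: "(\<integral>z. K z * (d k z * d m z) \<partial>lborel) = conv K (\<lambda>y. v t y $ k * v t y $ m) x
      - v t x $ m * conv K (\<lambda>y. v t y $ k) x - v t x $ k * conv K (\<lambda>y. v t y $ m) x
      + v t x $ k * v t x $ m * (\<integral>z. K z \<partial>lborel)"
    if K: "test_fun UNIV K" for K k m
  proof -
    have "(\<integral>z. K z * (d k z * d m z) \<partial>lborel) = (\<integral>z. K z * (v t (x - z) $ k * v t (x - z) $ m)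
        - v t x $ m * (K z * v t (x - z) $ k) - v t x $ k * (K z * v t (x - z) $ m) + v t x $ k * v t x $ m * K z \<partial>lborel)"
      by (simp add: d_def algebra_simps)
    also have "\<dots> = (\<integral>z. K z * (v t (x - z) $ k * v t (x - z) $ m) \<partial>lborel)
        - v t x $ m * (\<integral>z. K z * v t (x - z) $ k \<partial>lborel) - v t x $ k * (\<integral>z. K z * v t (x - z) $ m \<partial>lborel)
        + v t x $ k * v t x $ m * (\<integral>z. K z \<partial>lborel)"
      using i1[OF K] i2[OF K] i0[OF K] by simp
    finally show ?thesis unfolding conv_reflect[OF K cm] conv_reflect[OF K borel_measurable_times[OF cm cm]] .
  qed
  have Uk: "U t x $ k = conv \<Phi> (\<lambda>y. v t y $ k) x" for k by (rule fun_cong[OF U_nth])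
  \<comment> \<open>All terms containing the constant \<open>v t x\<close> cancel, since
    \<open>\<Phi>\<close> has mass one and its derivatives have mass zero.\<close>
  show ?thesis
    unfolding V_nth e1[OF di] e2[OF di] e1[OF scaled_test] integral_pd[OF scaled_test] mass Uk pd_U
    by (rule sum.cong[OF refl]) (simp add: algebra_simps)
qed

text \<open>Cauchy-Schwarz against the energy. The squared kernel derivative carries
  \<open>l\<close> to the power -8 and the change of variables returns \<open>l ^ 3\<close>, which
  leaves \<open>l ^ 5\<close> in the denominator.\<close>

lemma pd_U_bound:
  assumes l: "0 < l" and E: "(\<integral>y. (norm (v t y))\<^sup>2 \<partial>lborel) \<le> E"
  shows "\<bar>pd j (\<lambda>y. U t y $ k) x\<bar> \<le> sqrt ((\<integral>z. (pd j \<phi> z)\<^sup>2 \<partial>lborel) / l ^ 5 * E)"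
proof -
  have sm: "smooth \<phi>" using kernel by (simp add: filter_kernel_def test_fun_def)
  have tf: "test_fun UNIV (\<lambda>y. pd j \<Phi> (x - y))" by (rule test_fun_reflect[OF test_fun_pd[OF scaled_test]])
  have i1: "integrable lborel (\<lambda>y. (pd j \<Phi> (x - y))\<^sup>2)"
    unfolding power2_eq_square by (rule test_fun_integrable[OF test_fun_mult[OF tf test_fun_smooth[OF tf]]])
  have le: "(v t y $ k)\<^sup>2 \<le> (norm (v t y))\<^sup>2" for y
    using component_le_norm_cart[of "v t y" k] by (intro abs_le_square_iff[THEN iffD1]) simp
  have i2: "integrable lborel (\<lambda>y. (v t y $ k)\<^sup>2)"
    by (rule Bochner_Integration.integrable_bound[OF sq[of t]])
      (use borel_measurable_slice(1)[OF meas_component[of k], of t] le in auto)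
  have e1: "(\<integral>y. (pd j \<Phi> (x - y))\<^sup>2 \<partial>lborel) = (\<integral>z. (pd j \<phi> z)\<^sup>2 \<partial>lborel) / l ^ 5"
  proof -
    have "(\<integral>y. (pd j \<Phi> (x - y))\<^sup>2 \<partial>lborel) = (\<integral>y. (pd j \<Phi> y)\<^sup>2 \<partial>lborel)"
      using integral_lborel_affine[of "\<lambda>y. (pd j \<Phi> y)\<^sup>2" "-1" x]
        smooth_measurable[OF test_fun_smooth[OF test_fun_pd[OF scaled_test]], of j] by simp
    also have "\<dots> = l ^ 3 * (\<integral>y. (pd j \<Phi> (l *\<^sub>R y))\<^sup>2 \<partial>lborel)"
      using integral_lborel_affine[of "\<lambda>y. (pd j \<Phi> y)\<^sup>2" l 0] l
        smooth_measurable[OF test_fun_smooth[OF test_fun_pd[OF scaled_test]], of j] by simp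
    also have "\<dots> = (\<integral>z. (pd j \<phi> z)\<^sup>2 \<partial>lborel) / l ^ 5"
      using l by (simp add: pd_scaled[OF sm] power_divide field_simps eval_nat_numeral)
    finally show ?thesis .
  qed
  have "(\<integral>y. pd j \<Phi> (x - y) * v t y $ k \<partial>lborel)\<^sup>2
      \<le> (\<integral>y. (pd j \<Phi> (x - y))\<^sup>2 \<partial>lborel) * (\<integral>y. (v t y $ k)\<^sup>2 \<partial>lborel)"
    by (rule integral_Cauchy_Schwarz[OF i1 i2 conv_integrable[OF test_fun_pd[OF scaled_test] loc_int_component]])
  also have "\<dots> \<le> (\<integral>y. (pd j \<Phi> (x - y))\<^sup>2 \<partial>lborel) * E"
    by (intro mult_left_mono order_trans[OF integral_mono[OF i2 sq le] E]) simp
  finally show ?thesis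
    using real_sqrt_le_mono unfolding e1 pd_U conv_real real_sqrt_abs[symmetric] by blast
qed

text \<open>The powers of \<open>l\<close> cancel because both increment measures have total mass one.\<close>

lemma V_increment_bound:
  assumes l: "0 < l" and p: "2 \<le> p"
  shows "ennreal ((norm (V t x))\<^sup>2)
    \<le> ennreal (81 * (\<integral>y. norm (grad \<phi> y) \<partial>lborel)\<^sup>2 / l\<^sup>2) * MM \<phi> l p v t x ^ 4"
proof -
  have sm: "smooth \<phi>" and nn: "\<And>z. 0 \<le> \<phi> z" and i1: "(\<integral>x. \<phi> x \<partial>lborel) = 1"
    using kernel by (auto simp: filter_kernel_def test_fun_def)
  define g where "g = (\<integral>y. norm (grad \<phi> y) \<partial>lborel)"
  have g: "0 < g" unfolding g_def by (rule kernel_grad_pos[OF kernel])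
  define f where "f z = norm (v t (x - z) - v t x)" for z
  have f0: "0 \<le> f z" for z by (simp add: f_def)
  have fm: "f \<in> borel_measurable borel"
    unfolding f_def[abs_def] using borel_measurable_slice(1)[OF meas, of t] by simp
  have Pm: "\<Phi> \<in> borel_measurable borel" by (rule smooth_measurable[OF test_fun_smooth[OF scaled_test]])
  have Gm: "grad \<Phi> \<in> borel_measurable borel" by (rule grad_measurable[OF test_fun_smooth[OF scaled_test]])
  have P0: "0 \<le> \<Phi> z" for z using nn l by (simp add: scaled_def)
  define \<nu> \<mu> where "\<nu> = nu \<phi> l" and "\<mu> = mu \<phi> l"
  have nu_int: "(\<integral>\<^sup>+z. h z \<partial>\<nu>) = (\<integral>\<^sup>+z. ennreal (\<Phi> z) * h z \<partial>lborel)" if "h \<in> borel_measurable borel" for h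
    unfolding \<nu>_def nu_def using that Pm by (subst nn_integral_density) auto
  have mu_int: "(\<integral>\<^sup>+z. h z \<partial>\<mu>) = (\<integral>\<^sup>+z. ennreal (l * norm (grad \<Phi> z) / g) * h z \<partial>lborel)" if "h \<in> borel_measurable borel" for h
    unfolding \<mu>_def mu_def g_def using that Gm by (subst nn_integral_density) auto
  have nu_mass: "emeasure \<nu> (space \<nu>) \<le> 1"
  proof -
    have "emeasure \<nu> (space \<nu>) = (\<integral>\<^sup>+z. 1 \<partial>\<nu>)" by simp
    also have "\<dots> = (\<integral>\<^sup>+z. ennreal (\<Phi> z) \<partial>lborel)" by (subst nu_int) auto
    also have "\<dots> = ennreal (\<integral>z. \<Phi> z \<partial>lborel)"
      using P0 by (intro nn_integral_eq_integral test_fun_integrable[OF scaled_test]) auto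
    finally show ?thesis using integral_scaled[OF sm l] i1 by simp
  qed
  \<comment> \<open>The Bochner integral of a non-integrable function is 0, so a positive value
    certifies integrability.\<close>
  have gi: "integrable lborel (\<lambda>z. norm (grad \<phi> z))"
    using g unfolding g_def by (metis less_irrefl not_integrable_integral_eq)
  have mu_mass: "emeasure \<mu> (space \<mu>) \<le> 1"
  proof -
    have "emeasure \<mu> (space \<mu>) = (\<integral>\<^sup>+z. 1 \<partial>\<mu>)" by simp
    also have "\<dots> = (\<integral>\<^sup>+z. ennreal (l * norm (grad \<Phi> z) / g) \<partial>lborel)" by (subst mu_int) auto
    also have "\<dots> = ennreal (l ^ 3) * (\<integral>\<^sup>+z. ennreal (l * norm (grad \<Phi> (l *\<^sub>R z)) / g) \<partial>lborel)"
      using nn_integral_lborel_affine[of "\<lambda>z. ennreal (l * norm (grad \<Phi> z) / g)" l 0] Gm l by simp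
    also have "\<dots> = (\<integral>\<^sup>+z. ennreal (l ^ 3) * ennreal (l * norm (grad \<Phi> (l *\<^sub>R z)) / g) \<partial>lborel)"
    proof -
      have "(\<lambda>z. grad \<Phi> (l *\<^sub>R z)) \<in> borel_measurable borel"
        using measurable_compose[OF _ Gm, of "\<lambda>z. l *\<^sub>R z" borel] by simp
      then show ?thesis by (subst nn_integral_cmult) auto
    qed
    also have "\<dots> = (\<integral>\<^sup>+z. ennreal (norm (grad \<phi> z) / g) \<partial>lborel)"
    proof (rule nn_integral_cong)
      fix z
      have "l ^ 3 * (l * norm (grad \<Phi> (l *\<^sub>R z)) / g) = norm (grad \<phi> z) / g"
        using l by (simp add: grad_scaled[OF sm] field_simps eval_nat_numeral)
      then show "ennreal (l ^ 3) * ennreal (l * norm (grad \<Phi> (l *\<^sub>R z)) / g) = ennreal (norm (grad \<phi> z) / g)"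
        using l g by (subst ennreal_mult[symmetric]) auto
    qed
    also have "\<dots> = ennreal (\<integral>z. norm (grad \<phi> z) / g \<partial>lborel)"
      using gi g by (intro nn_integral_eq_integral) auto
    also have "(\<integral>z. norm (grad \<phi> z) / g \<partial>lborel) = 1" using g by (simp add: g_def)
    finally show ?thesis by simp
  qed
  let ?n1 = "increment_norm \<nu> p (v t) x" and ?n2 = "increment_norm \<mu> p (v t) x"
  have fmn: "f \<in> borel_measurable \<nu>" and fmm: "f \<in> borel_measurable \<mu>"
    using fm by (simp_all add: \<nu>_def nu_def \<mu>_def mu_def)
  have ep1: "epowr y 1 = y" for y by (cases y) (simp_all add: epowr_def)
  have ep2: "epowr y 2 = y ^ 2" for y
  proof (cases y)
    case (real r)
    then show ?thesis by (cases "r = 0") (simp_all add: epowr_def ennreal_power powr_numeral)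
  qed (simp add: epowr_def power2_eq_square ennreal_top_mult)
  have j1: "(\<integral>\<^sup>+z. ennreal (f z) \<partial>\<nu>) \<le> ?n1"
    using nn_integral_powr_Jensen[OF nu_mass fmn f0, of 1 p] p
    by (simp add: ep1 f0 increment_norm_def f_def)
  have j2: "(\<integral>\<^sup>+z. ennreal (f z) \<partial>\<mu>) \<le> ?n2"
    using nn_integral_powr_Jensen[OF mu_mass fmm f0, of 1 p] p
    by (simp add: ep1 f0 increment_norm_def f_def)
  have f2: "f z powr 2 = (f z)\<^sup>2" for z using f0[of z] by (cases "f z = 0") (simp_all add: powr_numeral)
  have j3: "(\<integral>\<^sup>+z. ennreal ((f z)\<^sup>2) \<partial>\<mu>) \<le> ?n2\<^sup>2"
    using nn_integral_powr_Jensen[OF mu_mass fmm f0, of 2 p] p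
    unfolding f2 by (simp add: ep2 increment_norm_def f_def)
  have MM: "MM \<phi> l p v t x = ?n1 + ?n2" by (simp add: MM_def \<nu>_def \<mu>_def)
  define a1 m1 m2 where "a1 = (\<integral>\<^sup>+z. ennreal (\<Phi> z * f z) \<partial>lborel)"
    and "m1 = (\<integral>\<^sup>+z. ennreal (norm (grad \<Phi> z) * f z) \<partial>lborel)"
    and "m2 = (\<integral>\<^sup>+z. ennreal (norm (grad \<Phi> z) * (f z)\<^sup>2) \<partial>lborel)"
  have a1: "a1 \<le> ?n1"
    using j1 fm P0 f0 by (simp add: a1_def nu_int ennreal_mult)
  have grad_mu: "(\<integral>\<^sup>+z. ennreal (norm (grad \<Phi> z) * h z) \<partial>lborel) = ennreal (g / l) * (\<integral>\<^sup>+z. ennreal (h z) \<partial>\<mu>)"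
    if h: "h \<in> borel_measurable borel" "\<And>z. 0 \<le> h z" for h
  proof -
    have "ennreal (g / l) * (\<integral>\<^sup>+z. ennreal (h z) \<partial>\<mu>)
        = (\<integral>\<^sup>+z. ennreal (g / l) * (ennreal (l * norm (grad \<Phi> z) / g) * ennreal (h z)) \<partial>lborel)"
      using h Gm by (simp add: mu_int nn_integral_cmult)
    also have "\<dots> = (\<integral>\<^sup>+z. ennreal (norm (grad \<Phi> z) * h z) \<partial>lborel)"
      using g l h(2) by (intro nn_integral_cong) (simp add: ennreal_mult[symmetric] mult.assoc)
    finally show ?thesis by simp
  qed
  have m1: "m1 \<le> ennreal (g / l) * ?n2"
    unfolding m1_def grad_mu[OF fm f0] by (intro mult_left_mono j2) simp
  have m2: "m2 \<le> ennreal (g / l) * ?n2\<^sup>2"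
    unfolding m2_def using fm grad_mu[of "\<lambda>z. (f z)\<^sup>2"] mult_left_mono[OF j3, of "ennreal (g / l)"] by simp
  define d where "d i z = v t (x - z) $ i - v t x $ i" for i z
  have df: "\<bar>d i z\<bar> \<le> f z" for i z
    using component_le_norm_cart[of "v t (x - z) - v t x" i] by (simp add: d_def f_def)
  have pdg: "\<bar>pd j \<Phi> z\<bar> \<le> norm (grad \<Phi> z)" for j z
    using component_le_norm_cart[of "grad \<Phi> z" j] by (simp add: grad_def)
  \<comment> \<open>If \<open>h\<close> is not integrable, its integral is 0 by convention and the
    bound is trivial.\<close>
  have absint: "ennreal \<bar>\<integral>z. h z \<partial>lborel\<bar> \<le> (\<integral>\<^sup>+z. ennreal (k z) \<partial>lborel)" if "\<And>z. \<bar>h z\<bar> \<le> k z" for h k :: "real^3 \<Rightarrow> real"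
  proof -
    have "ennreal \<bar>\<integral>z. h z \<partial>lborel\<bar> \<le> (\<integral>\<^sup>+z. ennreal (norm (h z)) \<partial>lborel)"
      using integral_norm_bound_ennreal[of lborel h]
      by (cases "integrable lborel h") (simp_all add: not_integrable_integral_eq)
    also have "\<dots> \<le> (\<integral>\<^sup>+z. ennreal (k z) \<partial>lborel)" using that by (intro nn_integral_mono ennreal_leI) simp
    finally show ?thesis .
  qed
  have b1: "ennreal \<bar>\<integral>z. pd j \<Phi> z * (d i z * d j z) \<partial>lborel\<bar> \<le> m2" for i j
    unfolding m2_def
  proof (rule absint)
    fix z
    show "\<bar>pd j \<Phi> z * (d i z * d j z)\<bar> \<le> norm (grad \<Phi> z) * (f z)\<^sup>2"
      unfolding abs_mult power2_eq_square by (intro mult_mono pdg df) (auto simp: f0)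
  qed
  have b2: "ennreal \<bar>\<integral>z. pd j \<Phi> z * d i z \<partial>lborel\<bar> \<le> m1" for i j
    unfolding m1_def
  proof (rule absint)
    fix z
    show "\<bar>pd j \<Phi> z * d i z\<bar> \<le> norm (grad \<Phi> z) * f z"
      unfolding abs_mult by (intro mult_mono pdg df) (auto simp: f0)
  qed
  have b3: "ennreal \<bar>\<integral>z. \<Phi> z * d i z \<partial>lborel\<bar> \<le> a1" for i
    unfolding a1_def
  proof (rule absint)
    fix z
    show "\<bar>\<Phi> z * d i z\<bar> \<le> \<Phi> z * f z"
      unfolding abs_mult using P0[of z] df[of i z] by (simp add: mult_left_mono)
  qed
  have summand_bound: "ennreal \<bar>A - Bq * Cq - D * F\<bar> \<le> m2 + 2 * (m1 * a1)"
    if "ennreal \<bar>A\<bar> \<le> m2" "ennreal \<bar>Bq\<bar> \<le> m1" "ennreal \<bar>Cq\<bar> \<le> a1" "ennreal \<bar>D\<bar> \<le> a1" "ennreal \<bar>F\<bar> \<le> m1"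
    for A Bq Cq D F :: real
  proof -
    have "\<bar>A - Bq * Cq - D * F\<bar> \<le> \<bar>A\<bar> + \<bar>Bq\<bar> * \<bar>Cq\<bar> + \<bar>F\<bar> * \<bar>D\<bar>"
      unfolding abs_mult[symmetric] by (simp add: mult.commute)
    then have "ennreal \<bar>A - Bq * Cq - D * F\<bar> \<le> ennreal (\<bar>A\<bar> + \<bar>Bq\<bar> * \<bar>Cq\<bar> + \<bar>F\<bar> * \<bar>D\<bar>)" by (rule ennreal_leI)
    also have "\<dots> = ennreal \<bar>A\<bar> + ennreal \<bar>Bq\<bar> * ennreal \<bar>Cq\<bar> + ennreal \<bar>F\<bar> * ennreal \<bar>D\<bar>"
      by (simp add: ennreal_mult)
    also have "\<dots> \<le> m2 + m1 * a1 + m1 * a1"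
      by (intro add_mono mult_mono that) auto
    finally show ?thesis by (simp add: mult_2 add.assoc)
  qed
  have Vi: "ennreal \<bar>V t x $ i\<bar> \<le> 3 * (m2 + 2 * (m1 * a1))" for i
  proof -
    let ?s = "\<lambda>j. (\<integral>z. pd j \<Phi> z * (d i z * d j z) \<partial>lborel)
      - (\<integral>z. pd j \<Phi> z * d i z \<partial>lborel) * (\<integral>z. \<Phi> z * d j z \<partial>lborel)
      - (\<integral>z. \<Phi> z * d i z \<partial>lborel) * (\<integral>z. pd j \<Phi> z * d j z \<partial>lborel)"
    have "V t x $ i = (\<Sum>j\<in>UNIV. ?s j)" unfolding d_def by (rule V_increments[OF l])
    then have "ennreal \<bar>V t x $ i\<bar> \<le> ennreal (\<Sum>j\<in>UNIV. \<bar>?s j\<bar>)"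
      by (simp only:) (intro ennreal_leI sum_abs)
    also have "\<dots> = (\<Sum>j\<in>UNIV. ennreal \<bar>?s j\<bar>)" by (rule sum_ennreal[symmetric]) simp
    also have "\<dots> \<le> (\<Sum>j\<in>(UNIV::3 set). m2 + 2 * (m1 * a1))"
      by (intro sum_mono summand_bound b1 b2 b3)
    finally show ?thesis by simp
  qed
  \<comment> \<open>Three components, each a sum of three summands, give the factor 9; its square is
    the 81 of the statement.\<close>
  have "ennreal (norm (V t x)) \<le> ennreal (\<Sum>i\<in>UNIV. \<bar>V t x $ i\<bar>)"
    by (intro ennreal_leI norm_le_l1_cart)
  also have "\<dots> = (\<Sum>i\<in>UNIV. ennreal \<bar>V t x $ i\<bar>)" by (rule sum_ennreal[symmetric]) simp
  also have "\<dots> \<le> (\<Sum>i\<in>(UNIV::3 set). 3 * (m2 + 2 * (m1 * a1)))" by (intro sum_mono Vi)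
  also have "\<dots> = 9 * (m2 + 2 * (m1 * a1))" by (simp add: mult.assoc[symmetric])
  also have "\<dots> \<le> 9 * (ennreal (g / l) * ?n2\<^sup>2 + 2 * ((ennreal (g / l) * ?n2) * ?n1))"
    by (intro mult_left_mono add_mono mult_mono m1 m2 a1) auto
  \<comment> \<open>The product of the two norms occurs with coefficient 2, exactly as in the
    expanded square, so the sum fits without a further constant.\<close>
  also have "\<dots> \<le> 9 * (ennreal (g / l) * (?n1 + ?n2)\<^sup>2)"
  proof -
    have "(?n1 + ?n2)\<^sup>2 = ?n1\<^sup>2 + (?n2\<^sup>2 + 2 * (?n2 * ?n1))"
      by (simp add: power2_eq_square algebra_simps mult_2)
    then have "?n2\<^sup>2 + 2 * (?n2 * ?n1) \<le> (?n1 + ?n2)\<^sup>2" by simp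
    from mult_left_mono[OF this, of "ennreal (g / l)"]
    have "ennreal (g / l) * ?n2\<^sup>2 + 2 * ((ennreal (g / l) * ?n2) * ?n1) \<le> ennreal (g / l) * (?n1 + ?n2)\<^sup>2"
      by (simp add: distrib_left mult_ac)
    then show ?thesis by (rule mult_left_mono) simp
  qed
  finally have "ennreal (norm (V t x)) \<le> 9 * (ennreal (g / l) * (MM \<phi> l p v t x)\<^sup>2)" by (simp only: MM)
  then have "(ennreal (norm (V t x)))\<^sup>2 \<le> (9 * (ennreal (g / l) * (MM \<phi> l p v t x)\<^sup>2))\<^sup>2"
    by (intro power_mono) auto
  also have "\<dots> = (9 * ennreal (g / l))\<^sup>2 * MM \<phi> l p v t x ^ 4"
    by (simp add: power_mult_distrib power_mult[symmetric] mult_ac)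
  also have "9 * ennreal (g / l) = ennreal (9 * (g / l))"
    using ennreal_mult[of 9 "g / l"] g l by simp
  also have "(ennreal (9 * (g / l)))\<^sup>2 = ennreal (81 * g\<^sup>2 / l\<^sup>2)"
    using g l by (simp add: ennreal_power power_mult_distrib power_divide)
  finally show ?thesis by (simp add: ennreal_power g_def)
qed

end

section \<open>Estimates at one scale\<close>

lemma norm_cross3_le: "norm (cross3 a b) \<le> norm a * norm b"
proof -
  have "(norm (cross3 a b))\<^sup>2 \<le> (norm a * norm b)\<^sup>2"
    using norm_cross_dot[of a b] zero_le_power2[of "a \<bullet> b"] by linarith
  then show ?thesis by (rule power2_le_imp_le) simp
qed

text \<open>Each component of the curl is a difference of two off-diagonal derivatives, and squaring
  a difference costs the factor 2. The 1/2 in \<open>young_scaled\<close> offsets it later.\<close>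

lemma norm_curl_sq_le:
  assumes "\<And>i. smooth (\<lambda>y. W y $ i)"
  shows "(norm (curl W x))\<^sup>2 \<le> 2 * grad_sq W x"
proof -
  have "(a - b)\<^sup>2 \<le> 2 * (a\<^sup>2 + b\<^sup>2)" for a b :: real
    using zero_le_power2[of "a + b"] by (simp add: power2_sum power2_diff)
  note * = this[of "pd 2 (\<lambda>y. W y $ 3) x" "pd 3 (\<lambda>y. W y $ 2) x"]
    this[of "pd 3 (\<lambda>y. W y $ 1) x" "pd 1 (\<lambda>y. W y $ 3) x"] this[of "pd 1 (\<lambda>y. W y $ 2) x" "pd 2 (\<lambda>y. W y $ 1) x"]
  have sq: "0 \<le> (pd 1 (\<lambda>y. W y $ 1) x)\<^sup>2" "0 \<le> (pd 2 (\<lambda>y. W y $ 2) x)\<^sup>2" "0 \<le> (pd 3 (\<lambda>y. W y $ 3) x)\<^sup>2"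
    by simp_all
  have "(norm (curl W x))\<^sup>2 = (pd 2 (\<lambda>y. W y $ 3) x - pd 3 (\<lambda>y. W y $ 2) x)\<^sup>2
    + (pd 3 (\<lambda>y. W y $ 1) x - pd 1 (\<lambda>y. W y $ 3) x)\<^sup>2 + (pd 1 (\<lambda>y. W y $ 2) x - pd 2 (\<lambda>y. W y $ 1) x)\<^sup>2"
    unfolding norm_sq_vec sum_3 curl_nth by (simp add: power2_eq_square)
  also have "\<dots> \<le> 2 * ((pd 2 (\<lambda>y. W y $ 3) x)\<^sup>2 + (pd 3 (\<lambda>y. W y $ 2) x)\<^sup>2)
    + 2 * ((pd 3 (\<lambda>y. W y $ 1) x)\<^sup>2 + (pd 1 (\<lambda>y. W y $ 3) x)\<^sup>2)
    + 2 * ((pd 1 (\<lambda>y. W y $ 2) x)\<^sup>2 + (pd 2 (\<lambda>y. W y $ 1) x)\<^sup>2)"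
    by (intro add_mono *)
  also have "\<dots> \<le> 2 * grad_sq W x"
    using sq unfolding grad_sq_eq[OF assms] sum_3 by simp
  finally show ?thesis .
qed

lemma young_scaled:
  fixes a b \<eta> :: real
  assumes "0 < \<eta>" shows "a * b \<le> \<eta> / 2 * a\<^sup>2 + b\<^sup>2 / (2 * \<eta>)"
proof -
  have "0 \<le> (\<eta> * a - b)\<^sup>2 / (2 * \<eta>)" using assms by simp
  then show ?thesis using assms by (simp add: field_simps power2_eq_square)
qed

context cutoff_flow
begin

lemma bounded_meas_set_integrable:
  assumes "bounded_meas f" "compact A"
  shows "set_integrable lborel A (\<lambda>(t, x). f t x)"
proof -
  obtain B where B: "\<And>t x. \<bar>f t x\<bar> \<le> B" using bounded_meas_bound[OF assms(1)] by blast
  show ?thesis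
    using set_integrable_continuous_bounded[OF assms(2) continuous_on_const[of _ 1] bounded_meas_joint[OF assms(1)] B]
    by (simp add: split_beta')
qed

text \<open>The stretching is cubic in the gradient of \<open>U\<close>: nine terms, each a
  derivative times two vorticity components of size at most \<open>2 * D\<close>.\<close>

lemma stretch_bound:
  assumes "\<And>i j. \<bar>pd j (\<lambda>y. U t y $ i) x\<bar> \<le> D"
  shows "\<bar>stretch t x\<bar> \<le> 36 * D ^ 3"
proof -
  have D0: "0 \<le> D" using assms[of 1 1] by linarith
  have Om: "\<bar>Om t x $ i\<bar> \<le> 2 * D" for i
  proof -
    have "\<bar>a - b\<bar> \<le> 2 * D" if "\<bar>a\<bar> \<le> D" "\<bar>b\<bar> \<le> D" for a b using that by linarith
    moreover have "i = 1 \<or> i = 2 \<or> i = 3" by (rule exhaust_3)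
    ultimately show ?thesis using assms by (elim disjE) (simp_all add: Omfil_def curl_nth)
  qed
  have "\<bar>stretch t x\<bar> \<le> (\<Sum>i\<in>(UNIV::3 set). \<Sum>j\<in>(UNIV::3 set). 2 * D * (2 * D) * D)"
    unfolding stretch_def
  proof (intro order_trans[OF sum_abs] sum_mono)
    fix i j :: 3
    show "\<bar>Om t x $ i * Om t x $ j * pd j (\<lambda>y. U t y $ i) x\<bar> \<le> 2 * D * (2 * D) * D"
      unfolding abs_mult by (intro mult_mono Om assms) (use D0 in auto)
  qed
  also have "\<dots> = 36 * D ^ 3" by (simp add: power3_eq_cube)
  finally show ?thesis .
qed

text \<open>The gradient bound will come from an essential supremum in time, so it holds only for
  almost every \<open>t\<close>; integrating in space first makes this enough.\<close>

lemma stretch_integral_bound: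
  assumes G1: "\<And>t x. t \<in> {s0..s1} \<Longrightarrow> 0 \<le> X t x \<and> X t x \<le> 1"
    and D: "AE t in lborel. t \<in> {s0..s1} \<longrightarrow> (\<forall>x i j. \<bar>pd j (\<lambda>y. U t y $ i) x\<bar> \<le> D)" and D0: "0 \<le> D"
  shows "(LINT (t, x):S|lborel. X t x * stretch t x) \<le> 36 * D ^ 3 * ((s1 - s0) * measure lborel C)"
proof -
  let ?c = "36 * D ^ 3"
  have int: "set_integrable lborel S (\<lambda>p. X (fst p) (snd p) * stretch (fst p) (snd p))"
    using set_integrable_X[OF bounded_meas_stretch] by (simp add: split_beta')
  have inC: "integrable lborel (indicat_real C)"
    using borel_integrable_compact[OF C_compact continuous_on_const[of C "1::real"]] by simp
  have Cm: "C \<in> sets lborel" using borel_compact[OF C_compact] by simp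
  have inner: "(LINT x:C|lborel. X t x * stretch t x) \<le> ?c * measure lborel C"
    if t: "t \<in> {s0..s1}" and b: "\<forall>x i j. \<bar>pd j (\<lambda>y. U t y $ i) x\<bar> \<le> D" for t
  proof -
    obtain Bd where B: "\<And>t x. \<bar>stretch t x\<bar> \<le> Bd" using bounded_meas_bound[OF bounded_meas_stretch] by blast
    have "(LINT x:C|lborel. X t x * stretch t x) \<le> (LINT x:C|lborel. ?c)"
    proof (rule set_integral_mono)
      show "set_integrable lborel C (\<lambda>x. X t x * stretch t x)"
        by (rule set_integrable_continuous_bounded[OF C_compact smooth_continuous[OF smooth_space_slice[OF G_smooth]]
              bounded_meas_slice(1)[OF bounded_meas_stretch] B])
      show "set_integrable lborel C (\<lambda>x. ?c)" using inC by (simp add: set_integrable_def)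
      fix x
      have "X t x * stretch t x \<le> 1 * \<bar>stretch t x\<bar>"
        using G1[OF t, of x] mult_left_mono[OF abs_ge_self[of "stretch t x"], of "X t x"]
          mult_right_mono[of "X t x" 1 "\<bar>stretch t x\<bar>"] by linarith
      then show "X t x * stretch t x \<le> ?c" using stretch_bound[of t x D] b by simp
    qed
    also have "\<dots> = ?c * measure lborel C" using Cm by (simp add: set_lebesgue_integral_def)
    finally show ?thesis .
  qed
  have "(LINT (t, x):S|lborel. X t x * stretch t x) = (LINT t:{s0..s1}|lborel. (LINT x:C|lborel. X t x * stretch t x))"
    using integrable_S_slice(1)[OF int] by (simp add: split_beta')
  also have "\<dots> \<le> (LINT t:{s0..s1}|lborel. ?c * measure lborel C)"
    unfolding set_lebesgue_integral_def[of lborel "{s0..s1}"]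
  proof (rule integral_mono_AE)
    have "integrable (lborel \<Otimes>\<^sub>M lborel) (\<lambda>p. indicator S p *\<^sub>R (X (fst p) (snd p) * stretch (fst p) (snd p)))"
      using int unfolding set_integrable_def lborel_prod .
    from lborel_pair.integrable_fst'[OF this]
    show "integrable lborel (\<lambda>t. indicator {s0..s1} t *\<^sub>R (LINT x:C|lborel. X t x * stretch t x))"
    proof (rule Bochner_Integration.integrable_cong[THEN iffD1, OF refl, rotated])
      fix t
      show "(\<integral>x. indicator S (t, x) *\<^sub>R (X (fst (t, x)) (snd (t, x)) * stretch (fst (t, x)) (snd (t, x))) \<partial>lborel)
          = indicator {s0..s1} t *\<^sub>R (LINT x:C|lborel. X t x * stretch t x)"
        by (cases "t \<in> {s0..s1}") (simp_all add: set_lebesgue_integral_def indicator_times)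
    qed
    show "integrable lborel (\<lambda>t. indicat_real {s0..s1} t *\<^sub>R (?c * measure lborel C))"
      by (intro integrable_scaleR_left integrable_real_indicator) (auto simp: emeasure_lborel_Icc_eq)
    show "AE t in lborel. indicat_real {s0..s1} t *\<^sub>R (LINT x:C|lborel. X t x * stretch t x)
        \<le> indicat_real {s0..s1} t *\<^sub>R (?c * measure lborel C)"
      using D
    proof (rule eventually_mono)
      fix t
      assume *: "t \<in> {s0..s1} \<longrightarrow> (\<forall>x i j. \<bar>pd j (\<lambda>y. U t y $ i) x\<bar> \<le> D)"
      show "indicat_real {s0..s1} t *\<^sub>R (LINT x:C|lborel. X t x * stretch t x)
        \<le> indicat_real {s0..s1} t *\<^sub>R (?c * measure lborel C)"
      proof (cases "t \<in> {s0..s1}")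
        case True
        then show ?thesis using inner[OF True] * by simp
      qed simp
    qed
  qed
  also have "\<dots> = ?c * ((s1 - s0) * measure lborel C)"
    using s01 by (simp add: set_lebesgue_integral_def)
  finally show ?thesis .
qed

text \<open>\<open>A\<close> abstracts the support of the cutoff gradient: any Borel subset of
  \<open>S\<close> containing the points where that gradient is nonzero. The two commutator terms of
  the balance are split by Young's inequality, with weight \<open>\<eta>\<close> in the interior and
  \<open>1 / r\<close> on \<open>A\<close>.\<close>

lemma enstrophy_inequality:
  assumes G1: "\<And>t x. t \<in> {s0..s1} \<Longrightarrow> 0 \<le> X t x \<and> X t x \<le> 1"
    and D: "AE t in lborel. t \<in> {s0..s1} \<longrightarrow> (\<forall>x i j. \<bar>pd j (\<lambda>y. U t y $ i) x\<bar> \<le> D)" and D0: "0 \<le> D"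
    and r: "0 < r" and \<eta>: "0 < \<eta>" and K: "0 \<le> K"
    and grad_X: "\<And>t x. t \<in> {s0..s1} \<Longrightarrow> norm (grad (X t) x) \<le> K / r"
    and A: "A \<in> sets borel" "A \<subseteq> S" "\<And>t x. t \<in> {s0..s1} \<Longrightarrow> grad (X t) x \<noteq> 0 \<Longrightarrow> (t, x) \<in> A"
  shows "(\<integral>x. X s1 x * (norm (Om s1 x))\<^sup>2 \<partial>lborel) / 2 - (\<integral>x. X s0 x * (norm (Om s0 x))\<^sup>2 \<partial>lborel) / 2
      + (1 - \<eta>) * (LINT (t, x):S|lborel. X t x * grad_sq (Om t) x)
   \<le> (LINT (t, x):S|lborel. (norm (Om t x))\<^sup>2 * (sdt G (t, x) + lapl (X t) x + U t x \<bullet> grad (X t) x)) / 2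
     + 36 * D ^ 3 * ((s1 - s0) * measure lborel C)
     + (LINT (t, x):S|lborel. X t x * (norm (V t x))\<^sup>2) / (2 * \<eta>)
     + K / 2 * ((LINT (t, x):A|lborel. (norm (Om t x))\<^sup>2) / r\<^sup>2 + (LINT (t, x):A|lborel. (norm (V t x))\<^sup>2))"
proof -
  let ?g = "\<lambda>(t, x). X t x * grad_sq (Om t) x" and ?w = "\<lambda>(t, x). X t x * (norm (V t x))\<^sup>2"
  let ?c = "\<lambda>(t, x). X t x * (curl (Om t) x \<bullet> V t x)"
  have ig: "set_integrable lborel S ?g" by (rule set_integrable_X[OF bounded_meas_grad_sq])
  have iw: "set_integrable lborel S ?w" by (rule set_integrable_X[OF bounded_meas_norm_V])
  have ic: "set_integrable lborel S ?c" by (rule set_integrable_X[OF bounded_meas_curl_V])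
  have ig': "set_integrable lborel S (\<lambda>p. \<eta> * ?g p)" and iw': "set_integrable lborel S (\<lambda>p. 1 / (2 * \<eta>) * ?w p)"
    using ig iw by (auto intro: set_integrable_mult_right)
  have neg: "(LINT p:A|lborel. (-1) * h p) = - (LINT p:A|lborel. h p)" for h :: "real \<times> (real^3) \<Rightarrow> real" and A
    unfolding set_lebesgue_integral_def by simp
  have cm: "(LINT p:A|lborel. c * h p) = c * (LINT p:A|lborel. h p)" for h :: "real \<times> (real^3) \<Rightarrow> real" and A c
    by (rule set_integral_mult_right)
  have "(LINT p:S|lborel. (-1) * ?c p) \<le> (LINT p:S|lborel. \<eta> * ?g p + 1 / (2 * \<eta>) * ?w p)"
  proof (rule set_integral_mono)
    show "set_integrable lborel S (\<lambda>p. (-1) * ?c p)" using ic by (intro set_integrable_mult_right)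
    show "set_integrable lborel S (\<lambda>p. \<eta> * ?g p + 1 / (2 * \<eta>) * ?w p)"
      by (rule set_integral_add(1)[OF ig' iw'])
    fix p assume p: "p \<in> S"
    obtain t x where tx: "p = (t, x)" by (cases p)
    have "- (curl (Om t) x \<bullet> V t x) \<le> norm (curl (Om t) x) * norm (V t x)"
      using Cauchy_Schwarz_ineq2[of "curl (Om t) x" "V t x"] by linarith
    also have "\<dots> \<le> \<eta> / 2 * (norm (curl (Om t) x))\<^sup>2 + (norm (V t x))\<^sup>2 / (2 * \<eta>)"
      by (rule young_scaled[OF \<eta>])
    \<comment> \<open>The factor 2 of the curl bound turns \<open>\<eta> / 2\<close> into
      \<open>\<eta>\<close>, so a fraction \<open>\<eta>\<close> of the diffusion is spent.\<close>
    also have "\<dots> \<le> \<eta> * grad_sq (Om t) x + (norm (V t x))\<^sup>2 / (2 * \<eta>)"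
      using mult_left_mono[OF norm_curl_sq_le[OF smooth_Om, of t x], of "\<eta> / 2"] \<eta> by simp
    finally have "X t x * - (curl (Om t) x \<bullet> V t x) \<le> X t x * (\<eta> * grad_sq (Om t) x + (norm (V t x))\<^sup>2 / (2 * \<eta>))"
      using G1[of t x] p tx by (intro mult_left_mono) auto
    then show "(-1) * ?c p \<le> \<eta> * ?g p + 1 / (2 * \<eta>) * ?w p"
      unfolding tx by (simp add: algebra_simps)
  qed
  also have "\<dots> = \<eta> * (LINT p:S|lborel. ?g p) + (LINT p:S|lborel. ?w p) / (2 * \<eta>)"
    by (subst set_integral_add(2)[OF ig' iw'], unfold cm) simp
  finally have commutator: "- (LINT p:S|lborel. ?c p) \<le> \<eta> * (LINT p:S|lborel. ?g p) + (LINT p:S|lborel. ?w p) / (2 * \<eta>)"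
    unfolding neg .
  let ?N = "\<lambda>(t, x). (norm (Om t x))\<^sup>2" and ?V = "\<lambda>(t, x). (norm (V t x))\<^sup>2"
  let ?x = "\<lambda>(t, x). grad (X t) x \<bullet> cross3 (Om t x) (V t x)"
  have Scomp: "compact S" using C_compact by (intro compact_Times) auto
  have Am: "A \<in> sets lborel" using A(1) by simp
  have iN: "set_integrable lborel A ?N" and iV: "set_integrable lborel A ?V"
    by (rule set_integrable_subset[OF bounded_meas_set_integrable[OF bounded_meas_norm_Om Scomp] Am A(2)],
        rule set_integrable_subset[OF bounded_meas_set_integrable[OF bounded_meas_norm_V Scomp] Am A(2)])
  have ix: "set_integrable lborel S ?x" by (rule set_integrable_grad_cross)
  have ixA: "set_integrable lborel A ?x" by (rule set_integrable_subset[OF ix Am A(2)])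
  have iN': "set_integrable lborel A (\<lambda>p. K / (2 * r\<^sup>2) * ?N p)" and iV': "set_integrable lborel A (\<lambda>p. K / 2 * ?V p)"
    using iN iV by (auto intro: set_integrable_mult_right)
  have "(LINT p:S|lborel. ?x p) = (LINT p:A|lborel. ?x p)"
    unfolding set_lebesgue_integral_def
  proof (rule Bochner_Integration.integral_cong[OF refl])
    fix p :: "real \<times> (real^3)"
    obtain t x where tx: "p = (t, x)" by (cases p)
    show "indicat_real S p *\<^sub>R ?x p = indicat_real A p *\<^sub>R ?x p"
    proof (cases "p \<in> A")
      case True
      then have "p \<in> S" using A(2) by blast
      with True show ?thesis by simp
    next
      case False
      show ?thesis
      proof (cases "p \<in> S")
        case True
        then have "grad (X t) x = 0" using A(3)[of t x] False tx by auto
        then show ?thesis by (simp add: tx)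
      qed (use False in simp)
    qed
  qed
  moreover have "(LINT p:A|lborel. (-1) * ?x p) \<le> (LINT p:A|lborel. K / (2 * r\<^sup>2) * ?N p + K / 2 * ?V p)"
  proof (rule set_integral_mono)
    show "set_integrable lborel A (\<lambda>p. (-1) * ?x p)" using ixA by (intro set_integrable_mult_right)
    show "set_integrable lborel A (\<lambda>p. K / (2 * r\<^sup>2) * ?N p + K / 2 * ?V p)"
      by (rule set_integral_add(1)[OF iN' iV'])
    fix p assume p: "p \<in> A"
    obtain t x where tx: "p = (t, x)" by (cases p)
    have t: "t \<in> {s0..s1}" using A(2) p tx by auto
    have "- (grad (X t) x \<bullet> cross3 (Om t x) (V t x)) \<le> norm (grad (X t) x) * norm (cross3 (Om t x) (V t x))"
      using Cauchy_Schwarz_ineq2[of "grad (X t) x" "cross3 (Om t x) (V t x)"] by linarith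
    also have "\<dots> \<le> (K / r) * (norm (Om t x) * norm (V t x))"
      using K r by (intro mult_mono grad_X[OF t] norm_cross3_le) auto
    \<comment> \<open>The weight \<open>1 / r\<close> balances the factor \<open>K / r\<close>:
      vorticity gets \<open>r\<^sup>2\<close> in the denominator and the stress a coefficient free
      of \<open>r\<close>. Multiplied by \<open>r\<close>, these are the two weights in
      \<open>Lcom\<close>.\<close>
    also have "\<dots> \<le> (K / r) * ((1 / r) / 2 * (norm (Om t x))\<^sup>2 + (norm (V t x))\<^sup>2 / (2 * (1 / r)))"
      using K r by (intro mult_left_mono young_scaled) auto
    also have "\<dots> = K / (2 * r\<^sup>2) * (norm (Om t x))\<^sup>2 + K / 2 * (norm (V t x))\<^sup>2"
      using r by (simp add: field_simps power2_eq_square)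
    finally show "(-1) * ?x p \<le> K / (2 * r\<^sup>2) * ?N p + K / 2 * ?V p" unfolding tx by simp
  qed
  moreover have "(LINT p:A|lborel. K / (2 * r\<^sup>2) * ?N p + K / 2 * ?V p)
      = K / 2 * ((LINT p:A|lborel. ?N p) / r\<^sup>2 + (LINT p:A|lborel. ?V p))"
    by (subst set_integral_add(2)[OF iN' iV'], unfold cm) (simp add: field_simps)
  ultimately have shell: "- (LINT p:S|lborel. ?x p) \<le> K / 2 * ((LINT p:A|lborel. ?N p) / r\<^sup>2 + (LINT p:A|lborel. ?V p))"
    unfolding neg by (simp only:)
  have stretching: "(LINT (t, x):S|lborel. X t x * stretch t x) \<le> 36 * D ^ 3 * ((s1 - s0) * measure lborel C)"
    by (rule stretch_integral_bound[OF _ D D0]) (rule G1)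
  show ?thesis
    unfolding enstrophy_balance left_diff_distrib[of 1 \<eta>] mult_1
    using commutator shell stretching by linarith
qed

end

section \<open>The quantities of the statement at one scale\<close>

lemma stint_cong:
  assumes "\<And>t x. (t, x) \<in> A \<Longrightarrow> f t x = f' t x" shows "stint A f = stint A f'"
  unfolding set_lebesgue_integral_def
proof (rule Bochner_Integration.integral_cong[OF refl])
  fix p show "indicat_real A p *\<^sub>R (case p of (t, x) \<Rightarrow> f t x) = indicat_real A p *\<^sub>R (case p of (t, x) \<Rightarrow> f' t x)"
    using assms by (cases p) (simp add: indicator_def)
qed

lemma stint_nonneg:
  assumes "\<And>t x. (t, x) \<in> A \<Longrightarrow> 0 \<le> f t x" shows "0 \<le> stint A f"
  unfolding set_lebesgue_integral_def
proof (rule Bochner_Integration.integral_nonneg)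
  fix p show "0 \<le> indicat_real A p *\<^sub>R (case p of (t, x) \<Rightarrow> f t x)"
    using assms by (cases p) (simp add: indicator_def)
qed

text \<open>\<open>u\<close> and \<open>chi\<close> are the data of the statement; \<open>v\<close>
  and \<open>g\<close> are surrogates defined at all times that agree with them at the times where
  the scale-wise quantities are evaluated. The bound \<open>r \<le> 1\<close> keeps the slab within
  the unit of time before \<open>t0\<close>.\<close>

locale scale_setup = flow +
  fixes \<phi> :: "real^3 \<Rightarrow> real" and \<tau>0 \<tau>1 :: real and chi :: "real \<Rightarrow> real^3 \<Rightarrow> real"
    and g :: "real \<times> (real^3) \<Rightarrow> real" and x0 :: "real^3" and r l :: real and u :: "real \<Rightarrow> real^3 \<Rightarrow> real^3"
  assumes kernel': "filter_kernel \<phi>" and tau: "-1 < \<tau>0" "\<tau>0 < \<tau>1" "\<tau>1 < 0"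
    and g_smooth: "smooth g" and chi_g: "\<tau> \<in> {\<tau>0..\<tau>1} \<Longrightarrow> chi \<tau> y = g (\<tau>, y)"
    and chi_range: "\<tau> \<in> {\<tau>0..\<tau>1} \<Longrightarrow> 0 \<le> chi \<tau> y \<and> chi \<tau> y \<le> 1"
    and chi_supp: "\<tau> \<in> {\<tau>0..\<tau>1} \<Longrightarrow> 1 < norm y \<Longrightarrow> chi \<tau> y = 0"
    and r: "0 < r" "r \<le> 1" and l: "0 < l"
    and u_v: "t \<in> {t0 - 1..t0} \<Longrightarrow> u t = v t"
begin

definition G0 :: "real \<times> (real^3) \<Rightarrow> real" where
  "G0 p = g ((fst p - t0) / r\<^sup>2, (snd p - x0) /\<^sub>R r)"

lemma rescaled_time: "t \<in> {t0 + \<tau>0 * r\<^sup>2..t0 + \<tau>1 * r\<^sup>2} \<longleftrightarrow> (t - t0) / r\<^sup>2 \<in> {\<tau>0..\<tau>1}"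
  using r by (auto simp: field_simps)

lemma G0_smooth: "smooth G0"
proof -
  have L: "bounded_linear (\<lambda>p::real \<times> (real^3). (fst p / r\<^sup>2, snd p /\<^sub>R r))"
    by (intro bounded_linear_Pair bounded_linear_compose[OF bounded_linear_divide bounded_linear_fst]
        bounded_linear_compose[OF bounded_linear_scaleR_right bounded_linear_snd])
  have "G0 = (\<lambda>p. g ((- t0 / r\<^sup>2, - x0 /\<^sub>R r) + (fst p / r\<^sup>2, snd p /\<^sub>R r)))"
    unfolding G0_def[abs_def] by (auto simp: fun_eq_iff diff_divide_distrib algebra_simps)
  then show ?thesis using smooth_affine[OF L g_smooth, of "(- t0 / r\<^sup>2, - x0 /\<^sub>R r)"] by (simp only:)
qed

lemma G0_cutk: "t \<in> {t0 + \<tau>0 * r\<^sup>2..t0 + \<tau>1 * r\<^sup>2} \<Longrightarrow> cutk chi x0 t0 r t x = G0 (t, x)"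
  unfolding rescaled_time by (simp add: cutk_def G0_def chi_g)

lemma G0_zero: "t \<in> {t0 + \<tau>0 * r\<^sup>2..t0 + \<tau>1 * r\<^sup>2} \<Longrightarrow> x \<notin> cball x0 r \<Longrightarrow> G0 (t, x) = 0"
proof -
  assume t: "t \<in> {t0 + \<tau>0 * r\<^sup>2..t0 + \<tau>1 * r\<^sup>2}" and x: "x \<notin> cball x0 r"
  have "norm ((x - x0) /\<^sub>R r) = norm (x - x0) / r" using r by (simp add: divide_inverse mult.commute)
  moreover have "1 < norm (x - x0) / r" using x r by (simp add: dist_norm norm_minus_commute)
  ultimately have "1 < norm ((x - x0) /\<^sub>R r)" by simp
  then show ?thesis using chi_supp[of "(t - t0) / r\<^sup>2"] t G0_cutk[OF t, of x]
    unfolding rescaled_time by (simp add: cutk_def)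
qed

end

sublocale scale_setup \<subseteq> cutoff_flow v t0 B \<phi> l G0 "t0 + \<tau>0 * r\<^sup>2" "t0 + \<tau>1 * r\<^sup>2" "cball x0 r"
proof unfold_locales
  show "filter_kernel \<phi>" by (rule kernel')
  show "test_fun UNIV (scaled \<phi> l)"
    using kernel' by (intro test_fun_scaled[OF _ l, of "ball 0 1"]) (simp add: filter_kernel_def)
  show "smooth G0" by (rule G0_smooth)
  have "r\<^sup>2 \<le> 1" "0 < r\<^sup>2" using r by (auto simp: power_le_one)
  \<comment> \<open>Strictness matters: the vorticity equation is available between interior
    times.\<close>
  have "- r\<^sup>2 < \<tau>0 * r\<^sup>2" using mult_strict_right_mono[OF tau(1) \<open>0 < r\<^sup>2\<close>] by simp
  then show "t0 - 1 < t0 + \<tau>0 * r\<^sup>2" using \<open>r\<^sup>2 \<le> 1\<close> by linarith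
  show "t0 + \<tau>0 * r\<^sup>2 < t0 + \<tau>1 * r\<^sup>2" using tau(2) \<open>0 < r\<^sup>2\<close> by simp
  show "t0 + \<tau>1 * r\<^sup>2 < t0" using tau(3) \<open>0 < r\<^sup>2\<close> by (simp add: mult_neg_pos)
qed (use G0_zero in auto)

context scale_setup
begin

abbreviation "s_in \<equiv> t0 + \<tau>0 * r\<^sup>2"
abbreviation "s_out \<equiv> t0 + \<tau>1 * r\<^sup>2"
abbreviation "cutx \<equiv> cutk chi x0 t0 r"

lemma slab_eq: "slab \<tau>0 \<tau>1 t0 r = {s_in..s_out}"
  by (simp add: slab_def)

lemma cut_eq: "t \<in> {s_in..s_out} \<Longrightarrow> cutx t = X t"
  by (rule ext) (rule G0_cutk)

lemma slab_time: "t \<in> {s_in..s_out} \<Longrightarrow> t \<in> {t0 - 1..t0}"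
  using s0 s1 by auto

lemma filtered_u:
  assumes "t \<in> {s_in..s_out}"
  shows "Ufil \<phi> l u t = U t" "Omfil \<phi> l u t = Om t" "Rfil \<phi> l u t = R t" "MM \<phi> l p u t = MM \<phi> l p v t"
  unfolding Ufil_def Omfil_def Rfil_def[abs_def] MM_def[abs_def] u_v[OF slab_time[OF assms]]
  by (rule refl)+

lemma cut_range: "t \<in> {s_in..s_out} \<Longrightarrow> 0 \<le> X t x \<and> X t x \<le> 1"
  using chi_range[of "(t - t0) / r\<^sup>2" "(x - x0) /\<^sub>R r"] G0_cutk[of t x]
  unfolding rescaled_time by (simp add: cutk_def)

lemma stint_slab:
  assumes "\<And>t x. t \<in> {s_in..s_out} \<Longrightarrow> x \<in> cball x0 r \<Longrightarrow> f t x = f' t x"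
    and "\<And>t x. t \<in> {s_in..s_out} \<Longrightarrow> x \<notin> cball x0 r \<Longrightarrow> f t x = 0"
  shows "stint (slab \<tau>0 \<tau>1 t0 r \<times> UNIV) f = stint S f'"
  unfolding set_lebesgue_integral_def slab_eq
proof (rule Bochner_Integration.integral_cong[OF refl])
  fix p :: "real \<times> (real^3)"
  obtain t x where p: "p = (t, x)" by (cases p)
  show "indicat_real ({s_in..s_out} \<times> UNIV) p *\<^sub>R (case p of (t, x) \<Rightarrow> f t x)
      = indicat_real S p *\<^sub>R (case p of (t, x) \<Rightarrow> f' t x)"
    unfolding p using assms[of t x]
    by (cases "t \<in> {s_in..s_out}"; cases "x \<in> cball x0 r") (simp_all add: indicator_times)
qed

lemma slab_ends: "s_in \<in> {s_in..s_out}" "s_out \<in> {s_in..s_out}"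
  using s01 by auto

lemma Ein_eq: "Ein \<phi> \<tau>0 chi x0 t0 u r l = r * ((\<integral>x. X s_in x * (norm (Om s_in x))\<^sup>2 \<partial>lborel) / 2)"
  using cut_eq[OF slab_ends(1)] filtered_u(2)[OF slab_ends(1)] by (simp add: Ein_def Eom_def)

lemma Eout_eq: "Eout \<phi> \<tau>1 chi x0 t0 u r l = r * ((\<integral>x. X s_out x * (norm (Om s_out x))\<^sup>2 \<partial>lborel) / 2)"
  using cut_eq[OF slab_ends(2)] filtered_u(2)[OF slab_ends(2)] by (simp add: Eout_def Eom_def)

lemma Pdiff_eq: "Pdiff \<phi> \<tau>0 \<tau>1 chi x0 t0 u r l = r * stint S (\<lambda>t x. X t x * grad_sq (Om t) x)"
proof -
  have "stint (slab \<tau>0 \<tau>1 t0 r \<times> UNIV) (\<lambda>t x. cutx t x * grad_sq (Omfil \<phi> l u t) x)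
      = stint S (\<lambda>t x. X t x * grad_sq (Om t) x)"
  proof (rule stint_slab)
    show "cutx t x * grad_sq (Omfil \<phi> l u t) x = X t x * grad_sq (Om t) x"
      if "t \<in> {s_in..s_out}" "x \<in> cball x0 r" for t x
      by (simp only: G0_cutk[OF that(1)] filtered_u(2)[OF that(1)])
    show "cutx t x * grad_sq (Omfil \<phi> l u t) x = 0" if "t \<in> {s_in..s_out}" "x \<notin> cball x0 r" for t x
      by (simp only: G0_cutk[OF that(1)] G0_zero[OF that] mult_zero_left)
  qed
  then show ?thesis by (simp add: Pdiff_def)
qed

lemma cutoff_residual_eq: "cutoff_residual \<phi> \<tau>0 \<tau>1 chi x0 t0 u r l
    = r * (stint S (\<lambda>t x. (norm (Om t x))\<^sup>2 * (sdt G0 (t, x) + lapl (X t) x + U t x \<bullet> grad (X t) x)) / 2)"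
proof -
  \<comment> \<open>The statement differentiates the cutoff within the slab, while
    \<open>sdt\<close> is the two-sided derivative of the smooth extension; on a nondegenerate
    interval the two agree.\<close>
  have vd: "vector_derivative (\<lambda>s. cutx s x) (at t within {s_in..s_out}) = sdt G0 (t, x)"
    if t: "t \<in> {s_in..s_out}" for t x
  proof (rule vector_derivative_within_closed_interval[OF s01 t])
    have "((\<lambda>t. G0 (t, x)) has_vector_derivative sdt G0 (t, x)) (at t within {s_in..s_out})"
      using has_derivative_time_slice[OF G0_smooth, of x t]
      by (simp add: has_real_derivative_iff_has_vector_derivative has_vector_derivative_at_within)
    then show "((\<lambda>s. cutx s x) has_vector_derivative sdt G0 (t, x)) (at t within {s_in..s_out})"
      by (rule has_vector_derivative_transform[OF t, rotated]) (rule G0_cutk)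
  qed
  have "stint (slab \<tau>0 \<tau>1 t0 r \<times> UNIV) (\<lambda>t x. (norm (Omfil \<phi> l u t x))\<^sup>2 *
          (vector_derivative (\<lambda>s. cutx s x) (at t within slab \<tau>0 \<tau>1 t0 r)
           + lapl (cutx t) x + Ufil \<phi> l u t x \<bullet> grad (cutx t) x))
      = stint S (\<lambda>t x. (norm (Om t x))\<^sup>2 * (sdt G0 (t, x) + lapl (X t) x + U t x \<bullet> grad (X t) x))"
  proof (rule stint_slab)
    fix t x assume t: "t \<in> {s_in..s_out}"
    show eq: "(norm (Omfil \<phi> l u t x))\<^sup>2 * (vector_derivative (\<lambda>s. cutx s x) (at t within slab \<tau>0 \<tau>1 t0 r)
           + lapl (cutx t) x + Ufil \<phi> l u t x \<bullet> grad (cutx t) x)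
        = (norm (Om t x))\<^sup>2 * (sdt G0 (t, x) + lapl (X t) x + U t x \<bullet> grad (X t) x)"
      unfolding slab_eq vd[OF t] cut_eq[OF t] filtered_u(1,2)[OF t] ..
    assume "x \<notin> cball x0 r"
    then show "(norm (Omfil \<phi> l u t x))\<^sup>2 * (vector_derivative (\<lambda>s. cutx s x) (at t within slab \<tau>0 \<tau>1 t0 r)
           + lapl (cutx t) x + Ufil \<phi> l u t x \<bullet> grad (cutx t) x) = 0"
      unfolding slab_eq vd[OF t] cut_eq[OF t] filtered_u(1,2)[OF t] using X_deriv_zero[OF t] by simp
  qed
  then show ?thesis by (simp add: cutoff_residual_def)
qed

text \<open>The cutoff is at most one and lives in the closed ball of radius \<open>r\<close>, which
  lies inside the larger open ball. Hence the budget dominates the sum of its other entries.\<close>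

lemma annular_cost_nonneg:
  assumes "0 < \<rho>"
  shows "0 \<le> annular_cost \<phi> \<tau>0 \<tau>1 chi \<rho> x0 t0 u r l"
proof -
  let ?b = "ball x0 ((1 + \<rho>) * r)"
  have "r < (1 + \<rho>) * r" using assms r by (simp add: algebra_simps)
  then have sub: "cball x0 r \<subseteq> ?b" by auto
  have A: "{s_in..s_out} \<times> ?b \<in> sets borel" by (intro borel_Times) auto
  have "compact ({s_in..s_out} \<times> cball x0 ((1 + \<rho>) * r))" by (intro compact_Times) auto
  from bounded_meas_set_integrable[OF bounded_meas_grad_sq this]
  have int: "set_integrable lborel ({s_in..s_out} \<times> ?b) (\<lambda>(t, x). grad_sq (Om t) x)"
    by (rule set_integrable_subset) (use A ball_subset_cball in auto)
  have gs: "0 \<le> grad_sq (Om t) x" for t x by (simp add: grad_sq_def sum_nonneg)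
  have "stint S (\<lambda>t x. X t x * grad_sq (Om t) x) \<le> stint ({s_in..s_out} \<times> ?b) (\<lambda>t x. grad_sq (Om t) x)"
    unfolding set_lebesgue_integral_def
  proof (rule integral_mono)
    show "integrable lborel (\<lambda>p. indicat_real S p *\<^sub>R (case p of (t, x) \<Rightarrow> X t x * grad_sq (Om t) x))"
      using set_integrable_X[OF bounded_meas_grad_sq] unfolding set_integrable_def .
    show "integrable lborel (\<lambda>p. indicat_real ({s_in..s_out} \<times> ?b) p *\<^sub>R (case p of (t, x) \<Rightarrow> grad_sq (Om t) x))"
      using int unfolding set_integrable_def .
    fix p :: "real \<times> (real^3)"
    obtain t x where p: "p = (t, x)" by (cases p)
    show "indicat_real S p *\<^sub>R (case p of (t, x) \<Rightarrow> X t x * grad_sq (Om t) x)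
        \<le> indicat_real ({s_in..s_out} \<times> ?b) p *\<^sub>R (case p of (t, x) \<Rightarrow> grad_sq (Om t) x)"
    proof (cases "p \<in> S")
      case True
      then have "p \<in> {s_in..s_out} \<times> ?b" using sub by auto
      moreover have "X t x * grad_sq (Om t) x \<le> grad_sq (Om t) x"
        using cut_range[of t x] gs[of t x] True p by (intro mult_left_le_one_le) auto
      ultimately show ?thesis using True p by simp
    next
      case False
      then have "indicat_real S p = 0" by simp
      then show ?thesis unfolding p using gs[of t x] by (simp del: mem_Times_iff)
    qed
  qed
  moreover have "stint (slab \<tau>0 \<tau>1 t0 r \<times> ?b) (\<lambda>t x. grad_sq (Omfil \<phi> l u t) x)
      = stint ({s_in..s_out} \<times> ?b) (\<lambda>t x. grad_sq (Om t) x)"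
    unfolding slab_eq by (rule stint_cong) (simp add: filtered_u(2))
  ultimately show ?thesis
    unfolding annular_cost_def Pdiff_eq using r by (simp add: mult_left_mono flip: right_diff_distrib)
qed

text \<open>\<open>S\<close> is closed, so the closure in the definition of the shell cannot leave
  it, in time or in space.\<close>

lemma shell_subset: "shell \<tau>0 \<tau>1 chi x0 t0 r \<subseteq> S"
  unfolding shell_def
proof (rule closure_minimal)
  show "closed S" by (intro closed_Times) auto
  show "{(t, x). t \<in> slab \<tau>0 \<tau>1 t0 r \<and> grad (cutx t) x \<noteq> 0} \<subseteq> S"
  proof (rule subsetI)
    fix p assume "p \<in> {(t, x). t \<in> slab \<tau>0 \<tau>1 t0 r \<and> grad (cutx t) x \<noteq> 0}"
    then obtain t x where p: "p = (t, x)" and t: "t \<in> {s_in..s_out}" and "grad (cutx t) x \<noteq> 0"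
      unfolding slab_eq by auto
    then have "grad (X t) x \<noteq> 0" by (simp only: cut_eq[OF t] not_False_eq_True)
    then have "x \<in> cball x0 r" using X_deriv_zero(2)[of t x] t by blast
    with t show "p \<in> S" unfolding p by blast
  qed
qed

lemma Lcom_eq: "Lcom K \<phi> \<tau>0 \<tau>1 chi x0 t0 u r l
    = K * (1 / r) * stint (shell \<tau>0 \<tau>1 chi x0 t0 r) (\<lambda>t x. (norm (Om t x))\<^sup>2)
    + K * r * stint (shell \<tau>0 \<tau>1 chi x0 t0 r) (\<lambda>t x. (norm (V t x))\<^sup>2)"
proof -
  have t: "t \<in> {s_in..s_out}" if "(t, x) \<in> shell \<tau>0 \<tau>1 chi x0 t0 r" for t x using shell_subset that by auto
  have "stint (shell \<tau>0 \<tau>1 chi x0 t0 r) (\<lambda>t x. (norm (Omfil \<phi> l u t x))\<^sup>2)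
      = stint (shell \<tau>0 \<tau>1 chi x0 t0 r) (\<lambda>t x. (norm (Om t x))\<^sup>2)"
    "stint (shell \<tau>0 \<tau>1 chi x0 t0 r) (\<lambda>t x. (norm (div_mat (Rfil \<phi> l u t) x))\<^sup>2)
      = stint (shell \<tau>0 \<tau>1 chi x0 t0 r) (\<lambda>t x. (norm (V t x))\<^sup>2)"
    by (rule stint_cong, simp add: filtered_u[OF t])+
  then show ?thesis by (simp add: Lcom_def)
qed

lemma Lcom_nonneg: "0 \<le> K \<Longrightarrow> 0 \<le> Lcom K \<phi> \<tau>0 \<tau>1 chi x0 t0 u r l"
  unfolding Lcom_def using r by (intro add_nonneg_nonneg mult_nonneg_nonneg stint_nonneg) auto

lemma grad_cut_bound:
  assumes K: "\<And>\<tau> y. \<tau> \<in> {\<tau>0..\<tau>1} \<Longrightarrow> norm (grad (chi \<tau>) y) \<le> K" and t: "t \<in> {s_in..s_out}"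
  shows "norm (grad (X t) x) \<le> K / r"
proof -
  let ?\<tau> = "(t - t0) / r\<^sup>2"
  have \<tau>: "?\<tau> \<in> {\<tau>0..\<tau>1}" using t unfolding rescaled_time .
  have "chi ?\<tau> = (\<lambda>y. g (?\<tau>, y))" by (rule ext) (rule chi_g[OF \<tau>])
  then have sm: "smooth (chi ?\<tau>)" using smooth_space_slice[OF g_smooth] by simp
  have lin: "linear (frechet_derivative (chi ?\<tau>) (at z))" for z
    using smooth_has_derivative[OF sm] by (intro bounded_linear.linear has_derivative_bounded_linear)
  have X: "X t = (\<lambda>x. chi ?\<tau> (- x0 /\<^sub>R r + inverse r *\<^sub>R x))"
    unfolding cut_eq[OF t, symmetric] cutk_def[abs_def] by (simp add: algebra_simps)
  have "pd i (X t) x = inverse r * pd i (chi ?\<tau>) (- x0 /\<^sub>R r + inverse r *\<^sub>R x)" for i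
    unfolding X pd_def
    by (subst frechet_derivative_affine[OF bounded_linear_scaleR_right smooth_differentiable[OF sm]])
      (simp add: linear_scale[OF lin])
  then have "grad (X t) x = inverse r *\<^sub>R grad (chi ?\<tau>) (- x0 /\<^sub>R r + inverse r *\<^sub>R x)"
    by (simp add: grad_def vec_eq_iff)
  then have "norm (grad (X t) x) = inverse r * norm (grad (chi ?\<tau>) (- x0 /\<^sub>R r + inverse r *\<^sub>R x))"
    using r by simp
  also have "\<dots> \<le> inverse r * K" using K[OF \<tau>] r by (intro mult_left_mono) auto
  finally show ?thesis by (simp add: field_simps)
qed

text \<open>\<open>V_increment_bound\<close> integrated against the cutoff; the factor
  \<open>1 / l\<^sup>2\<close> is the one in the normalisation of
  \<open>increment_defect\<close>.\<close>

lemma stress_defect_bound: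
  assumes p: "2 \<le> p"
  shows "ennreal (r * stint S (\<lambda>t x. X t x * (norm (V t x))\<^sup>2))
    \<le> ennreal (81 * (\<integral>y. norm (grad \<phi> y) \<partial>lborel)\<^sup>2) * increment_defect \<phi> \<tau>0 \<tau>1 chi x0 t0 p u r l"
proof -
  let ?c = "81 * (\<integral>y. norm (grad \<phi> y) \<partial>lborel)\<^sup>2"
  have c0: "0 < ?c" using kernel_grad_pos[OF kernel'] by simp
  define c where "c = ?c / l\<^sup>2"
  have cp: "0 < c" using c0 l by (simp add: c_def)
  let ?f = "\<lambda>p. indicat_real S p * (X (fst p) (snd p) * (norm (V (fst p) (snd p)))\<^sup>2)"
  have fi: "integrable lborel ?f"
    using set_integrable_X[OF bounded_meas_norm_V] unfolding set_integrable_def by (simp add: split_beta')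
  have f0: "0 \<le> ?f p" for p using cut_range[of "fst p" "snd p"] by (cases p) (auto simp: indicator_def)
  have "ennreal (stint S (\<lambda>t x. X t x * (norm (V t x))\<^sup>2)) = ennreal (\<integral>p. ?f p \<partial>lborel)"
    by (simp add: set_lebesgue_integral_def split_beta')
  also have "\<dots> = (\<integral>\<^sup>+p. ennreal (?f p) \<partial>lborel)"
    using fi f0 by (intro nn_integral_eq_integral[symmetric]) auto
  \<comment> \<open>The constant is pulled out of the integral of \<open>?f\<close>, whose
    measurability is known, so that the comparison with the defect is by monotonicity alone.\<close>
  also have "\<dots> = (\<integral>\<^sup>+p. ennreal c * ennreal (?f p / c) \<partial>lborel)"
    using cp f0 by (intro nn_integral_cong) (simp add: ennreal_mult[symmetric])
  also have "\<dots> = ennreal c * (\<integral>\<^sup>+p. ennreal (?f p / c) \<partial>lborel)"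
    using borel_measurable_integrable[OF fi] by (intro nn_integral_cmult) simp
  finally have J: "ennreal (stint S (\<lambda>t x. X t x * (norm (V t x))\<^sup>2))
      = ennreal c * (\<integral>\<^sup>+p. ennreal (?f p / c) \<partial>lborel)" .
  define I where "I = (\<integral>\<^sup>+(t, x)\<in>slab \<tau>0 \<tau>1 t0 r \<times> UNIV. ennreal (cutx t x) * MM \<phi> l p u t x ^ 4 \<partial>lborel)"
  have le: "(\<integral>\<^sup>+p. ennreal (?f p / c) \<partial>lborel) \<le> I"
    unfolding I_def
  proof (rule nn_integral_mono)
    fix q :: "real \<times> (real^3)"
    obtain t x where q: "q = (t, x)" by (cases q)
    show "ennreal (?f q / c) \<le> (case q of (t, x) \<Rightarrow> ennreal (cutx t x) * MM \<phi> l p u t x ^ 4)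
        * indicator (slab \<tau>0 \<tau>1 t0 r \<times> UNIV) q"
    proof (cases "q \<in> S")
      case True
      then have t: "t \<in> {s_in..s_out}" using q by auto
      have "ennreal ((norm (V t x))\<^sup>2 / c) = ennreal (1 / c) * ennreal ((norm (V t x))\<^sup>2)"
        using cp by (simp add: ennreal_mult[symmetric])
      also have "\<dots> \<le> ennreal (1 / c) * (ennreal c * MM \<phi> l p v t x ^ 4)"
        using V_increment_bound[OF l p, of t x] by (intro mult_left_mono) (auto simp: c_def)
      also have "\<dots> = MM \<phi> l p v t x ^ 4"
        using cp by (simp add: mult.assoc[symmetric] ennreal_mult[symmetric])
      finally have "ennreal (X t x) * ennreal ((norm (V t x))\<^sup>2 / c) \<le> ennreal (X t x) * MM \<phi> l p v t x ^ 4"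
        by (rule mult_left_mono) simp
      moreover have "ennreal (?f q / c) = ennreal (X t x) * ennreal ((norm (V t x))\<^sup>2 / c)"
        using True q cp cut_range[OF t, of x] by (simp add: ennreal_mult[symmetric])
      ultimately show ?thesis
        using t by (simp add: q slab_eq filtered_u(4)[OF t] G0_cutk[OF t] indicator_times)
    next
      case False
      then show ?thesis by simp
    qed
  qed
  have rc: "ennreal r * ennreal c = ennreal ?c * ennreal (r / l\<^sup>2)"
  proof -
    have "r * c = ?c * (r / l\<^sup>2)" by (simp add: c_def)
    moreover have "ennreal r * ennreal c = ennreal (r * c)" using r cp by (intro ennreal_mult[symmetric]) auto
    moreover have "ennreal ?c * ennreal (r / l\<^sup>2) = ennreal (?c * (r / l\<^sup>2))"
      using r by (intro ennreal_mult[symmetric]) auto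
    ultimately show ?thesis by (simp only:)
  qed
  have "0 \<le> stint S (\<lambda>t x. X t x * (norm (V t x))\<^sup>2)"
    by (rule stint_nonneg) (use cut_range in auto)
  then have "ennreal (r * stint S (\<lambda>t x. X t x * (norm (V t x))\<^sup>2))
      = ennreal r * (ennreal c * (\<integral>\<^sup>+p. ennreal (?f p / c) \<partial>lborel))"
    unfolding J[symmetric] using r by (intro ennreal_mult) auto
  also have "\<dots> \<le> ennreal r * (ennreal c * I)"
    by (intro mult_left_mono le) auto
  also have "\<dots> = ennreal ?c * increment_defect \<phi> \<tau>0 \<tau>1 chi x0 t0 p u r l"
    by (simp only: increment_defect_def I_def[symmetric] mult.assoc[symmetric] rc)
  finally show ?thesis .
qed

text \<open>\<open>enstrophy_inequality\<close> multiplied by \<open>r\<close>, with the bound on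
  the gradient of \<open>U\<close> supplied by the energy at almost every time and \<open>A\<close>
  taken to be the shell.\<close>

lemma scale_inequality:
  assumes K: "\<And>\<tau> y. \<tau> \<in> {\<tau>0..\<tau>1} \<Longrightarrow> norm (grad (chi \<tau>) y) \<le> K" and K0: "0 \<le> K" and \<eta>: "0 < \<eta>"
    and E: "AE t in lborel. t \<in> {t0 - 1..t0} \<longrightarrow> (\<integral>x. (norm (v t x))\<^sup>2 \<partial>lborel) \<le> E" and E0: "0 \<le> E"
    and a: "\<And>j. (\<integral>z. (pd j \<phi> z)\<^sup>2 \<partial>lborel) \<le> a"
  shows "Eout \<phi> \<tau>1 chi x0 t0 u r l + (1 - \<eta>) * Pdiff \<phi> \<tau>0 \<tau>1 chi x0 t0 u r l - Ein \<phi> \<tau>0 chi x0 t0 u r l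
    \<le> \<bar>cutoff_residual \<phi> \<tau>0 \<tau>1 chi x0 t0 u r l\<bar>
      + r * (36 * sqrt (a / l ^ 5 * E) ^ 3 * ((\<tau>1 - \<tau>0) * r\<^sup>2 * (unit_ball_vol 3 * r ^ 3)))
      + r * stint S (\<lambda>t x. X t x * (norm (V t x))\<^sup>2) / (2 * \<eta>)
      + Lcom K \<phi> \<tau>0 \<tau>1 chi x0 t0 u r l"
proof -
  let ?D = "sqrt (a / l ^ 5 * E)" and ?A = "shell \<tau>0 \<tau>1 chi x0 t0 r"
  have a0: "0 \<le> a" using a[of 1] by (rule order_trans[rotated]) simp
  have D: "AE t in lborel. t \<in> {s_in..s_out} \<longrightarrow> (\<forall>x i j. \<bar>pd j (\<lambda>y. U t y $ i) x\<bar> \<le> ?D)"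
    using E
  proof (rule eventually_mono)
    fix t assume *: "t \<in> {t0 - 1..t0} \<longrightarrow> (\<integral>x. (norm (v t x))\<^sup>2 \<partial>lborel) \<le> E"
    show "t \<in> {s_in..s_out} \<longrightarrow> (\<forall>x i j. \<bar>pd j (\<lambda>y. U t y $ i) x\<bar> \<le> ?D)"
    proof (intro impI allI)
      fix x i j assume "t \<in> {s_in..s_out}"
      then have "(\<integral>x. (norm (v t x))\<^sup>2 \<partial>lborel) \<le> E" using * slab_time by blast
      from pd_U_bound[OF l this, of j i x]
      have "\<bar>pd j (\<lambda>y. U t y $ i) x\<bar> \<le> sqrt ((\<integral>z. (pd j \<phi> z)\<^sup>2 \<partial>lborel) / l ^ 5 * E)" .
      also have "\<dots> \<le> ?D"
        using a[of j] l E0 by (intro real_sqrt_le_mono mult_right_mono divide_right_mono) auto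
      finally show "\<bar>pd j (\<lambda>y. U t y $ i) x\<bar> \<le> ?D" .
    qed
  qed
  have vol: "measure lborel (cball x0 r) = unit_ball_vol 3 * r ^ 3"
    using content_cball[of r x0] r by simp
  have A: "?A \<in> sets borel" "(t, x) \<in> ?A" if "t \<in> {s_in..s_out}" "grad (X t) x \<noteq> 0" for t x
  proof -
    show "?A \<in> sets borel" by (simp add: shell_def)
    show "(t, x) \<in> ?A"
      unfolding shell_def using that by (intro closure_subset[THEN subsetD]) (simp add: slab_eq cut_eq)
  qed
  have Am: "?A \<in> sets borel" by (simp add: shell_def)
  let ?N = "stint ?A (\<lambda>t x. (norm (Om t x))\<^sup>2)" and ?W = "stint ?A (\<lambda>t x. (norm (V t x))\<^sup>2)"
  have pos: "0 \<le> ?N" "0 \<le> ?W" by (rule stint_nonneg, simp)+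
  have "r * ((\<integral>x. X s_out x * (norm (Om s_out x))\<^sup>2 \<partial>lborel) / 2 - (\<integral>x. X s_in x * (norm (Om s_in x))\<^sup>2 \<partial>lborel) / 2
      + (1 - \<eta>) * stint S (\<lambda>t x. X t x * grad_sq (Om t) x))
    \<le> r * (stint S (\<lambda>t x. (norm (Om t x))\<^sup>2 * (sdt G0 (t, x) + lapl (X t) x + U t x \<bullet> grad (X t) x)) / 2
     + 36 * ?D ^ 3 * ((s_out - s_in) * measure lborel (cball x0 r))
     + stint S (\<lambda>t x. X t x * (norm (V t x))\<^sup>2) / (2 * \<eta>)
     + K / 2 * (?N / r\<^sup>2 + ?W))"
  proof (rule mult_left_mono[OF enstrophy_inequality])
    show "0 \<le> ?D" using a0 l E0 by simp
    show "norm (grad (X t) x) \<le> K / r" if "t \<in> {s_in..s_out}" for t x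
      by (rule grad_cut_bound[OF K that])
  qed (use cut_range D r \<eta> K0 Am shell_subset A(2) in auto)
  \<comment> \<open>The shell terms arrive with \<open>K / 2\<close>; doubling these nonnegative
    terms matches \<open>Lcom\<close> with constant \<open>K\<close>.\<close>
  moreover have "r * (K / 2 * (?N / r\<^sup>2 + ?W)) \<le> Lcom K \<phi> \<tau>0 \<tau>1 chi x0 t0 u r l"
  proof -
    have "r * (K / 2 * (?N / r\<^sup>2 + ?W)) = (K * (1 / r) * ?N + K * r * ?W) / 2"
      using r by (simp add: field_simps power2_eq_square)
    also have "\<dots> \<le> K * (1 / r) * ?N + K * r * ?W"
    proof -
      have half: "(a + b) / 2 \<le> a + b" if "0 \<le> a" "0 \<le> b" for a b :: real using that by simp
      show ?thesis by (rule half) (use K0 r pos in simp_all)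
    qed
    finally show ?thesis unfolding Lcom_eq .
  qed
  moreover have "s_out - s_in = (\<tau>1 - \<tau>0) * r\<^sup>2" by (simp add: algebra_simps)
  ultimately show ?thesis
    unfolding Eout_eq Ein_eq Pdiff_eq cutoff_residual_eq vol
    by (simp add: algebra_simps)
qed

end

section \<open>From a Leray-Hopf solution to the standing assumptions\<close>

definition zero_ext :: "real set \<Rightarrow> (real \<Rightarrow> real^3 \<Rightarrow> real^3) \<Rightarrow> real \<Rightarrow> real^3 \<Rightarrow> real^3" where
  "zero_ext I u t = (if t \<in> I then u t else (\<lambda>x. 0))"

lemma leray_hopf_zero_ext_measurable:
  assumes "leray_hopf a I u"
  shows "I \<in> sets borel" "(\<lambda>(t, x). zero_ext I u t x) \<in> borel_measurable borel"
proof -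
  show I: "I \<in> sets borel"
    using assms unfolding leray_hopf_def by (intro real_interval_borel_measurable) blast
  have "(I \<times> UNIV) \<inter> space borel \<in> sets (borel :: (real \<times> (real^3)) measure)"
    using borel_Times[OF I, of UNIV] by simp
  moreover have "(\<lambda>(t, x). u t x) \<in> borel_measurable (restrict_space borel (I \<times> UNIV))"
    using assms unfolding leray_hopf_def by blast
  ultimately have "(\<lambda>p. indicat_real (I \<times> UNIV) p *\<^sub>R (case p of (t, x) \<Rightarrow> u t x)) \<in> borel_measurable borel"
    by (subst (asm) borel_measurable_restrict_space_iff) auto
  moreover have "(\<lambda>p. indicat_real (I \<times> UNIV) p *\<^sub>R (case p of (t, x) \<Rightarrow> u t x)) = (\<lambda>(t, x). zero_ext I u t x)"
  proof
    fix p show "indicat_real (I \<times> UNIV) p *\<^sub>R (case p of (t, x) \<Rightarrow> u t x) = (case p of (t, x) \<Rightarrow> zero_ext I u t x)"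
      by (cases p; cases "fst p \<in> I") (simp_all add: zero_ext_def)
  qed
  ultimately show "(\<lambda>(t, x). zero_ext I u t x) \<in> borel_measurable borel" by simp
qed

text \<open>Outside \<open>I\<close> the zero field is square integrable and solenoidal, so these
  clauses hold at all times. The equation is inherited because the open unit interval before
  \<open>t0\<close> lies in the interior of \<open>I\<close>, so the test fields are
  admissible.\<close>

lemma leray_hopf_flow:
  assumes L: "leray_hopf a I u" and sub: "{t0 - 1..t0} \<subseteq> I"
  shows "\<exists>B. flow (zero_ext I u) t0 B"
proof -
  have sqI: "t \<in> I \<Longrightarrow> square_integrable (u t)"
    and wc: "square_integrable w \<Longrightarrow> continuous_on I (\<lambda>t. \<integral>x. u t x \<bullet> w x \<partial>lborel)"
    and df: "t \<in> I \<Longrightarrow> weakly_div_free (u t)" and ns: "weak_navier_stokes I u" for t w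
    using L unfolding leray_hopf_def by blast+
  obtain B where B: "\<And>t. t \<in> I \<Longrightarrow> (\<integral>x. (norm (u t x))\<^sup>2 \<partial>lborel) \<le> B"
    using L unfolding leray_hopf_def by blast
  \<comment> \<open>At times outside \<open>I\<close> the energy is 0, which a negative bound would
    not cover.\<close>
  have "flow (zero_ext I u) t0 (max B 0)"
  proof
    show "(\<lambda>(t, x). zero_ext I u t x) \<in> borel_measurable borel"
      by (rule leray_hopf_zero_ext_measurable[OF L])
    show "integrable lborel (\<lambda>x. (norm (zero_ext I u t x))\<^sup>2)" for t
      using sqI[of t] by (simp add: zero_ext_def square_integrable_def)
    show "(\<integral>x. (norm (zero_ext I u t x))\<^sup>2 \<partial>lborel) \<le> max B 0" for t
      using B[of t] by (auto simp: zero_ext_def max_def)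
    show "weakly_div_free (zero_ext I u t)" for t
      using df[of t] by (simp add: zero_ext_def weakly_div_free_def)
    show "continuous_on {t0 - 1..t0} (\<lambda>t. \<integral>x. zero_ext I u t x \<bullet> w x \<partial>lborel)" if "square_integrable w" for w
    proof (rule continuous_on_eq[OF continuous_on_subset[OF wc[OF that] sub]])
      show "(\<integral>x. u t x \<bullet> w x \<partial>lborel) = (\<integral>x. zero_ext I u t x \<bullet> w x \<partial>lborel)" if "t \<in> {t0 - 1..t0}" for t
      proof -
        have "t \<in> I" using sub that by blast
        then show ?thesis by (simp add: zero_ext_def)
      qed
    qed
    fix \<psi> :: "real \<times> (real^3) \<Rightarrow> real^3"
    assume tf: "test_fun ({t0 - 1<..<t0} \<times> UNIV) \<psi>" and dv: "\<And>t x. divg (\<lambda>y. \<psi> (t, y)) x = 0"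
    have "{t0 - 1<..<t0} \<subseteq> interior I"
      using sub greaterThanLessThan_subseteq_atLeastAtMost_iff[of "t0 - 1" t0 "t0 - 1" t0]
      by (intro interior_maximal) auto
    then have "test_fun (interior I \<times> UNIV) \<psi>"
      by (intro test_fun_mono[OF tf] Sigma_mono order_refl)
    with dv have "test_fun (interior I \<times> UNIV) \<psi> \<and> (\<forall>t x. divg (\<lambda>y. \<psi> (t, y)) x = 0)" by simp
    from ns[unfolded weak_navier_stokes_def, rule_format, OF this]
    have "set_lebesgue_integral lborel (I \<times> UNIV) (\<lambda>(t, x).
            u t x \<bullet> vector_derivative (\<lambda>s. \<psi> (s, x)) (at t)
          + (\<Sum>i\<in>UNIV. \<Sum>j\<in>UNIV. u t x $ i * u t x $ j * pd j (\<lambda>y. \<psi> (t, y) $ i) x)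
          + u t x \<bullet> lapl (\<lambda>y. \<psi> (t, y)) x) = 0"
      .
    then show "(\<integral>(t, x). zero_ext I u t x \<bullet> vector_derivative (\<lambda>s. \<psi> (s, x)) (at t)
          + (\<Sum>i\<in>UNIV. \<Sum>j\<in>UNIV. zero_ext I u t x $ i * zero_ext I u t x $ j * pd j (\<lambda>y. \<psi> (t, y) $ i) x)
          + zero_ext I u t x \<bullet> lapl (\<lambda>y. \<psi> (t, y)) x \<partial>lborel) = 0"
      unfolding set_lebesgue_integral_def
    proof (rule trans[OF Bochner_Integration.integral_cong[OF refl], rotated])
      fix p :: "real \<times> (real^3)"
      show "(case p of (t, x) \<Rightarrow> zero_ext I u t x \<bullet> vector_derivative (\<lambda>s. \<psi> (s, x)) (at t)
          + (\<Sum>i\<in>UNIV. \<Sum>j\<in>UNIV. zero_ext I u t x $ i * zero_ext I u t x $ j * pd j (\<lambda>y. \<psi> (t, y) $ i) x)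
          + zero_ext I u t x \<bullet> lapl (\<lambda>y. \<psi> (t, y)) x)
        = indicat_real (I \<times> UNIV) p *\<^sub>R (case p of (t, x) \<Rightarrow> u t x \<bullet> vector_derivative (\<lambda>s. \<psi> (s, x)) (at t)
          + (\<Sum>i\<in>UNIV. \<Sum>j\<in>UNIV. u t x $ i * u t x $ j * pd j (\<lambda>y. \<psi> (t, y) $ i) x)
          + u t x \<bullet> lapl (\<lambda>y. \<psi> (t, y)) x)"
        by (cases p; cases "fst p \<in> I") (simp_all add: zero_ext_def)
    qed
  qed
  then show ?thesis by blast
qed

text \<open>The essential supremum is finite by the uniform energy bound, so \<open>enn2real\<close>
  in \<open>ME\<close> loses nothing; measurability in time comes from the joint measurability of
  the zero extension.\<close>

lemma ME_bound:
  assumes L: "leray_hopf a I u"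
  shows "AE t in lborel. t \<in> I \<longrightarrow> (\<integral>x. (norm (u t x))\<^sup>2 \<partial>lborel) \<le> ME I u"
proof -
  let ?M = "restrict_space lborel I" and ?f = "\<lambda>t. \<integral>\<^sup>+x. ennreal ((norm (u t x))\<^sup>2) \<partial>lborel"
  note I = leray_hopf_zero_ext_measurable(1)[OF L] and vm = leray_hopf_zero_ext_measurable(2)[OF L]
  obtain B where B: "\<And>t. t \<in> I \<Longrightarrow> (\<integral>x. (norm (u t x))\<^sup>2 \<partial>lborel) \<le> B"
    using L unfolding leray_hopf_def by blast
  have sq: "integrable lborel (\<lambda>x. (norm (u t x))\<^sup>2)" if "t \<in> I" for t
    using L that unfolding leray_hopf_def square_integrable_def by blast
  have f_eq: "?f t = ennreal (\<integral>x. (norm (u t x))\<^sup>2 \<partial>lborel)" if "t \<in> I" for t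
    using sq[OF that] by (intro nn_integral_eq_integral) auto
  have "(\<lambda>t. \<integral>\<^sup>+x. ennreal ((norm (zero_ext I u t x))\<^sup>2) \<partial>lborel) \<in> borel_measurable borel"
  proof (rule lborel.borel_measurable_nn_integral)
    have "(\<lambda>p. ennreal ((norm (case p of (t, x) \<Rightarrow> zero_ext I u t x))\<^sup>2)) \<in> borel_measurable borel"
      using vm by measurable
    then show "(\<lambda>(t, x). ennreal ((norm (zero_ext I u t x))\<^sup>2)) \<in> borel_measurable (borel \<Otimes>\<^sub>M lborel)"
      by (simp add: split_beta' borel_prod measurable_cong_sets[OF sets_pair_measure_cong[OF refl sets_lborel] refl])
  qed
  then have "(\<lambda>t. \<integral>\<^sup>+x. ennreal ((norm (zero_ext I u t x))\<^sup>2) \<partial>lborel) \<in> borel_measurable ?M"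
    by (intro measurable_restrict_space1) simp
  then have fm: "?f \<in> borel_measurable ?M"
    by (rule measurable_cong[THEN iffD1, rotated]) (simp add: zero_ext_def space_restrict_space)
  have aeI: "AE t in ?M. t \<in> I"
    by (rule AE_I2) (simp add: space_restrict_space)
  have "esssup ?M ?f \<le> ennreal B"
    by (rule esssup_I[OF fm]) (use aeI f_eq B in \<open>auto elim!: eventually_mono intro!: ennreal_leI\<close>)
  then have fin: "esssup ?M ?f < \<infinity>" using ennreal_less_top le_less_trans by (simp add: le_less_trans)
  have "AE t in ?M. ?f t \<le> ennreal (ME I u)"
    using esssup_AE[of ?f ?M] fin by (simp add: ME_def)
  then have "AE t in lborel. t \<in> I \<longrightarrow> ?f t \<le> ennreal (ME I u)"
    using I by (subst (asm) AE_restrict_space_iff) auto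
  then show ?thesis
    by (rule eventually_mono) (auto simp: f_eq ennreal_le_iff ME_def)
qed

section \<open>The constants and the exponent 3/2\<close>

lemma cutoff_gradient_bound:
  assumes "cutoff_profile \<tau>0 \<tau>1 chi"
  shows "\<exists>K>0. \<forall>\<tau>\<in>{\<tau>0..\<tau>1}. \<forall>y. norm (grad (chi \<tau>) y) \<le> K"
proof -
  obtain g where g: "smooth g" "\<And>t x. t \<in> {\<tau>0..\<tau>1} \<Longrightarrow> chi t x = g (t, x)"
    using assms unfolding cutoff_profile_def by blast
  obtain Q where Q: "compact Q" "Q \<subseteq> ball 0 1" "\<And>t x. t \<in> {\<tau>0..\<tau>1} \<Longrightarrow> x \<notin> Q \<Longrightarrow> chi t x = 0"
    using assms unfolding cutoff_profile_def by blast
  \<comment> \<open>The gradient of the extension is continuous on the compact set that carries the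
    cutoff, and the gradient of the cutoff vanishes elsewhere, so one bound serves the whole
    slab.\<close>
  have "continuous_on UNIV (\<lambda>p. \<chi> i. sdx i g p)"
    by (intro continuous_on_vec_lambda smooth_continuous smooth_sdx g)
  then have "bounded ((\<lambda>p. \<chi> i. sdx i g p) ` ({\<tau>0..\<tau>1} \<times> Q))"
    using Q(1) by (intro compact_imp_bounded compact_continuous_image compact_Times)
      (auto intro: continuous_on_subset)
  then obtain K where K: "0 < K" "\<And>p. p \<in> {\<tau>0..\<tau>1} \<times> Q \<Longrightarrow> norm (\<chi> i. sdx i g p) \<le> K"
    unfolding bounded_pos by blast
  have "norm (grad (chi \<tau>) y) \<le> K" if t: "\<tau> \<in> {\<tau>0..\<tau>1}" for \<tau> y
  proof (cases "y \<in> Q")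
    case True
    have "chi \<tau> = (\<lambda>y. g (\<tau>, y))" using g(2)[OF t] by (rule ext)
    then have "grad (chi \<tau>) y = (\<chi> i. sdx i g (\<tau>, y))" by (simp add: grad_def pd_space_slice[OF g(1)])
    then show ?thesis using K(2)[of "(\<tau>, y)"] t True by simp
  next
    case False
    have "supp (chi \<tau>) \<subseteq> Q" by (rule supp_subset_closed[OF compact_imp_closed[OF Q(1)] Q(3)[OF t]])
    with False have "pd i (chi \<tau>) y = 0" for i unfolding pd_def by (intro deriv_zero_off_supp) auto
    then show ?thesis using K(1) by (simp add: grad_def zero_vec_def[symmetric])
  qed
  with K(1) show ?thesis by blast
qed

text \<open>The sum bounds the three derivative energies at once; the added 1 makes positivity
  immediate.\<close>

definition kernel_energy :: "(real^3 \<Rightarrow> real) \<Rightarrow> real" where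
  "kernel_energy \<phi> = 1 + (\<Sum>j\<in>UNIV. \<integral>z. (pd j \<phi> z)\<^sup>2 \<partial>lborel)"

text \<open>The stretching bound with all powers of \<open>r\<close> removed: 36 from
  \<open>stretch_bound\<close>, the power 3/2 from the cube of a square root, then slab length and
  ball volume at unit scale.\<close>

definition main_const :: "real \<Rightarrow> real \<Rightarrow> real \<Rightarrow> (real^3 \<Rightarrow> real) \<Rightarrow> real" where
  "main_const \<sigma> \<tau>0 \<tau>1 \<phi> = 36 * (kernel_energy \<phi> / \<sigma> ^ 5) powr (3 / 2) * (\<tau>1 - \<tau>0) * unit_ball_vol 3"

lemma kernel_energy: "0 < kernel_energy \<phi>" "(\<integral>z. (pd j \<phi> z)\<^sup>2 \<partial>lborel) \<le> kernel_energy \<phi>"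
proof -
  have nn: "0 \<le> (\<integral>z. (pd j \<phi> z)\<^sup>2 \<partial>lborel)" for j by simp
  have "(\<integral>z. (pd j \<phi> z)\<^sup>2 \<partial>lborel) \<le> (\<Sum>j\<in>UNIV. \<integral>z. (pd j \<phi> z)\<^sup>2 \<partial>lborel)"
    by (rule member_le_sum) (use nn in auto)
  moreover have "0 \<le> (\<Sum>j\<in>UNIV. \<integral>z. (pd j \<phi> z)\<^sup>2 \<partial>lborel)" by (rule sum_nonneg) (rule nn)
  ultimately show "0 < kernel_energy \<phi>" "(\<integral>z. (pd j \<phi> z)\<^sup>2 \<partial>lborel) \<le> kernel_energy \<phi>"
    unfolding kernel_energy_def by linarith+
qed

lemma main_const_pos: "0 < \<sigma> \<Longrightarrow> \<tau>0 < \<tau>1 \<Longrightarrow> 0 < main_const \<sigma> \<tau>0 \<tau>1 \<phi>"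
  using kernel_energy(1)[of \<phi>] unfolding main_const_def by (intro mult_pos_pos) auto

lemma sqrt_cube: "0 \<le> x \<Longrightarrow> sqrt x ^ 3 = x powr (3 / 2)"
  by (cases "x = 0") (simp_all add: powr_half_sqrt[symmetric] powr_power)

text \<open>The cube of the gradient bound carries \<open>r powr (- 15 / 2)\<close>; slab length,
  ball volume and the outer factor supply \<open>r ^ 6\<close>.\<close>

lemma stretching_scaling:
  assumes r: "0 < r" and \<sigma>: "0 < \<sigma>" and E: "0 \<le> E"
  shows "r * (36 * sqrt (kernel_energy \<phi> / (\<sigma> * r) ^ 5 * E) ^ 3 * ((\<tau>1 - \<tau>0) * r\<^sup>2 * (unit_ball_vol 3 * r ^ 3)))
    = main_const \<sigma> \<tau>0 \<tau>1 \<phi> * E powr (3 / 2) * r powr (- 3 / 2)"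
proof -
  let ?a = "kernel_energy \<phi> / \<sigma> ^ 5"
  have a: "0 < ?a" using kernel_energy(1) \<sigma> by simp
  have eq: "kernel_energy \<phi> / (\<sigma> * r) ^ 5 * E = ?a * E * r powr (-5)"
    using r \<sigma> by (simp add: power_mult_distrib powr_minus powr_numeral field_simps)
  have "sqrt (kernel_energy \<phi> / (\<sigma> * r) ^ 5 * E) ^ 3 = (?a * E * r powr (-5)) powr (3 / 2)"
    unfolding eq using E by (intro sqrt_cube mult_nonneg_nonneg less_imp_le[OF a]) auto
  also have "\<dots> = ?a powr (3 / 2) * E powr (3 / 2) * r powr (- 15 / 2)"
  proof -
    have "(A * E * r powr (-5)) powr (3 / 2) = A powr (3 / 2) * E powr (3 / 2) * r powr (- 15 / 2)" if "0 \<le> A" for A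
      using that E r by (simp add: powr_mult powr_powr)
    from this[OF less_imp_le[OF a]] show ?thesis .
  qed
  finally have s: "sqrt (kernel_energy \<phi> / (\<sigma> * r) ^ 5 * E) ^ 3 = ?a powr (3 / 2) * E powr (3 / 2) * r powr (- 15 / 2)" .
  have "r powr (- 15 / 2) * r ^ 6 = r powr (- 15 / 2) * r powr 6" using r by (simp add: powr_numeral)
  also have "\<dots> = r powr (- 3 / 2)" by (simp add: powr_add[symmetric])
  finally have p: "r powr (- 15 / 2) * r ^ 6 = r powr (- 3 / 2)" .
  have "r * (36 * (?a powr (3 / 2) * E powr (3 / 2) * r powr (- 15 / 2)) * ((\<tau>1 - \<tau>0) * r\<^sup>2 * (unit_ball_vol 3 * r ^ 3)))
     = main_const \<sigma> \<tau>0 \<tau>1 \<phi> * E powr (3 / 2) * (r powr (- 15 / 2) * r ^ 6)"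
    by (simp add: main_const_def eval_nat_numeral mult_ac)
  then show ?thesis unfolding s p .
qed

lemma rad_powr: "rad k powr (- 3 / 2) = 2 powr (3 * real k / 2)"
proof -
  have "rad k = 2 powr (- real k)" by (simp add: rad_def powr_minus powr_realpow divide_inverse)
  then show ?thesis by (simp add: powr_powr mult.commute)
qed

theorem theorem10p1:
  shows "\<exists>(Cchi :: real \<Rightarrow> real \<Rightarrow> (real \<Rightarrow> real^3 \<Rightarrow> real) \<Rightarrow> real)
      (Cnear :: real \<Rightarrow> real \<Rightarrow> real \<Rightarrow> (real^3 \<Rightarrow> real) \<Rightarrow> real \<Rightarrow> real \<Rightarrow> (real \<Rightarrow> real^3 \<Rightarrow> real) \<Rightarrow> real)
      (Cmain :: real \<Rightarrow> real \<Rightarrow> real \<Rightarrow> real \<Rightarrow> (real \<Rightarrow> real^3 \<Rightarrow> real) \<Rightarrow> (real^3 \<Rightarrow> real) \<Rightarrow> real)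
      (Ccom :: real \<Rightarrow> (real^3 \<Rightarrow> real) \<Rightarrow> real).
    \<forall>\<phi> \<tau>0 \<tau>1 chi \<sigma> \<rho> \<eta>near \<eta>com.
      filter_kernel \<phi> \<and> cutoff_profile \<tau>0 \<tau>1 chi \<and>
      0 < \<sigma> \<and> \<sigma> \<le> \<rho> \<and> \<rho> \<le> 1 / 4 \<and>
      0 < \<eta>near \<and> 0 < \<eta>com \<and> \<eta>near + \<eta>com < 1 \<longrightarrow>
      0 < Cchi \<tau>0 \<tau>1 chi \<and> 0 < Cnear \<eta>near \<sigma> \<rho> \<phi> \<tau>0 \<tau>1 chi \<and>
      0 < Cmain \<rho> \<sigma> \<tau>0 \<tau>1 chi \<phi> \<and> 0 < Ccom \<eta>com \<phi> \<and>
      (\<forall>a I u t0 x0 p w N.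
        leray_hopf a I u \<and> {t0 - 1..t0} \<subseteq> I \<and> 2 \<le> p \<and> p \<le> 4 \<and>
        (\<forall>k. 0 \<le> w k) \<and> summable (\<lambda>k. 2 powr (3 * real k / 2) * w k) \<longrightarrow>
        ennreal (\<Sum>k=0..N. w k *
            surplus (Cnear \<eta>near \<sigma> \<rho> \<phi> \<tau>0 \<tau>1 chi) \<eta>near \<eta>com
              \<phi> \<tau>0 \<tau>1 chi \<rho> x0 t0 u (rad k) (\<sigma> * rad k))
        \<le> ennreal (Cmain \<rho> \<sigma> \<tau>0 \<tau>1 chi \<phi> * ME I u powr (3 / 2) * Wnorm w)
          + ennreal (Ccom \<eta>com \<phi>) * (\<Sum>k=0..N. ennreal (w k) *
              increment_defect \<phi> \<tau>0 \<tau>1 chi x0 t0 p u (rad k) (\<sigma> * rad k))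
          + ennreal (\<Sum>k=0..N. w k *
              (Lbud (Cchi \<tau>0 \<tau>1 chi) \<phi> \<tau>0 \<tau>1 chi \<rho> x0 t0 u (rad k) (\<sigma> * rad k)
               + Lcom (Cchi \<tau>0 \<tau>1 chi) \<phi> \<tau>0 \<tau>1 chi x0 t0 u (rad k) (\<sigma> * rad k))))"
proof -
  \<comment> \<open>Each constant must be a function of exactly the data it may depend on; the
    choice operator turns the existence of a gradient bound into such a function.\<close>
  define Cchi where "Cchi \<tau>0 \<tau>1 chi = (SOME K. 0 < K \<and> (\<forall>\<tau>\<in>{\<tau>0..\<tau>1}. \<forall>y. norm (grad (chi \<tau>) y) \<le> K))"
    for \<tau>0 \<tau>1 and chi :: "real \<Rightarrow> real^3 \<Rightarrow> real"
  \<comment> \<open>81 and the kernel gradient come from the stress bound, \<open>2 * \<eta>\<close>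
    from Young's inequality.\<close>
  define Ccom where "Ccom \<eta> \<phi> = 81 * (\<integral>y. norm (grad \<phi> y) \<partial>lborel)\<^sup>2 / (2 * \<eta>)" for \<eta> and \<phi> :: "real^3 \<Rightarrow> real"
  show ?thesis
  proof (rule exI[of _ Cchi], rule exI[of _ "\<lambda>_ _ _ _ _ _ _. 1"],
      rule exI[of _ "\<lambda>\<rho> \<sigma> \<tau>0 \<tau>1 chi \<phi>. main_const \<sigma> \<tau>0 \<tau>1 \<phi>"], rule exI[of _ Ccom], intro allI impI)
    fix \<phi> :: "real^3 \<Rightarrow> real" and \<tau>0 \<tau>1 :: real and chi :: "real \<Rightarrow> real^3 \<Rightarrow> real" and \<sigma> \<rho> \<eta>near \<eta>com :: real
    assume "filter_kernel \<phi> \<and> cutoff_profile \<tau>0 \<tau>1 chi \<and> 0 < \<sigma> \<and> \<sigma> \<le> \<rho> \<and> \<rho> \<le> 1 / 4 \<and>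
      0 < \<eta>near \<and> 0 < \<eta>com \<and> \<eta>near + \<eta>com < 1"
    then have \<phi>: "filter_kernel \<phi>" and cp: "cutoff_profile \<tau>0 \<tau>1 chi" and \<sigma>: "0 < \<sigma>" and \<rho>: "0 < \<rho>"
      and \<eta>near: "0 < \<eta>near" and \<eta>com: "0 < \<eta>com" by auto
    have K: "0 < Cchi \<tau>0 \<tau>1 chi" "\<And>\<tau> y. \<tau> \<in> {\<tau>0..\<tau>1} \<Longrightarrow> norm (grad (chi \<tau>) y) \<le> Cchi \<tau>0 \<tau>1 chi"
      using someI_ex[OF cutoff_gradient_bound[OF cp, unfolded Bex_def]] unfolding Cchi_def by blast+
    have tau: "-1 < \<tau>0" "\<tau>0 < \<tau>1" "\<tau>1 < 0" using cp by (auto simp: cutoff_profile_def)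
    have Cm: "0 < main_const \<sigma> \<tau>0 \<tau>1 \<phi>" by (rule main_const_pos[OF \<sigma> tau(2)])
    have Cc: "0 < Ccom \<eta>com \<phi>" using kernel_grad_pos[OF \<phi>] \<eta>com by (simp add: Ccom_def)
    obtain g where g: "smooth g" "\<And>t x. t \<in> {\<tau>0..\<tau>1} \<Longrightarrow> chi t x = g (t, x)"
      using cp unfolding cutoff_profile_def by blast
    obtain Q where Q: "Q \<subseteq> ball 0 1" "\<And>t x. t \<in> {\<tau>0..\<tau>1} \<Longrightarrow> x \<notin> Q \<Longrightarrow> chi t x = 0"
      using cp unfolding cutoff_profile_def by blast
    have range: "0 \<le> chi t x \<and> chi t x \<le> 1" if "t \<in> {\<tau>0..\<tau>1}" for t x
      using cp that unfolding cutoff_profile_def by blast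
    \<comment> \<open>The estimate at a single scale, stated in \<open>ennreal\<close> because the
      defect may be infinite. Nonnegativity of the budget is proved alongside, since
      \<open>ennreal\<close> truncates negative values.\<close>
    have scale: "ennreal (surplus 1 \<eta>near \<eta>com \<phi> \<tau>0 \<tau>1 chi \<rho> x0 t0 u (rad k) (\<sigma> * rad k))
        \<le> ennreal (main_const \<sigma> \<tau>0 \<tau>1 \<phi> * ME I u powr (3 / 2) * 2 powr (3 * real k / 2))
          + ennreal (Ccom \<eta>com \<phi>) * increment_defect \<phi> \<tau>0 \<tau>1 chi x0 t0 p u (rad k) (\<sigma> * rad k)
          + ennreal (Lbud (Cchi \<tau>0 \<tau>1 chi) \<phi> \<tau>0 \<tau>1 chi \<rho> x0 t0 u (rad k) (\<sigma> * rad k)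
               + Lcom (Cchi \<tau>0 \<tau>1 chi) \<phi> \<tau>0 \<tau>1 chi x0 t0 u (rad k) (\<sigma> * rad k))"
      and budget: "0 \<le> Lbud (Cchi \<tau>0 \<tau>1 chi) \<phi> \<tau>0 \<tau>1 chi \<rho> x0 t0 u (rad k) (\<sigma> * rad k)
               + Lcom (Cchi \<tau>0 \<tau>1 chi) \<phi> \<tau>0 \<tau>1 chi x0 t0 u (rad k) (\<sigma> * rad k)"
      if L: "leray_hopf a I u" and sub: "{t0 - 1..t0} \<subseteq> I" and p: "2 \<le> p" for a I u t0 x0 p k
    proof -
      let ?r = "rad k" and ?l = "\<sigma> * rad k" and ?K = "Cchi \<tau>0 \<tau>1 chi" and ?v = "zero_ext I u"
      have r: "0 < ?r" "?r \<le> 1" by (simp_all add: rad_def)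
      obtain B where "flow ?v t0 B" using leray_hopf_flow[OF L sub] by blast
      then interpret flow ?v t0 B .
      interpret scale_setup ?v t0 B \<phi> \<tau>0 \<tau>1 chi g x0 ?r ?l u
      proof
        show "chi \<tau> y = 0" if "\<tau> \<in> {\<tau>0..\<tau>1}" "1 < norm y" for \<tau> y
          using Q(1) that by (intro Q(2)) auto
        show "u t = ?v t" if "t \<in> {t0 - 1..t0}" for t using sub that by (auto simp: zero_ext_def)
      qed (use \<phi> tau g range r \<sigma> in auto)
      have E: "AE t in lborel. t \<in> {t0 - 1..t0} \<longrightarrow> (\<integral>x. (norm (?v t x))\<^sup>2 \<partial>lborel) \<le> ME I u"
        using ME_bound[OF L] by (rule eventually_mono) (use sub in \<open>auto simp: zero_ext_def\<close>)
      have E0: "0 \<le> ME I u" by (simp add: ME_def)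
      let ?res = "\<bar>cutoff_residual \<phi> \<tau>0 \<tau>1 chi x0 t0 u ?r ?l\<bar>"
      let ?Lc = "Lcom ?K \<phi> \<tau>0 \<tau>1 chi x0 t0 u ?r ?l"
      let ?J = "?r * stint S (\<lambda>t x. X t x * (norm (V t x))\<^sup>2)"
      let ?m = "main_const \<sigma> \<tau>0 \<tau>1 \<phi> * ME I u powr (3 / 2) * 2 powr (3 * real k / 2)"
      let ?P = "Pdiff \<phi> \<tau>0 \<tau>1 chi x0 t0 u ?r ?l"
      have ineq: "Eout \<phi> \<tau>1 chi x0 t0 u ?r ?l + (1 - \<eta>com) * ?P - Ein \<phi> \<tau>0 chi x0 t0 u ?r ?l
          \<le> ?res + ?m + ?J / (2 * \<eta>com) + ?Lc"
        using scale_inequality[OF K(2) less_imp_le[OF K(1)] \<eta>com E E0 kernel_energy(2)]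
        unfolding stretching_scaling[OF r(1) \<sigma> E0] rad_powr .
      have ann: "0 \<le> annular_cost \<phi> \<tau>0 \<tau>1 chi \<rho> x0 t0 u ?r ?l" by (rule annular_cost_nonneg[OF \<rho>])
      have Lc: "0 \<le> ?Lc" using K(1) by (intro Lcom_nonneg) simp
      have P0: "0 \<le> ?P"
        unfolding Pdiff_eq using r cut_range
        by (intro mult_nonneg_nonneg stint_nonneg) (auto simp: grad_sq_def intro: sum_nonneg)
      have J0: "0 \<le> ?J" using r cut_range by (intro mult_nonneg_nonneg stint_nonneg) auto
      have O0: "0 \<le> Ores \<phi> \<tau>0 \<tau>1 chi x0 t0 u ?r ?l"
        unfolding Ores_def slab_eq using r cut_range
        by (intro mult_nonneg_nonneg stint_nonneg) (auto simp: cut_eq)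
      have M0: "0 \<le> Mloc \<rho> x0 t0 ?r u" unfolding Mloc_def using r by simp
      have m0: "0 \<le> ?m" using Cm by simp
      have Lb0: "0 \<le> Lbud ?K \<phi> \<tau>0 \<tau>1 chi \<rho> x0 t0 u ?r ?l" unfolding Lbud_def using ann Lc by simp
      show budget: "0 \<le> Lbud ?K \<phi> \<tau>0 \<tau>1 chi \<rho> x0 t0 u ?r ?l + ?Lc"
        using Lb0 Lc by simp
      have "surplus 1 \<eta>near \<eta>com \<phi> \<tau>0 \<tau>1 chi \<rho> x0 t0 u ?r ?l
          \<le> ?m + ?J / (2 * \<eta>com) + (Lbud ?K \<phi> \<tau>0 \<tau>1 chi \<rho> x0 t0 u ?r ?l + ?Lc)"
        unfolding surplus_def
      proof (rule max.boundedI)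
        show "0 \<le> ?m + ?J / (2 * \<eta>com) + (Lbud ?K \<phi> \<tau>0 \<tau>1 chi \<rho> x0 t0 u ?r ?l + ?Lc)"
          using m0 J0 \<eta>com Lb0 Lc by (intro add_nonneg_nonneg) auto
        \<comment> \<open>Both quantities enter the surplus with a minus sign, so a lower bound by 0
          is what the estimate asks of them.\<close>
        have "0 \<le> \<eta>near * ?P" "0 \<le> 1 * Mloc \<rho> x0 t0 ?r u * Ores \<phi> \<tau>0 \<tau>1 chi x0 t0 u ?r ?l"
          using \<eta>near P0 O0 M0 by simp_all
        moreover have "(1 - \<eta>near - \<eta>com) * ?P = (1 - \<eta>com) * ?P - \<eta>near * ?P" by (simp add: algebra_simps)
        \<comment> \<open>\<open>?res\<close> is an entry of \<open>Lbud\<close>, whose other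
          entries are nonnegative; the shell terms \<open>?Lc\<close> are paid by the separate
          copy.\<close>
        ultimately show "Eout \<phi> \<tau>1 chi x0 t0 u ?r ?l + (1 - \<eta>near - \<eta>com) * ?P - Ein \<phi> \<tau>0 chi x0 t0 u ?r ?l
            - 1 * Mloc \<rho> x0 t0 ?r u * Ores \<phi> \<tau>0 \<tau>1 chi x0 t0 u ?r ?l
          \<le> ?m + ?J / (2 * \<eta>com) + (Lbud ?K \<phi> \<tau>0 \<tau>1 chi \<rho> x0 t0 u ?r ?l + ?Lc)"
          using ineq ann Lc unfolding Lbud_def by linarith
      qed
      then have "ennreal (surplus 1 \<eta>near \<eta>com \<phi> \<tau>0 \<tau>1 chi \<rho> x0 t0 u ?r ?l)
          \<le> ennreal (?m + ?J / (2 * \<eta>com) + (Lbud ?K \<phi> \<tau>0 \<tau>1 chi \<rho> x0 t0 u ?r ?l + ?Lc))"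
        by (rule ennreal_leI)
      also have "\<dots> = ennreal ?m + ennreal (?J / (2 * \<eta>com)) + ennreal (Lbud ?K \<phi> \<tau>0 \<tau>1 chi \<rho> x0 t0 u ?r ?l + ?Lc)"
        using m0 J0 \<eta>com budget by (subst ennreal_plus, simp, simp, subst ennreal_plus) auto
      also have "ennreal (?J / (2 * \<eta>com)) = ennreal (1 / (2 * \<eta>com)) * ennreal ?J"
        using J0 \<eta>com by (subst ennreal_mult[symmetric]) auto
      also have "ennreal (1 / (2 * \<eta>com)) * ennreal ?J \<le> ennreal (1 / (2 * \<eta>com)) *
          (ennreal (81 * (\<integral>y. norm (grad \<phi> y) \<partial>lborel)\<^sup>2) * increment_defect \<phi> \<tau>0 \<tau>1 chi x0 t0 p u ?r ?l)"
        by (intro mult_left_mono stress_defect_bound p) simp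
      also have "\<dots> = ennreal (Ccom \<eta>com \<phi>) * increment_defect \<phi> \<tau>0 \<tau>1 chi x0 t0 p u ?r ?l"
        using \<eta>com by (simp add: Ccom_def mult.assoc[symmetric] ennreal_mult[symmetric])
      finally show "ennreal (surplus 1 \<eta>near \<eta>com \<phi> \<tau>0 \<tau>1 chi \<rho> x0 t0 u ?r ?l)
          \<le> ennreal ?m + ennreal (Ccom \<eta>com \<phi>) * increment_defect \<phi> \<tau>0 \<tau>1 chi x0 t0 p u ?r ?l
            + ennreal (Lbud ?K \<phi> \<tau>0 \<tau>1 chi \<rho> x0 t0 u ?r ?l + ?Lc)"
        by (simp add: add_mono)
    qed
    show "0 < Cchi \<tau>0 \<tau>1 chi \<and> 0 < (1::real) \<and> 0 < main_const \<sigma> \<tau>0 \<tau>1 \<phi> \<and> 0 < Ccom \<eta>com \<phi> \<and>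
      (\<forall>a I u t0 x0 p w N.
        leray_hopf a I u \<and> {t0 - 1..t0} \<subseteq> I \<and> 2 \<le> p \<and> p \<le> 4 \<and>
        (\<forall>k. 0 \<le> w k) \<and> summable (\<lambda>k. 2 powr (3 * real k / 2) * w k) \<longrightarrow>
        ennreal (\<Sum>k=0..N. w k *
            surplus 1 \<eta>near \<eta>com \<phi> \<tau>0 \<tau>1 chi \<rho> x0 t0 u (rad k) (\<sigma> * rad k))
        \<le> ennreal (main_const \<sigma> \<tau>0 \<tau>1 \<phi> * ME I u powr (3 / 2) * Wnorm w)
          + ennreal (Ccom \<eta>com \<phi>) * (\<Sum>k=0..N. ennreal (w k) *
              increment_defect \<phi> \<tau>0 \<tau>1 chi x0 t0 p u (rad k) (\<sigma> * rad k))
          + ennreal (\<Sum>k=0..N. w k *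
              (Lbud (Cchi \<tau>0 \<tau>1 chi) \<phi> \<tau>0 \<tau>1 chi \<rho> x0 t0 u (rad k) (\<sigma> * rad k)
               + Lcom (Cchi \<tau>0 \<tau>1 chi) \<phi> \<tau>0 \<tau>1 chi x0 t0 u (rad k) (\<sigma> * rad k))))"
    proof (intro conjI allI impI K(1) Cm Cc zero_less_one)
      fix a t0 p :: real and I u x0 and w :: "nat \<Rightarrow> real" and N
      assume H: "leray_hopf a I u \<and> {t0 - 1..t0} \<subseteq> I \<and> 2 \<le> p \<and> p \<le> 4 \<and>
        (\<forall>k. 0 \<le> w k) \<and> summable (\<lambda>k. 2 powr (3 * real k / 2) * w k)"
      then have L: "leray_hopf a I u" "{t0 - 1..t0} \<subseteq> I" "2 \<le> p" and w: "\<And>k. 0 \<le> w k"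
        and sw: "summable (\<lambda>k. 2 powr (3 * real k / 2) * w k)" by auto
      let ?s = "\<lambda>k. surplus 1 \<eta>near \<eta>com \<phi> \<tau>0 \<tau>1 chi \<rho> x0 t0 u (rad k) (\<sigma> * rad k)"
      let ?c = "main_const \<sigma> \<tau>0 \<tau>1 \<phi> * ME I u powr (3 / 2)"
      let ?d = "\<lambda>k. increment_defect \<phi> \<tau>0 \<tau>1 chi x0 t0 p u (rad k) (\<sigma> * rad k)"
      let ?b = "\<lambda>k. Lbud (Cchi \<tau>0 \<tau>1 chi) \<phi> \<tau>0 \<tau>1 chi \<rho> x0 t0 u (rad k) (\<sigma> * rad k)
               + Lcom (Cchi \<tau>0 \<tau>1 chi) \<phi> \<tau>0 \<tau>1 chi x0 t0 u (rad k) (\<sigma> * rad k)"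
      have s0: "0 \<le> ?s k" for k by (simp add: surplus_def)
      have c0: "0 \<le> ?c" using Cm by simp
      have b0: "0 \<le> ?b k" for k by (rule budget[OF L])
      have "ennreal (\<Sum>k=0..N. w k * ?s k) = (\<Sum>k=0..N. ennreal (w k) * ennreal (?s k))"
        using w s0 by (subst sum_ennreal[symmetric]) (auto simp: ennreal_mult)
      also have "\<dots> \<le> (\<Sum>k=0..N. ennreal (w k) *
          (ennreal (?c * 2 powr (3 * real k / 2)) + ennreal (Ccom \<eta>com \<phi>) * ?d k + ennreal (?b k)))"
        by (intro sum_mono mult_left_mono scale[OF L]) simp
      also have "\<dots> = (\<Sum>k=0..N. ennreal (?c * (2 powr (3 * real k / 2) * w k)))
          + ennreal (Ccom \<eta>com \<phi>) * (\<Sum>k=0..N. ennreal (w k) * ?d k) + (\<Sum>k=0..N. ennreal (w k * ?b k))"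
      proof -
        have "ennreal (w k) * (ennreal (?c * 2 powr (3 * real k / 2)) + ennreal (Ccom \<eta>com \<phi>) * ?d k + ennreal (?b k))
          = ennreal (?c * (2 powr (3 * real k / 2) * w k)) + ennreal (Ccom \<eta>com \<phi>) * (ennreal (w k) * ?d k) + ennreal (w k * ?b k)" for k
        proof -
          have "ennreal (w k) * ennreal (?c * 2 powr (3 * real k / 2)) = ennreal (w k * (?c * 2 powr (3 * real k / 2)))"
            using w c0 by (intro ennreal_mult[symmetric]) auto
          moreover have "w k * (?c * 2 powr (3 * real k / 2)) = ?c * (2 powr (3 * real k / 2) * w k)" by (simp only: mult_ac)
          moreover have "ennreal (w k) * ennreal (?b k) = ennreal (w k * ?b k)"
            using w b0 by (intro ennreal_mult[symmetric]) auto
          ultimately show ?thesis by (simp only: distrib_left mult.left_commute[of "ennreal (w k)" "ennreal (Ccom \<eta>com \<phi>)"])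
        qed
        then show ?thesis by (simp only: sum.distrib sum_distrib_left)
      qed
      also have "(\<Sum>k=0..N. ennreal (w k * ?b k)) = ennreal (\<Sum>k=0..N. w k * ?b k)"
        using w b0 by (intro sum_ennreal) auto
      also have "(\<Sum>k=0..N. ennreal (?c * (2 powr (3 * real k / 2) * w k)))
          = ennreal (\<Sum>k=0..N. ?c * (2 powr (3 * real k / 2) * w k))"
        using w c0 by (intro sum_ennreal) auto
      finally have total: "ennreal (\<Sum>k=0..N. w k * ?s k)
          \<le> ennreal (\<Sum>k=0..N. ?c * (2 powr (3 * real k / 2) * w k))
          + ennreal (Ccom \<eta>com \<phi>) * (\<Sum>k=0..N. ennreal (w k) * ?d k) + ennreal (\<Sum>k=0..N. w k * ?b k)" .
      \<comment> \<open>Partial sums of a summable nonnegative series stay below its total, which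
        makes this term independent of \<open>N\<close>.\<close>
      have "(\<Sum>k=0..N. 2 powr (3 * real k / 2) * w k) \<le> Wnorm w"
        unfolding Wnorm_def using w by (intro sum_le_suminf sw) auto
      then have "(\<Sum>k=0..N. ?c * (2 powr (3 * real k / 2) * w k)) \<le> ?c * Wnorm w"
        unfolding sum_distrib_left[symmetric] by (rule mult_left_mono[OF _ c0])
      then have "ennreal (\<Sum>k=0..N. ?c * (2 powr (3 * real k / 2) * w k)) \<le> ennreal (?c * Wnorm w)"
        by (rule ennreal_leI)
      then show "ennreal (\<Sum>k=0..N. w k * ?s k)
          \<le> ennreal (?c * Wnorm w) + ennreal (Ccom \<eta>com \<phi>) * (\<Sum>k=0..N. ennreal (w k) * ?d k)
            + ennreal (\<Sum>k=0..N. w k * ?b k)"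
        by (intro order_trans[OF total] add_mono) auto
    qed
  qed
qed

end
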